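(* Let $U\subset\mathbb{R}^n$ be open. For any classical symbol valued form $\beta\in\Omega\,CS(U)$ with compact support (in $U$), one has $$\mathrm{res}(d\beta)=0,$$ where $d$ is the exterior differential on $T^*U$ and $\mathrm{res}$ is the Wodzicki residue extended to symbol valued forms.
   Context: $U\subset\mathbb{R}^n$ is open, $T^*U=U\times\mathbb{R}^n$ with coordinates $(x,\xi)$, and $|\xi|$ is the Euclidean norm. $S^m(U)\subset C^\infty(T^*U)$ denotes the scalar symbols of order $m\in\mathbb{R}$. Fix a smooth function $\chi$ on $T^*U$ with $\chi=0$ for $|\xi|\le 1/2$ and $\chi=1$ for $|\xi|\ge 1$. A symbol $\sigma$ is classical of order $m\in\mathbb{C}$ ($\sigma\in CS^m(U)$) if for every positive integer $N$, $\sigma=\sum_{i=0}^N\chi\,\sigma_{m-i}+\sigma_{(N)}$ with $\sigma_{m-i}$ positively homogeneous of degree $m-i$ in $\xi\ne0$ and $\sigma_{(N)}$ a symbol of order $m-N-1$ (i.e. $\mathrm{Re}(m)-N-1$). $CS(U)$ is the algebra generated by all $CS^m(U)$, $m\in\mathbb{C}$; for $\sigma\in CS(U)$, $\sigma_{a}$ denotes its positively homogeneous component of degree $a$ (zero if absent), extended linearly to sums. $\Omega^kCS^m(U)$ is the set of $k$-forms $\alpha=\sum_{|I|+|J|=k}\alpha_{I,J}(x,\xi)\,dx_I\wedge d\xi_J$ on $T^*U$ with $\alpha_{I,J}\in CS^{m-|J|}(U)$ ($I,J\subset\{1,\dots,n\}$), and $\Omega\,CS(U)$ is generated by such forms of all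 orders and degrees. Compact support means compact support in $x\in U$. For $\sigma\in CS(U)$ with compact support, $\mathrm{res}(\sigma)=\int_U\int_{|\xi|=1}\sigma_{-n}(x,\xi)\,d_S\xi\,dx$, with $d_S\xi=\sum_{i=1}^n(-1)^{i+1}\xi_i\,d\xi_1\wedge\cdots\wedge\widehat{d\xi_i}\wedge\cdots\wedge d\xi_n$. For a form $\alpha=\sum_{I,J}\alpha_{I,J}\,dx_I\wedge d\xi_J$ with compact support, $\mathrm{res}(\alpha)=\mathrm{res}(\alpha_{I,J})$ for $|I|=|J|=n$, and the terms with $|I|\neq n$ or $|J|\ne n$ contribute $0$. *)

theory Defs
  imports "HOL-Analysis.Analysis"
begin

section \<open>Smooth functions and partial derivatives on the cotangent bundle\<close>

text \<open>
  A point of \<open>T\<^sup>*U = U \<times> R\<^sup>n\<close> is a pair \<open>(x, \<xi>)\<close>. Functions on \<open>T\<^sup>*U\<close> are represented by total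
  functions; their values over points outside \<open>U\<close> are irrelevant to every notion below, since \<open>U\<close>
  is open. The order on the index type \<open>'n\<close> fixes the order of the coordinates.
\<close>

type_synonym 'n pt = "(real^'n) \<times> (real^'n)"

definition smooth_on :: "'a::real_normed_vector set \<Rightarrow> ('a \<Rightarrow> 'b::real_normed_vector) \<Rightarrow> bool" where
  "smooth_on W f \<longleftrightarrow>
     (\<forall>vs. foldr (\<lambda>v g p. frechet_derivative g (at p) v) vs f differentiable_on W)"

definition dx :: "'n::finite \<Rightarrow> ('n pt \<Rightarrow> complex) \<Rightarrow> 'n pt \<Rightarrow> complex" where
  "dx i f = (\<lambda>p. frechet_derivative f (at p) (axis i 1, 0))"

definition dxi :: "'n::finite \<Rightarrow> ('n pt \<Rightarrow> complex) \<Rightarrow> 'n pt \<Rightarrow> complex" where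
  "dxi j f = (\<lambda>p. frechet_derivative f (at p) (0, axis j 1))"


section \<open>Symbols and classical symbols\<close>

text \<open>
  Multi-indices are written as lists of coordinate indices, so \<open>length js\<close> is the number of
  \<open>\<xi>\<close>-derivatives.
\<close>

definition symbol :: "(real^'n::finite) set \<Rightarrow> real \<Rightarrow> ('n pt \<Rightarrow> complex) \<Rightarrow> bool" where
  "symbol U m \<sigma> \<longleftrightarrow>
     smooth_on (U \<times> UNIV) \<sigma> \<and>
     (\<forall>K is js. compact K \<and> K \<subseteq> U \<longrightarrow>
        (\<exists>C. \<forall>x\<in>K. \<forall>\<xi>. norm (foldr dx is (foldr dxi js \<sigma>) (x, \<xi>))
                        \<le> C * (1 + norm \<xi>) powr (m - real (length js))))"

text \<open>The cut-off function of the \<open>\<xi>\<close>-variable is written \<open>\<kappa>\<close>, as the usual letter is the vector binder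
  of the library.\<close>

definition cutoff :: "(real^'n::finite) set \<Rightarrow> ('n pt \<Rightarrow> complex) \<Rightarrow> bool" where
  "cutoff U \<kappa> \<longleftrightarrow>
     smooth_on (U \<times> UNIV) \<kappa> \<and>
     (\<forall>x\<in>U. \<forall>\<xi>. (norm \<xi> \<le> 1/2 \<longrightarrow> \<kappa> (x, \<xi>) = 0) \<and> (norm \<xi> \<ge> 1 \<longrightarrow> \<kappa> (x, \<xi>) = 1))"

definition pos_homogeneous :: "(real^'n::finite) set \<Rightarrow> complex \<Rightarrow> ('n pt \<Rightarrow> complex) \<Rightarrow> bool" where
  "pos_homogeneous U a \<tau> \<longleftrightarrow>
     (\<forall>x\<in>U. \<forall>\<xi> t. \<xi> \<noteq> 0 \<and> t > 0 \<longrightarrow> \<tau> (x, t *\<^sub>R \<xi>) = complex_of_real t powr a * \<tau> (x, \<xi>))"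

text \<open>
  The sequence entry \<open>s i\<close> is the homogeneous component \<open>\<sigma>\<^bsub>m-i\<^esub>\<close>. It is a smooth function off the
  zero section; its value at \<open>\<xi> = 0\<close> is immaterial because \<open>\<kappa>\<close> vanishes there.
\<close>

definition classical_expansion ::
  "(real^'n::finite) set \<Rightarrow> ('n pt \<Rightarrow> complex) \<Rightarrow> complex \<Rightarrow> ('n pt \<Rightarrow> complex) \<Rightarrow>
   (nat \<Rightarrow> 'n pt \<Rightarrow> complex) \<Rightarrow> bool" where
  "classical_expansion U \<kappa> m \<sigma> s \<longleftrightarrow>
     symbol U (Re m) \<sigma> \<and>
     (\<forall>i. smooth_on (U \<times> (UNIV - {0})) (s i) \<and> pos_homogeneous U (m - of_nat i) (s i)) \<and>
     (\<forall>N>0. symbol U (Re m - real N - 1) (\<lambda>p. \<sigma> p - (\<Sum>i\<le>N. \<kappa> p * s i p)))"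

definition classical_symbol ::
  "(real^'n::finite) set \<Rightarrow> ('n pt \<Rightarrow> complex) \<Rightarrow> complex \<Rightarrow> ('n pt \<Rightarrow> complex) \<Rightarrow> bool" where
  "classical_symbol U \<kappa> m \<sigma> \<longleftrightarrow> (\<exists>s. classical_expansion U \<kappa> m \<sigma> s)"

text \<open>
  The homogeneous component of degree \<open>a\<close>, extended linearly to finite sums of classical symbols of
  arbitrary complex orders. As \<open>CS\<^sup>m(U) CS\<^sup>m'(U) \<subseteq> CS\<^sup>m\<^sup>+\<^sup>m'(U)\<close>, such sums exhaust the algebra
  \<open>CS(U)\<close>. The inner sum has at most one term, and is zero if degree \<open>a\<close> does not occur. The
  component is determined only over \<open>U\<close> and for \<open>\<xi> \<noteq> 0\<close>.
\<close>

definition is_component ::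
  "(real^'n::finite) set \<Rightarrow> ('n pt \<Rightarrow> complex) \<Rightarrow> ('n pt \<Rightarrow> complex) \<Rightarrow> complex \<Rightarrow>
   ('n pt \<Rightarrow> complex) \<Rightarrow> bool" where
  "is_component U \<kappa> \<sigma> a \<tau> \<longleftrightarrow>
     (\<exists>r m \<rho> s.
        (\<forall>k<r::nat. classical_expansion U \<kappa> (m k) (\<rho> k) (s k)) \<and>
        (\<forall>x\<in>U. \<forall>\<xi>. \<sigma> (x, \<xi>) = (\<Sum>k<r. \<rho> k (x, \<xi>))) \<and>
        (\<forall>x\<in>U. \<forall>\<xi>. \<xi> \<noteq> 0 \<longrightarrow>
           \<tau> (x, \<xi>) = (\<Sum>k<r. \<Sum>i | m k - of_nat i = a. s k i (x, \<xi>))))"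

definition component ::
  "(real^'n::finite) set \<Rightarrow> ('n pt \<Rightarrow> complex) \<Rightarrow> ('n pt \<Rightarrow> complex) \<Rightarrow> complex \<Rightarrow> 'n pt \<Rightarrow> complex" where
  "component U \<kappa> \<sigma> a = (SOME \<tau>. is_component U \<kappa> \<sigma> a \<tau>)"


section \<open>Differential forms on the cotangent bundle\<close>

text \<open>
  The form \<open>\<Sum> \<alpha>\<^bsub>I,J\<^esub> dx\<^sub>I \<and> d\<xi>\<^sub>J\<close> is represented by its coefficients \<open>\<alpha> I J\<close>, where the factors of
  \<open>dx\<^sub>I\<close> and \<open>d\<xi>\<^sub>J\<close> are taken in increasing order.
\<close>

type_synonym 'n form = "'n set \<Rightarrow> 'n set \<Rightarrow> 'n pt \<Rightarrow> complex"

text \<open>For disjoint \<open>A\<close> and \<open>B\<close>, \<open>dx\<^sub>A \<and> dx\<^sub>B = shuffle_sign A B dx\<^bsub>A\<union>B\<^esub>\<close>.\<close>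

definition shuffle_sign :: "'n::linorder set \<Rightarrow> 'n set \<Rightarrow> complex" where
  "shuffle_sign A B = (-1) ^ card {(a, b). a \<in> A \<and> b \<in> B \<and> b < a}"

text \<open>
  \<open>dx\<^sub>A \<and> d\<xi>\<^sub>B \<and> dx\<^sub>A\<^sub>' \<and> d\<xi>\<^sub>B\<^sub>' = (-1)\<^bsup>|B||A'|\<^esup> dx\<^sub>A \<and> dx\<^sub>A\<^sub>' \<and> d\<xi>\<^sub>B \<and> d\<xi>\<^sub>B\<^sub>'\<close>, with \<open>A' = I - A\<close> and
  \<open>B' = J - B\<close>.
\<close>

definition wedge :: "'n::{finite,linorder} form \<Rightarrow> 'n form \<Rightarrow> 'n form" where
  "wedge \<alpha> \<beta> I J p =
     (\<Sum>A\<in>Pow I. \<Sum>B\<in>Pow J.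
        (-1) ^ (card B * card (I - A)) * shuffle_sign A (I - A) * shuffle_sign B (J - B) *
        \<alpha> A B p * \<beta> (I - A) (J - B) p)"

definition basis_form :: "'n set \<Rightarrow> 'n set \<Rightarrow> 'n form" where
  "basis_form A B I J p = (if I = A \<and> J = B then 1 else 0)"

definition ext_d :: "'n::{finite,linorder} form \<Rightarrow> 'n form" where
  "ext_d \<alpha> I J p =
     (\<Sum>i\<in>UNIV. wedge (basis_form {i} {}) (\<lambda>A B. dx i (\<alpha> A B)) I J p) +
     (\<Sum>j\<in>UNIV. wedge (basis_form {} {j}) (\<lambda>A B. dxi j (\<alpha> A B)) I J p)"

definition classical_form ::
  "(real^'n::finite) set \<Rightarrow> ('n pt \<Rightarrow> complex) \<Rightarrow> nat \<Rightarrow> complex \<Rightarrow> 'n form \<Rightarrow> bool" where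
  "classical_form U \<kappa> k m \<alpha> \<longleftrightarrow>
     (\<forall>I J. card I + card J = k \<longrightarrow> classical_symbol U \<kappa> (m - of_nat (card J)) (\<alpha> I J)) \<and>
     (\<forall>I J. card I + card J \<noteq> k \<longrightarrow> (\<forall>x\<in>U. \<forall>\<xi>. \<alpha> I J (x, \<xi>) = 0))"

text \<open>The algebra (under sum, scalar multiples and exterior product) generated by these forms.\<close>

inductive_set \<Omega>CS :: "(real^'n::{finite,linorder}) set \<Rightarrow> ('n pt \<Rightarrow> complex) \<Rightarrow> 'n form set"
  for U :: "(real^'n::{finite,linorder}) set" and \<kappa> :: "'n pt \<Rightarrow> complex" where
  base: "classical_form U \<kappa> k m \<alpha> \<Longrightarrow> \<alpha> \<in> \<Omega>CS U \<kappa>"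
| add: "\<alpha> \<in> \<Omega>CS U \<kappa> \<Longrightarrow> \<beta> \<in> \<Omega>CS U \<kappa> \<Longrightarrow> (\<lambda>I J p. \<alpha> I J p + \<beta> I J p) \<in> \<Omega>CS U \<kappa>"
| scale: "\<alpha> \<in> \<Omega>CS U \<kappa> \<Longrightarrow> (\<lambda>I J p. c * \<alpha> I J p) \<in> \<Omega>CS U \<kappa>"
| wedge: "\<alpha> \<in> \<Omega>CS U \<kappa> \<Longrightarrow> \<beta> \<in> \<Omega>CS U \<kappa> \<Longrightarrow> wedge \<alpha> \<beta> \<in> \<Omega>CS U \<kappa>"

definition compactly_supported_form :: "(real^'n::finite) set \<Rightarrow> 'n form \<Rightarrow> bool" where
  "compactly_supported_form U \<alpha> \<longleftrightarrow>
     (\<exists>K. compact K \<and> K \<subseteq> U \<and> (\<forall>I J. \<forall>x\<in>U - K. \<forall>\<xi>. \<alpha> I J (x, \<xi>) = 0))"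


section \<open>Integration over the unit sphere and the residue\<close>

text \<open>
  The two open hemispheres \<open>\<xi>\<^sub>i > 0\<close> and \<open>\<xi>\<^sub>i < 0\<close> of the unit sphere are graphs over the open unit
  disc in the remaining coordinates. \<open>sphere_point i \<epsilon> \<eta>\<close> is the point over \<open>\<eta>\<close> with \<open>\<xi>\<^sub>i\<close> of sign \<open>\<epsilon>\<close>.
\<close>

definition sphere_point :: "'n::finite \<Rightarrow> real \<Rightarrow> ('n \<Rightarrow> real) \<Rightarrow> real^'n" where
  "sphere_point i \<epsilon> \<eta> =
     (\<chi> k. if k = i then \<epsilon> * sqrt (1 - (\<Sum>l\<in>UNIV - {i}. (\<eta> l)\<^sup>2)) else \<eta> k)"

text \<open>
  The integral of \<open>g d\<xi>\<^sub>1 \<and> \<dots> \<and> d\<xi>\<^sub>n\<close> with \<open>d\<xi>\<^sub>i\<close> omitted over the unit sphere, oriented as the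
  boundary of the ball: with respect to the coordinates \<open>(\<xi>\<^sub>k)\<^bsub>k \<noteq> i\<^esub>\<close>, the hemisphere of sign \<open>\<epsilon>\<close> has
  orientation \<open>\<epsilon> (-1)\<^bsup>i+1\<^esup>\<close>. Here \<open>(-1)\<^bsup>i+1\<^esup>\<close> is \<open>(-1) ^ card {k. k < i}\<close>. The form vanishes on the
  equator \<open>\<xi>\<^sub>i = 0\<close>.
\<close>

definition sphere_form_integral ::
  "'n::{finite,linorder} \<Rightarrow> (real^'n::{finite,linorder} \<Rightarrow> complex) \<Rightarrow> complex" where
  "sphere_form_integral i g =
     (let M = Pi\<^sub>M (UNIV - {i}) (\<lambda>_. lborel);
          D = {\<eta> \<in> space M. (\<Sum>l\<in>UNIV - {i}. (\<eta> l)\<^sup>2) < 1}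
      in (-1) ^ card {k. k < i} *
         (LINT \<eta>:D|M. g (sphere_point i 1 \<eta>) - g (sphere_point i (-1) \<eta>)))"

text \<open>The integral of \<open>f d\<^sub>S\<xi>\<close> over the unit sphere, for \<open>d\<^sub>S\<xi> = \<Sum>\<^sub>i (-1)\<^bsup>i+1\<^esup> \<xi>\<^sub>i d\<xi>\<^sub>1 \<and> \<dots> \<and> d\<xi>\<^sub>n\<close>
  (\<open>d\<xi>\<^sub>i\<close> omitted).\<close>

definition sphere_integral :: "(real^'n::{finite,linorder} \<Rightarrow> complex) \<Rightarrow> complex" where
  "sphere_integral f =
     (\<Sum>i\<in>UNIV. (-1) ^ card {k. k < i} * sphere_form_integral i (\<lambda>\<xi>. complex_of_real (\<xi> $ i) * f \<xi>))"

definition res_symbol ::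
  "(real^'n::{finite,linorder}) set \<Rightarrow> ('n pt \<Rightarrow> complex) \<Rightarrow> ('n pt \<Rightarrow> complex) \<Rightarrow> complex" where
  "res_symbol U \<kappa> \<sigma> =
     (LINT x:U|lborel. sphere_integral (\<lambda>\<xi>. component U \<kappa> \<sigma> (- of_nat CARD('n)) (x, \<xi>)))"

definition res_form ::
  "(real^'n::{finite,linorder}) set \<Rightarrow> ('n pt \<Rightarrow> complex) \<Rightarrow> 'n form \<Rightarrow> complex" where
  "res_form U \<kappa> \<alpha> = res_symbol U \<kappa> (\<alpha> UNIV UNIV)"

end

theory Submission
  imports Defs "HOL-Library.Landau_Symbols"
begin

text \<open>
  In top degree, \<open>d\<beta>\<close> is a signed sum of derivatives \<open>\<partial>b/\<partial>x\<^sub>i\<close> and \<open>\<partial>g/\<partial>\<xi>\<^sub>j\<close> of coefficients of \<open>\<beta>\<close>, so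
  its component of degree \<open>-n\<close> is the same sum of derivatives of homogeneous components, of degree
  \<open>-n\<close> for \<open>b\<close> and \<open>1 - n\<close> for \<open>g\<close>. Components are unique, because a finite sum of powers \<open>t\<^sup>a\<close> with
  distinct complex exponents decays rapidly only if its coefficients vanish; hence they inherit
  the support of the coefficients in \<open>x\<close>.

  For \<open>f\<close> homogeneous of degree \<open>-n\<close> and \<open>\<Psi>\<close> supported in the annulus \<open>1 \<le> |\<xi>| \<le> 2\<close>, polar
  coordinates give \<open>\<integral> f(\<xi>) \<Psi>(|\<xi>|) d\<xi> = (\<integral> \<Psi>(r)/r dr) \<cdot> \<integral>\<^bsub>|\<xi>|=1\<^esub> f d\<^sub>S\<xi>\<close>. So the residue is, up to a
  nonzero constant, the integral over \<open>U \<times> R\<^sup>n\<close> of the component times a radial weight \<open>w\<close>, and one can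
  integrate by parts there. A derivative in \<open>x\<^sub>i\<close> contributes nothing, and one in \<open>\<xi>\<^sub>j\<close> leaves
  \<open>- \<integral> g \<partial>w/\<partial>\<xi>\<^sub>j\<close>, which the polar formula evaluates to a multiple of \<open>\<integral> w'(r) dr = 0\<close>.
\<close>


section \<open>Directional derivatives and smooth functions\<close>

text \<open>The sphere is only given through hemisphere graphs, whose square root is not
  differentiable on the equator. Over flat space, derivatives in fixed directions suffice, and
  translation invariance of Lebesgue measure yields integration by parts.

  The polar formula is matched to the hemispheres by the identity \<open>1 = (\<Sum>i\<in>UNIV.
  (\<xi> $ i)\<^sup>2 / (norm \<xi>)\<^sup>2)\<close> off the origin. The summand of index
  \<open>i\<close> vanishes on the equator of the two graphs in direction \<open>i\<close>, and its
  integral is exactly the term of index \<open>i\<close> in the form on the sphere, so no partition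
  of the sphere is needed.

  Since \<open>component\<close> is an arbitrary choice, uniqueness must hold for sums of arbitrary
  complex orders. Exponents with equal real part oscillate against each other, so the coefficients
  cannot be peeled off by limits alone; dilations \<open>t \<mapsto> h * t\<close> separate them.

  Symbol estimates prescribe an order of differentiation (first in \<xi>, then in x), which is why
  symmetry of second derivatives is proved before any closure property of symbols.\<close>

definition dird :: "'a::real_normed_vector \<Rightarrow> ('a \<Rightarrow> 'b::real_normed_vector) \<Rightarrow> 'a \<Rightarrow> 'b" where
  "dird v f = (\<lambda>p. frechet_derivative f (at p) v)"

lemma dx_eq_dird: "dx i = dird (axis i 1, 0)"
  by (simp add: fun_eq_iff dx_def dird_def)

lemma dxi_eq_dird: "dxi j = dird (0, axis j 1)"
  by (simp add: fun_eq_iff dxi_def dird_def)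

lemma frechet_derivative_cong_open:
  assumes "open W" "x \<in> W" "\<And>y. y \<in> W \<Longrightarrow> f y = g y"
  shows "frechet_derivative f (at x) = frechet_derivative g (at x)"
proof -
  have "(f has_derivative f') (at x) \<longleftrightarrow> (g has_derivative f') (at x)" for f'
    using assms has_derivative_transform_within_open[of f f' x UNIV W g]
      has_derivative_transform_within_open[of g f' x UNIV W f] by auto
  then show ?thesis by (simp add: frechet_derivative_def)
qed

lemma dird_cong:
  assumes "open W" "x \<in> W" "\<And>y. y \<in> W \<Longrightarrow> f y = g y"
  shows "dird v f x = dird v g x"
  using frechet_derivative_cong_open[OF assms] by (simp add: dird_def)

lemma differentiable_on_cong_open:
  assumes "open W" "f differentiable_on W" "\<And>y. y \<in> W \<Longrightarrow> f y = g y"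
  shows "g differentiable_on W"
proof -
  have "g differentiable at x" if "x \<in> W" for x
    using assms that has_derivative_transform_within_open[of f _ x UNIV W g]
    unfolding differentiable_on_eq_differentiable_at[OF assms(1)] differentiable_def by metis
  then show ?thesis using assms(1) by (simp add: differentiable_on_eq_differentiable_at)
qed

lemma dird_eq: "(f has_derivative f') (at p) \<Longrightarrow> dird v f p = f' v"
  unfolding dird_def using frechet_derivative_at by metis

lemma differentiable_has_dird:
  "f differentiable at p \<Longrightarrow> (f has_derivative (\<lambda>v. dird v f p)) (at p)"
  unfolding dird_def using frechet_derivative_works by (metis (no_types, lifting) ext)

lemma dird_const [simp]: "dird v (\<lambda>p. c) = (\<lambda>p. 0)"
  by (simp add: dird_def fun_eq_iff)

lemma dird_add:
  assumes "f differentiable at p" "g differentiable at p"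
  shows "dird v (\<lambda>q. f q + g q) p = dird v f p + dird v g p"
  by (rule dird_eq[OF has_derivative_add[OF assms[THEN differentiable_has_dird]]])

lemma dird_sum:
  assumes "\<And>i. i \<in> I \<Longrightarrow> f i differentiable at p"
  shows "dird v (\<lambda>q. \<Sum>i\<in>I. f i q) p = (\<Sum>i\<in>I. dird v (f i) p)"
  by (rule dird_eq[OF has_derivative_sum]) (rule differentiable_has_dird[OF assms])

lemma dird_mult:
  fixes f g :: "_ \<Rightarrow> _::real_normed_algebra"
  assumes "f differentiable at p" "g differentiable at p"
  shows "dird v (\<lambda>q. f q * g q) p = dird v f p * g p + f p * dird v g p"
  using dird_eq[OF has_derivative_mult[OF assms[THEN differentiable_has_dird]], of v] by simp

lemma dird_bounded_linear:
  assumes "bounded_linear h" "f differentiable at p"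
  shows "dird v (\<lambda>q. h (f q)) p = h (dird v f p)"
  by (rule dird_eq[OF bounded_linear.has_derivative[OF assms(1) differentiable_has_dird[OF assms(2)]]])


text \<open>Smoothness cut off at a finite order, recursing on the derivative that is taken first.
  The Leibniz rule then turns a statement about a product into statements about products of lower
  order, and closure properties follow by induction with the functions generalized.\<close>

primrec diff_times :: "nat \<Rightarrow> 'a::real_normed_vector set \<Rightarrow> ('a \<Rightarrow> 'b::real_normed_vector) \<Rightarrow> bool" where
  "diff_times 0 W f \<longleftrightarrow> f differentiable_on W"
| "diff_times (Suc n) W f \<longleftrightarrow> f differentiable_on W \<and> (\<forall>v. diff_times n W (dird v f))"

lemma diff_times_differentiable: "diff_times n W f \<Longrightarrow> f differentiable_on W"
  by (cases n) auto

lemma diff_times_foldr: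
  "diff_times n W f \<longleftrightarrow> (\<forall>vs. length vs \<le> n \<longrightarrow> foldr dird vs f differentiable_on W)"
proof (induction n arbitrary: f)
  case 0
  then show ?case by simp
next
  case (Suc n)
  \<comment> \<open>\<open>foldr\<close> applies the last list entry first, so lists are split at
    their end to match the recursion of \<open>diff_times\<close>.\<close>
  have "(\<forall>vs. length vs \<le> Suc n \<longrightarrow> P vs) \<longleftrightarrow> P [] \<and> (\<forall>v vs. length vs \<le> n \<longrightarrow> P (vs @ [v]))"
    for P :: "'a list \<Rightarrow> bool"
  proof safe
    fix vs :: "'a list" assume "P []" "\<forall>v vs. length vs \<le> n \<longrightarrow> P (vs @ [v])" "length vs \<le> Suc n"
    then show "P vs" by (cases vs rule: rev_cases) auto
  qed auto
  then show ?case by (simp add: Suc)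
qed

lemma smooth_on_iff: "smooth_on W f \<longleftrightarrow> (\<forall>n. diff_times n W f)"
proof -
  have "smooth_on W f \<longleftrightarrow> (\<forall>vs. foldr dird vs f differentiable_on W)"
    by (simp add: smooth_on_def dird_def[abs_def])
  then show ?thesis by (auto simp: diff_times_foldr)
qed

lemma smooth_on_dird: "smooth_on W f \<Longrightarrow> smooth_on W (dird v f)"
  unfolding smooth_on_iff by (metis diff_times.simps(2))

lemma smooth_on_differentiable_at:
  "smooth_on W f \<Longrightarrow> open W \<Longrightarrow> p \<in> W \<Longrightarrow> f differentiable at p"
  unfolding smooth_on_iff
  using diff_times_differentiable differentiable_on_eq_differentiable_at by blast

lemma smooth_on_continuous_on: "smooth_on W f \<Longrightarrow> continuous_on W f"
  unfolding smooth_on_iff using diff_times_differentiable differentiable_imp_continuous_on by blast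

lemma diff_times_cong:
  assumes "open W" "diff_times n W f" "\<And>y. y \<in> W \<Longrightarrow> f y = g y"
  shows "diff_times n W g"
  using assms(2,3)
proof (induction n arbitrary: f g)
  case 0
  then show ?case using differentiable_on_cong_open[OF assms(1)] by (metis diff_times.simps(1))
next
  case (Suc n)
  have "diff_times n W (dird v g)" for v
    using Suc.IH[of "dird v f"] Suc.prems dird_cong[OF assms(1)] by (metis diff_times.simps(2))
  then show ?case
    using Suc.prems differentiable_on_cong_open[OF assms(1)] by (metis diff_times.simps(2))
qed

lemma diff_times_mono: "diff_times (Suc n) W f \<Longrightarrow> diff_times n W f"
  by (simp add: diff_times_foldr)

lemma diff_times_add:
  assumes "open W" "diff_times n W f" "diff_times n W g"
  shows "diff_times n W (\<lambda>p. f p + g p)"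
  using assms(2,3)
proof (induction n arbitrary: f g)
  case (Suc n)
  have "diff_times n W (dird v (\<lambda>p. f p + g p))" for v
  proof (rule diff_times_cong[OF assms(1)])
    show "diff_times n W (\<lambda>p. dird v f p + dird v g p)"
      using Suc by auto
    show "dird v f y + dird v g y = dird v (\<lambda>p. f p + g p) y" if "y \<in> W" for y
      using Suc.prems that assms(1) differentiable_on_eq_differentiable_at
      by (subst dird_add) auto
  qed
  then show ?case using Suc.prems by auto
qed auto

lemma diff_times_mult:
  fixes f g :: "_ \<Rightarrow> _::real_normed_algebra"
  assumes "open W" "diff_times n W f" "diff_times n W g"
  shows "diff_times n W (\<lambda>p. f p * g p)"
  using assms(2,3)
proof (induction n arbitrary: f g)
  case (Suc n)
  have "diff_times n W (dird v (\<lambda>p. f p * g p))" for v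
  proof (rule diff_times_cong[OF assms(1)])
    show "diff_times n W (\<lambda>p. dird v f p * g p + f p * dird v g p)"
      using Suc.prems diff_times_mono[OF Suc.prems(1)] diff_times_mono[OF Suc.prems(2)]
      by (intro diff_times_add assms(1) Suc.IH) auto
    show "dird v f y * g y + f y * dird v g y = dird v (\<lambda>p. f p * g p) y" if "y \<in> W" for y
      using Suc.prems that assms(1) differentiable_on_eq_differentiable_at
      by (subst dird_mult) auto
  qed
  moreover have "(\<lambda>p. f p * g p) differentiable_on W"
    using Suc.prems by (auto simp: differentiable_on_def intro: differentiable_mult)
  ultimately show ?case by auto
qed (auto simp: differentiable_on_def intro: differentiable_mult)

lemma diff_times_Un:
  assumes "open V" "open W" "diff_times n V f" "diff_times n W f"
  shows "diff_times n (V \<union> W) f"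
  using assms(3,4) 
  by (induction n arbitrary: f) (auto simp: assms(1,2) open_Un differentiable_on_eq_differentiable_at)

lemma diff_times_subset: "V \<subseteq> W \<Longrightarrow> diff_times n W f \<Longrightarrow> diff_times n V f"
  by (induction n arbitrary: f) (auto intro: differentiable_on_subset)

lemma diff_times_const: "diff_times n W (\<lambda>p. c)"
  by (induction n arbitrary: c) auto

lemma smooth_on_const: "smooth_on W (\<lambda>p. c)"
  by (simp add: smooth_on_iff diff_times_const)

lemma smooth_on_cong:
  "open W \<Longrightarrow> smooth_on W f \<Longrightarrow> (\<And>y. y \<in> W \<Longrightarrow> f y = g y) \<Longrightarrow> smooth_on W g"
  unfolding smooth_on_iff using diff_times_cong by blast

lemma smooth_on_add:
  "open W \<Longrightarrow> smooth_on W f \<Longrightarrow> smooth_on W g \<Longrightarrow> smooth_on W (\<lambda>p. f p + g p)"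
  unfolding smooth_on_iff using diff_times_add by blast

lemma smooth_on_mult:
  fixes f g :: "_ \<Rightarrow> _::real_normed_algebra"
  shows "open W \<Longrightarrow> smooth_on W f \<Longrightarrow> smooth_on W g \<Longrightarrow> smooth_on W (\<lambda>p. f p * g p)"
  unfolding smooth_on_iff using diff_times_mult by blast

lemma smooth_on_Un:
  "open V \<Longrightarrow> open W \<Longrightarrow> smooth_on V f \<Longrightarrow> smooth_on W f \<Longrightarrow> smooth_on (V \<union> W) f"
  unfolding smooth_on_iff using diff_times_Un by blast

lemma smooth_on_subset: "V \<subseteq> W \<Longrightarrow> smooth_on W f \<Longrightarrow> smooth_on V f"
  unfolding smooth_on_iff using diff_times_subset by blast

lemma smooth_on_diff:
  fixes f g :: "'a::real_normed_vector \<Rightarrow> 'b::real_normed_algebra_1"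
  shows "open W \<Longrightarrow> smooth_on W f \<Longrightarrow> smooth_on W g \<Longrightarrow> smooth_on W (\<lambda>p. f p - g p)"
  using smooth_on_add[of W f "\<lambda>p. (-1) * g p"] smooth_on_mult[of W "\<lambda>p. -1" g]
    smooth_on_const[of W "-1 :: 'b"] by simp

lemma smooth_on_sum:
  assumes "open W" "\<And>i. i \<in> I \<Longrightarrow> smooth_on W (f i)"
  shows "smooth_on W (\<lambda>p. \<Sum>i\<in>I. f i p)"
  using assms(2)
  by (induction I rule: infinite_finite_induct) (auto intro: smooth_on_const smooth_on_add assms(1))

lemma dird_diff:
  assumes "f differentiable at p" "g differentiable at p"
  shows "dird v (\<lambda>q. f q - g q) p = dird v f p - dird v g p"
  by (rule dird_eq[OF has_derivative_diff[OF assms[THEN differentiable_has_dird]]])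


section \<open>Symmetry of second derivatives\<close>

text \<open>The mean value theorem is applied twice: to the increment in direction \<open>v\<close>
  as a function of the step along \<open>u\<close>, then to \<open>dird u f\<close> along
  \<open>v\<close>. The left side is symmetric in \<open>u\<close> and \<open>v\<close>, which is
  what makes the two mixed derivatives comparable.\<close>

lemma second_difference_mvt:
  fixes f :: "'a::real_normed_vector \<Rightarrow> real"
  assumes W: "open W" and f: "smooth_on W f" and h: "h > 0"
    and in_W: "\<And>s t. 0 \<le> s \<Longrightarrow> s \<le> h \<Longrightarrow> 0 \<le> t \<Longrightarrow> t \<le> h \<Longrightarrow> p + s *\<^sub>R u + t *\<^sub>R v \<in> W"
  shows "\<exists>s\<in>{0..h}. \<exists>t\<in>{0..h}.
    f (p + h *\<^sub>R u + h *\<^sub>R v) - f (p + h *\<^sub>R u) - f (p + h *\<^sub>R v) + f p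
      = h * h * dird v (dird u f) (p + s *\<^sub>R u + t *\<^sub>R v)"
proof -
  have line: "((\<lambda>s. g (q + s *\<^sub>R w)) has_real_derivative dird w g (q + s *\<^sub>R w)) (at s)"
    if g: "smooth_on W g" "q + s *\<^sub>R w \<in> W" for g :: "'a \<Rightarrow> real" and q w s
  proof -
    have "((\<lambda>s. q + s *\<^sub>R w) has_derivative (\<lambda>d. d *\<^sub>R w)) (at s)"
      by (auto intro!: derivative_eq_intros)
    moreover have D: "(g has_derivative (\<lambda>v. dird v g (q + s *\<^sub>R w))) (at (q + s *\<^sub>R w))"
      using differentiable_has_dird smooth_on_differentiable_at[OF g(1) W g(2)] by blast
    ultimately have "((\<lambda>s. g (q + s *\<^sub>R w)) has_derivative (\<lambda>d. dird (d *\<^sub>R w) g (q + s *\<^sub>R w))) (at s)"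
      using has_derivative_compose by blast
    moreover have "dird (d *\<^sub>R w) g (q + s *\<^sub>R w) = dird w g (q + s *\<^sub>R w) * d" for d
      using linear_scale[OF has_derivative_linear[OF D], of d w] by simp
    ultimately show ?thesis by (simp add: has_field_derivative_def)
  qed
  define A where "A s = f ((p + h *\<^sub>R v) + s *\<^sub>R u) - f (p + s *\<^sub>R u)" for s
  have "(A has_real_derivative (dird u f ((p + h *\<^sub>R v) + s *\<^sub>R u) - dird u f (p + s *\<^sub>R u))) (at s)"
    if "0 \<le> s" "s \<le> h" for s
    unfolding A_def using in_W[of s h] in_W[of s 0] that h
    by (intro DERIV_diff line f) (auto simp: algebra_simps)
  from MVT2[OF h this] obtain s where s: "0 < s" "s < h"
    "A h - A 0 = h * (dird u f ((p + h *\<^sub>R v) + s *\<^sub>R u) - dird u f (p + s *\<^sub>R u))"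
    by auto
  have "((\<lambda>t. dird u f ((p + s *\<^sub>R u) + t *\<^sub>R v)) has_real_derivative
      dird v (dird u f) ((p + s *\<^sub>R u) + t *\<^sub>R v)) (at t)" if "0 \<le> t" "t \<le> h" for t
    using in_W[of s t] that s by (intro line smooth_on_dird f) auto
  from MVT2[OF h this] obtain t where t: "0 < t" "t < h"
    "dird u f ((p + s *\<^sub>R u) + h *\<^sub>R v) - dird u f ((p + s *\<^sub>R u) + 0 *\<^sub>R v)
       = h * dird v (dird u f) ((p + s *\<^sub>R u) + t *\<^sub>R v)"
    by auto
  have "A h - A 0 = h * h * dird v (dird u f) (p + s *\<^sub>R u + t *\<^sub>R v)"
    using s(3) t(3) by (simp add: algebra_simps)
  then show ?thesis using s t unfolding A_def
    by (intro bexI[of _ s] bexI[of _ t]) (auto simp: algebra_simps)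
qed

text \<open>Near \<open>p\<close> each mixed derivative stays within half of the supposed gap of its
  value at \<open>p\<close>. Yet both take, at suitable points there, the value of the same second
  difference divided by \<open>h * h\<close>.\<close>

lemma dird_commute_real:
  fixes f :: "'a::real_normed_vector \<Rightarrow> real"
  assumes W: "open W" and f: "smooth_on W f" and p: "p \<in> W"
  shows "dird v (dird u f) p = dird u (dird v f) p"
proof (rule ccontr)
  let ?F = "dird v (dird u f)" and ?G = "dird u (dird v f)"
  assume neq: "?F p \<noteq> ?G p"
  define e where "e = \<bar>?F p - ?G p\<bar> / 2"
  have e: "e > 0" using neq by (simp add: e_def)
  have "continuous_on W ?F" "continuous_on W ?G"
    using f by (auto intro: smooth_on_continuous_on smooth_on_dird)
  then have "isCont ?F p" "isCont ?G p"
    using continuous_on_eq_continuous_at W p by blast+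
  then have "(?F \<longlongrightarrow> ?F p) (nhds p)" "(?G \<longlongrightarrow> ?G p) (nhds p)"
    by (auto simp: continuous_at tendsto_nhds_iff isCont_def)
  then have "\<forall>\<^sub>F q in nhds p. dist (?F q) (?F p) < e" "\<forall>\<^sub>F q in nhds p. dist (?G q) (?G p) < e"
    using e by (auto simp: tendsto_iff)
  moreover have "\<forall>\<^sub>F q in nhds p. q \<in> W" using W p by (simp add: eventually_nhds_in_open)
  ultimately have "\<forall>\<^sub>F q in nhds p. dist (?F q) (?F p) < e \<and> dist (?G q) (?G p) < e \<and> q \<in> W"
    by eventually_elim auto
  then obtain d where d: "d > 0" "\<And>q. dist q p < d \<Longrightarrow> dist (?F q) (?F p) < e \<and> dist (?G q) (?G p) < e \<and> q \<in> W"
    unfolding eventually_nhds_metric by blast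
  \<comment> \<open>Small enough that the whole parallelogram spanned by
    \<open>h *\<^sub>R u\<close> and \<open>h *\<^sub>R v\<close> stays within distance
    \<open>d\<close> of \<open>p\<close>. The summand 1 makes the estimate strict and covers
    \<open>u = v = 0\<close>.\<close>
  define h where "h = d / (norm u + norm v + 1)"
  have n: "norm u + norm v + 1 > 0" using norm_ge_zero[of u] norm_ge_zero[of v] by linarith
  have h: "h > 0" using d n by (simp add: h_def)
  have near: "dist (p + s *\<^sub>R u + t *\<^sub>R v) p < d" if "0 \<le> s" "s \<le> h" "0 \<le> t" "t \<le> h" for s t
  proof -
    have "norm (s *\<^sub>R u + t *\<^sub>R v) \<le> s * norm u + t * norm v"
      using norm_triangle_ineq[of "s *\<^sub>R u" "t *\<^sub>R v"] that by simp
    also have "\<dots> \<le> h * norm u + h * norm v" using that by (intro add_mono mult_right_mono) auto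
    also have "\<dots> < h * (norm u + norm v + 1)" using h by (simp add: algebra_simps)
    also have "\<dots> = d" using n by (simp add: h_def)
    finally show ?thesis by (simp add: dist_norm algebra_simps)
  qed
  obtain s t where st: "s \<in> {0..h}" "t \<in> {0..h}"
    "f (p + h *\<^sub>R u + h *\<^sub>R v) - f (p + h *\<^sub>R u) - f (p + h *\<^sub>R v) + f p = h * h * ?F (p + s *\<^sub>R u + t *\<^sub>R v)"
    using second_difference_mvt[OF W f h, of p u v] near d by blast
  have near': "dist (p + s *\<^sub>R v + t *\<^sub>R u) p < d" if "0 \<le> s" "s \<le> h" "0 \<le> t" "t \<le> h" for s t
    using near[of t s] that by (simp add: algebra_simps)
  obtain s' t' where st': "s' \<in> {0..h}" "t' \<in> {0..h}"
    "f (p + h *\<^sub>R v + h *\<^sub>R u) - f (p + h *\<^sub>R v) - f (p + h *\<^sub>R u) + f p = h * h * ?G (p + s' *\<^sub>R v + t' *\<^sub>R u)"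
    using second_difference_mvt[OF W f h, of p v u] near' d by blast
  have "h * h * ?F (p + s *\<^sub>R u + t *\<^sub>R v) = h * h * ?G (p + s' *\<^sub>R v + t' *\<^sub>R u)"
    using st(3) st'(3) by (simp add: algebra_simps)
  then have "?F (p + s *\<^sub>R u + t *\<^sub>R v) = ?G (p + s' *\<^sub>R v + t' *\<^sub>R u)"
    using h by simp
  moreover have "dist (?F (p + s *\<^sub>R u + t *\<^sub>R v)) (?F p) < e" using d near st by auto
  moreover have "dist (?G (p + s' *\<^sub>R v + t' *\<^sub>R u)) (?G p) < e" using d near' st' by auto
  ultimately show False unfolding e_def dist_real_def by (smt (verit) field_sum_of_halves)
qed

lemma smooth_on_bounded_linear:
  assumes "open W" "bounded_linear h" "smooth_on W f"
  shows "smooth_on W (\<lambda>p. h (f p))"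
proof -
  have "diff_times n W (\<lambda>p. h (g p))" if "diff_times n W g" for n g
    using that
  proof (induction n arbitrary: g)
    case 0
    then show ?case
      using assms(2) by (auto simp: differentiable_on_def intro: bounded_linear_imp_differentiable
          differentiable_compose)
  next
    case (Suc n)
    have "diff_times n W (dird v (\<lambda>p. h (g p)))" for v
      by (rule diff_times_cong[OF assms(1) Suc.IH[of "dird v g"]])
        (use Suc.prems assms in \<open>auto simp: dird_bounded_linear differentiable_on_eq_differentiable_at\<close>)
    moreover have "(\<lambda>p. h (g p)) differentiable_on W"
      using assms(2) Suc.prems by (auto simp: differentiable_on_def intro: bounded_linear_imp_differentiable
          differentiable_compose)
    ultimately show ?case by simp
  qed
  then show ?thesis using assms(3) by (simp add: smooth_on_iff)
qed

text \<open>The mean value theorem with an exact intermediate point fails for complex values, so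
  real and imaginary parts are treated separately.\<close>

lemma dird_commute:
  fixes f :: "'a::real_normed_vector \<Rightarrow> complex"
  assumes W: "open W" and f: "smooth_on W f" and p: "p \<in> W"
  shows "dird v (dird u f) p = dird u (dird v f) p"
proof -
  have *: "h (dird v (dird u f) p) = dird v (dird u (\<lambda>q. h (f q))) p"
    if h: "bounded_linear h" for h :: "complex \<Rightarrow> real" and u v
  proof -
    have "dird v (dird u (\<lambda>q. h (f q))) p = dird v (\<lambda>q. h (dird u f q)) p"
      using smooth_on_differentiable_at[OF f W]
      by (intro dird_cong[OF W p]) (simp add: dird_bounded_linear h)
    also have "\<dots> = h (dird v (dird u f) p)"
      using smooth_on_differentiable_at[OF smooth_on_dird[OF f] W p] by (simp add: dird_bounded_linear h)
    finally show ?thesis by simp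
  qed
  have "h (dird v (dird u f) p) = h (dird u (dird v f) p)" if h: "bounded_linear h" for h :: "complex \<Rightarrow> real"
    using dird_commute_real[OF W smooth_on_bounded_linear[OF W h f] p] by (simp add: * h)
  from this[OF bounded_linear_Re] this[OF bounded_linear_Im] show ?thesis
    by (simp add: complex_eq_iff)
qed


section \<open>Symbol estimates\<close>

definition growth :: "(real^'n::finite) set \<Rightarrow> real \<Rightarrow> ('n pt \<Rightarrow> complex) \<Rightarrow> bool" where
  "growth U m f \<longleftrightarrow> (\<forall>K. compact K \<and> K \<subseteq> U \<longrightarrow>
     (\<exists>C. \<forall>x\<in>K. \<forall>\<xi>. norm (f (x, \<xi>)) \<le> C * (1 + norm \<xi>) powr m))"

text \<open>The symbol estimates up to order \<open>n\<close>, with the derivatives in x and \<xi>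
  taken in any order. Each \<xi>-derivative costs one power of growth. In this recursive form the
  Leibniz rule can be used by induction on \<open>n\<close>.\<close>

primrec growth_times :: "nat \<Rightarrow> (real^'n::finite) set \<Rightarrow> real \<Rightarrow> ('n pt \<Rightarrow> complex) \<Rightarrow> bool" where
  "growth_times 0 U m f \<longleftrightarrow> growth U m f"
| "growth_times (Suc n) U m f \<longleftrightarrow> growth U m f \<and>
     (\<forall>i. growth_times n U m (dx i f)) \<and> (\<forall>j. growth_times n U (m - 1) (dxi j f))"

lemma smooth_on_dx: "smooth_on W f \<Longrightarrow> smooth_on W (dx i f)"
  and smooth_on_dxi: "smooth_on W f \<Longrightarrow> smooth_on W (dxi i f)"
  by (simp_all add: dx_eq_dird dxi_eq_dird smooth_on_dird)

lemma smooth_on_foldr_dxi: "smooth_on W f \<Longrightarrow> smooth_on W (foldr dxi js f)"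
  by (induction js) (auto intro: smooth_on_dxi)

lemma dx_cong:
  "open W \<Longrightarrow> p \<in> W \<Longrightarrow> (\<And>q. q \<in> W \<Longrightarrow> f q = g q) \<Longrightarrow> dx i f p = dx i g p"
  and dxi_cong:
  "open W \<Longrightarrow> p \<in> W \<Longrightarrow> (\<And>q. q \<in> W \<Longrightarrow> f q = g q) \<Longrightarrow> dxi i f p = dxi i g p"
  unfolding dx_eq_dird dxi_eq_dird by (erule (1) dird_cong; simp)+

lemma foldr_dx_cong:
  assumes "open W" "\<And>q. q \<in> W \<Longrightarrow> f q = g q"
  shows "p \<in> W \<Longrightarrow> foldr dx is f p = foldr dx is g p"
proof (induction "is" arbitrary: p)
  case (Cons i "is")
  show ?case using dx_cong[OF assms(1) Cons.prems Cons.IH] by simp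
qed (simp add: assms)

text \<open>In \<open>symbol\<close> the x-derivatives come after the \<xi>-derivatives. To see that
  \<open>dx i f\<close> is a symbol, its derivative has to be moved outwards past all
  \<open>dxi\<close>; here symmetry of second derivatives enters.\<close>

lemma foldr_dxi_dx:
  assumes W: "open W" and f: "smooth_on W f"
  shows "p \<in> W \<Longrightarrow> foldr dxi js (dx i f) p = dx i (foldr dxi js f) p"
proof (induction js arbitrary: p)
  case (Cons j js)
  have a: "dxi j (foldr dxi js (dx i f)) p = dxi j (dx i (foldr dxi js f)) p"
    by (rule dxi_cong[OF W Cons.prems Cons.IH])
  have b: "dxi j (dx i (foldr dxi js f)) p = dx i (dxi j (foldr dxi js f)) p"
    unfolding dx_eq_dird[of i] dxi_eq_dird[of j]
    by (rule dird_commute[OF W smooth_on_foldr_dxi[OF f] Cons.prems])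
  show ?case using a b by (simp only: foldr.simps o_apply)
qed simp

lemma symbol_dxi: 
  assumes "symbol U m f" shows "symbol U (m - 1) (dxi j f)"
proof -
  have "\<exists>C. \<forall>x\<in>K. \<forall>\<xi>. norm (foldr dx is (foldr dxi js (dxi j f)) (x, \<xi>))
      \<le> C * (1 + norm \<xi>) powr (m - 1 - real (length js))" if K: "compact K" "K \<subseteq> U" for K "is" js
  proof -
    have "\<exists>C. \<forall>x\<in>K. \<forall>\<xi>. norm (foldr dx is (foldr dxi (js @ [j]) f) (x, \<xi>))
      \<le> C * (1 + norm \<xi>) powr (m - real (length (js @ [j])))"
      using assms K unfolding symbol_def by blast
    then show ?thesis by (simp add: algebra_simps)
  qed
  then show ?thesis using assms by (auto simp: symbol_def smooth_on_dxi)
qed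

lemma open_phase: "open U \<Longrightarrow> open (U \<times> (UNIV :: 'b::topological_space set))"
  by (simp add: open_Times)

lemma symbol_dx: 
  assumes U: "open U" and "symbol U m f" shows "symbol U m (dx i f)"
proof -
  have f: "smooth_on (U \<times> UNIV) f" using assms by (simp add: symbol_def)
  have *: "foldr dx is (foldr dxi js (dx i f)) (x, \<xi>) = foldr dx (is @ [i]) (foldr dxi js f) (x, \<xi>)"
    if "x \<in> U" for x \<xi> "is" js
    using foldr_dx_cong[OF open_phase[OF U] foldr_dxi_dx[OF open_phase[OF U] f], where p = "(x, \<xi>)"] that
    by simp
  have "\<exists>C. \<forall>x\<in>K. \<forall>\<xi>. norm (foldr dx is (foldr dxi js (dx i f)) (x, \<xi>))
      \<le> C * (1 + norm \<xi>) powr (m - real (length js))" if K: "compact K" "K \<subseteq> U" for K "is" js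
  proof -
    have "\<exists>C. \<forall>x\<in>K. \<forall>\<xi>. norm (foldr dx (is @ [i]) (foldr dxi js f) (x, \<xi>))
      \<le> C * (1 + norm \<xi>) powr (m - real (length js))"
      using assms K unfolding symbol_def by blast
    then obtain C where C: "\<And>x \<xi>. x \<in> K \<Longrightarrow> norm (foldr dx (is @ [i]) (foldr dxi js f) (x, \<xi>))
      \<le> C * (1 + norm \<xi>) powr (m - real (length js))" by blast
    have "norm (foldr dx is (foldr dxi js (dx i f)) (x, \<xi>))
      \<le> C * (1 + norm \<xi>) powr (m - real (length js))" if "x \<in> K" for x \<xi>
      using C[OF that, of \<xi>] K that by (subst *) auto
    then show ?thesis by blast
  qed
  then show ?thesis using f by (auto simp: symbol_def smooth_on_dx)
qed

lemma growthD:
  "growth U m f \<Longrightarrow> compact K \<and> K \<subseteq> U \<Longrightarrow>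
    \<exists>C. \<forall>x\<in>K. \<forall>\<xi>. norm (f (x, \<xi>)) \<le> C * (1 + norm \<xi>) powr m"
  by (simp add: growth_def)

lemma growthI:
  assumes "\<And>K. compact K \<Longrightarrow> K \<subseteq> U \<Longrightarrow>
    \<exists>C. \<forall>x\<in>K. \<forall>\<xi>. norm (f (x, \<xi>)) \<le> C * (1 + norm \<xi>) powr m"
  shows "growth U m f"
  unfolding growth_def using assms by simp

lemma symbol_growth:
  assumes "symbol U m f"
  shows "growth U m f"
proof (rule growthI)
  fix K assume "compact K" "K \<subseteq> U"
  then have K: "compact K \<and> K \<subseteq> U" by simp
  with assms[unfolded symbol_def, THEN conjunct2, rule_format, of K "[]" "[]"]
  show "\<exists>C. \<forall>x\<in>K. \<forall>\<xi>. norm (f (x, \<xi>)) \<le> C * (1 + norm \<xi>) powr m" by simp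
qed

text \<open>One direction rests on derivatives of symbols being symbols. In the other, every entry
  of a list of derivatives uses up one unit of \<open>n\<close>, which is harmless because
  \<open>n\<close> is arbitrary.\<close>

lemma symbol_iff:
  assumes U: "open U"
  shows "symbol U m f \<longleftrightarrow> smooth_on (U \<times> UNIV) f \<and> (\<forall>n. growth_times n U m f)"
proof safe
  fix n assume "symbol U m f"
  then show "growth_times n U m f"
  proof (induction n arbitrary: m f)
    case (Suc n)
    then show ?case by (simp add: symbol_growth symbol_dx[OF U] symbol_dxi)
  qed (simp add: symbol_growth)
next
  assume f: "smooth_on (U \<times> UNIV) f" "\<forall>n. growth_times n U m f"
  have 1: "growth_times n U (m - real (length js)) (foldr dxi js f)" for n js
  proof (induction js arbitrary: n)
    case (Cons j js)
    have "growth_times (Suc n) U (m - real (length js)) (foldr dxi js f)" by (rule Cons.IH)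
    then have "growth_times n U (m - real (length js) - 1) (dxi j (foldr dxi js f))" by simp
    moreover have "m - real (length js) - 1 = m - real (length (j # js))" by simp
    ultimately show ?case by (simp only: foldr.simps o_apply)
  qed (simp add: f(2)[rule_format])
  have 2: "growth_times n U (m - real (length js)) (foldr dx is (foldr dxi js f))" for n "is" js
  proof (induction "is" arbitrary: n)
    case (Cons i "is")
    have "growth_times (Suc n) U (m - real (length js)) (foldr dx is (foldr dxi js f))"
      by (rule Cons.IH)
    then have "growth_times n U (m - real (length js)) (dx i (foldr dx is (foldr dxi js f)))" by simp
    then show ?case by (simp only: foldr.simps o_apply)
  qed (simp add: 1)
  have 3: "growth U (m - real (length js)) (foldr dx is (foldr dxi js f))" for "is" js
    using 2[of 0] by simp
  show "symbol U m f" unfolding symbol_def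
    by (rule conjI, rule f(1), intro allI impI, rule 3[unfolded growth_def, rule_format])
qed (simp add: symbol_def)

lemma growth_cong:
  assumes "growth U m f" "\<And>x \<xi>. x \<in> U \<Longrightarrow> f (x, \<xi>) = g (x, \<xi>)"
  shows "growth U m g"
proof (rule growthI)
  fix K assume "compact K" "K \<subseteq> U"
  then have K: "compact K \<and> K \<subseteq> U" by simp
  obtain C where C0: "\<forall>x\<in>K. \<forall>\<xi>. norm (f (x, \<xi>)) \<le> C * (1 + norm \<xi>) powr m"
    using growthD[OF assms(1) K] ..
  then show "\<exists>C. \<forall>x\<in>K. \<forall>\<xi>. norm (g (x, \<xi>)) \<le> C * (1 + norm \<xi>) powr m"
    using K assms(2) by (intro exI[of _ C]) (auto simp: subset_iff)
qed

lemma growth_mono: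
  assumes "growth U m f" "m \<le> m'" shows "growth U m' f"
proof (rule growthI)
  fix K assume "compact K" "K \<subseteq> U"
  then have K: "compact K \<and> K \<subseteq> U" by simp
  obtain C where C0: "\<forall>x\<in>K. \<forall>\<xi>. norm (f (x, \<xi>)) \<le> C * (1 + norm \<xi>) powr m"
    using growthD[OF assms(1) K] ..
  note C = C0[rule_format]
  \<comment> \<open>The absolute value is taken because \<open>C\<close> may be negative when
    \<open>K\<close> is empty.\<close>
  have "norm (f (x, \<xi>)) \<le> \<bar>C\<bar> * (1 + norm \<xi>) powr m'" if "x \<in> K" for x \<xi>
  proof -
    have "C * (1 + norm \<xi>) powr m \<le> \<bar>C\<bar> * (1 + norm \<xi>) powr m'"
      by (rule mult_mono) (auto intro: powr_mono assms)
    then show ?thesis using C[OF that, of \<xi>] by linarith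
  qed
  then show "\<exists>C. \<forall>x\<in>K. \<forall>\<xi>. norm (f (x, \<xi>)) \<le> C * (1 + norm \<xi>) powr m'" by blast
qed

lemma growth_add:
  assumes "growth U m f" "growth U m g" shows "growth U m (\<lambda>p. f p + g p)"
proof (rule growthI)
  fix K assume "compact K" "K \<subseteq> U"
  then have K: "compact K \<and> K \<subseteq> U" by simp
  obtain C where C0: "\<forall>x\<in>K. \<forall>\<xi>. norm (f (x, \<xi>)) \<le> C * (1 + norm \<xi>) powr m"
    using growthD[OF assms(1) K] ..
  note C = C0[rule_format]
  obtain C' where C'0: "\<forall>x\<in>K. \<forall>\<xi>. norm (g (x, \<xi>)) \<le> C' * (1 + norm \<xi>) powr m"
    using growthD[OF assms(2) K] ..
  note C' = C'0[rule_format]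
  have "norm (f (x, \<xi>) + g (x, \<xi>)) \<le> (C + C') * (1 + norm \<xi>) powr m" if "x \<in> K" for x \<xi>
    using C[OF that, of \<xi>] C'[OF that, of \<xi>] norm_triangle_ineq[of "f (x, \<xi>)" "g (x, \<xi>)"]
    by (simp add: algebra_simps)
  then show "\<exists>C. \<forall>x\<in>K. \<forall>\<xi>. norm (f (x, \<xi>) + g (x, \<xi>)) \<le> C * (1 + norm \<xi>) powr m" by blast
qed

lemma growth_mult:
  assumes "growth U m f" "growth U m' g" shows "growth U (m + m') (\<lambda>p. f p * g p)"
proof (rule growthI)
  fix K assume "compact K" "K \<subseteq> U"
  then have K: "compact K \<and> K \<subseteq> U" by simp
  obtain C where C0: "\<forall>x\<in>K. \<forall>\<xi>. norm (f (x, \<xi>)) \<le> C * (1 + norm \<xi>) powr m"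
    using growthD[OF assms(1) K] ..
  note C = C0[rule_format]
  obtain C' where C'0: "\<forall>x\<in>K. \<forall>\<xi>. norm (g (x, \<xi>)) \<le> C' * (1 + norm \<xi>) powr m'"
    using growthD[OF assms(2) K] ..
  note C' = C'0[rule_format]
  have "norm (f (x, \<xi>) * g (x, \<xi>)) \<le> (C * C') * (1 + norm \<xi>) powr (m + m')" if "x \<in> K" for x \<xi>
    using mult_mono'[OF C[OF that, of \<xi>] C'[OF that, of \<xi>]]
    by (simp add: norm_mult powr_add algebra_simps)
  then show "\<exists>C. \<forall>x\<in>K. \<forall>\<xi>. norm (f (x, \<xi>) * g (x, \<xi>)) \<le> C * (1 + norm \<xi>) powr (m + m')" by blast
qed

lemma growth_times_growth: "growth_times n U m f \<Longrightarrow> growth U m f"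
  by (cases n) auto

lemma growth_times_Suc: "growth_times (Suc n) U m f \<Longrightarrow> growth_times n U m f"
proof (induction n arbitrary: m f)
  case (Suc n)
  have "growth_times n U m (dx i f)" "growth_times n U (m - 1) (dxi i f)" for i
    using Suc.prems by (auto intro!: Suc.IH simp del: growth_times.simps simp: growth_times.simps(2)[of "Suc n" U m f])
  then show ?case using Suc.prems by simp
qed simp

lemma growth_times_mono: "growth_times n U m f \<Longrightarrow> m \<le> m' \<Longrightarrow> growth_times n U m' f"
proof (induction n arbitrary: m m' f)
  case (Suc n)
  have "growth_times n U (m' - 1) (dxi j f)" for j
    by (rule Suc.IH[of "m - 1"]) (use Suc.prems in simp_all)
  moreover have "growth_times n U m' (dx j f)" for j
    by (rule Suc.IH[of m]) (use Suc.prems in simp_all)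
  moreover have "growth U m' f"
    by (rule growth_mono[of U m]) (use Suc.prems in simp_all)
  ultimately show ?case by simp
qed (simp add: growth_mono)

lemma growth_times_cong:
  assumes U: "open U"
  shows "growth_times n U m f \<Longrightarrow> (\<And>x \<xi>. x \<in> U \<Longrightarrow> f (x, \<xi>) = g (x, \<xi>)) \<Longrightarrow> growth_times n U m g"
proof (induction n arbitrary: m f g)
  case (Suc n)
  have *: "dx i f (x, \<xi>) = dx i g (x, \<xi>)" "dxi i f (x, \<xi>) = dxi i g (x, \<xi>)" if "x \<in> U" for i x \<xi>
    using dx_cong[OF open_phase[OF U], of "(x, \<xi>)" f g] dxi_cong[OF open_phase[OF U], of "(x, \<xi>)" f g]
      Suc.prems that by auto
  have "growth_times n U m (dx i g)" for i
    by (rule Suc.IH[of _ "dx i f"]) (use Suc.prems(1) * in simp_all)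
  moreover have "growth_times n U (m - 1) (dxi i g)" for i
    by (rule Suc.IH[of _ "dxi i f"]) (use Suc.prems(1) * in simp_all)
  moreover have "growth U m g"
    by (rule growth_cong[of U m f]) (use Suc.prems in simp_all)
  ultimately show ?case by simp
next
  case 0
  show ?case using growth_cong[of U m f g] 0 by simp
qed

lemma dx_add:
  "f differentiable at p \<Longrightarrow> g differentiable at p \<Longrightarrow> dx i (\<lambda>q. f q + g q) p = dx i f p + dx i g p"
  and dxi_add:
  "f differentiable at p \<Longrightarrow> g differentiable at p \<Longrightarrow> dxi i (\<lambda>q. f q + g q) p = dxi i f p + dxi i g p"
  by (simp_all add: dx_eq_dird dxi_eq_dird dird_add)

lemma dx_mult:
  "f differentiable at p \<Longrightarrow> g differentiable at p \<Longrightarrow>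
    dx i (\<lambda>q. f q * g q) p = dx i f p * g p + f p * dx i g p"
  and dxi_mult:
  "f differentiable at p \<Longrightarrow> g differentiable at p \<Longrightarrow>
    dxi i (\<lambda>q. f q * g q) p = dxi i f p * g p + f p * dxi i g p"
  by (simp_all add: dx_eq_dird dxi_eq_dird dird_mult)

lemma growth_times_add:
  assumes U: "open U"
  shows "smooth_on (U \<times> UNIV) f \<Longrightarrow> smooth_on (U \<times> UNIV) g \<Longrightarrow> 
    growth_times n U m f \<Longrightarrow> growth_times n U m g \<Longrightarrow> growth_times n U m (\<lambda>p. f p + g p)"
proof (induction n arbitrary: m f g)
  case (Suc n)
  note D = Suc.prems(1,2)[THEN smooth_on_differentiable_at, OF open_phase[OF U]]
  have "growth_times n U m (dx i (\<lambda>p. f p + g p))" for i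
    by (rule growth_times_cong[OF U Suc.IH[of "dx i f" "dx i g"]])
      (use Suc.prems D in \<open>auto simp: smooth_on_dx dx_add\<close>)
  moreover have "growth_times n U (m - 1) (dxi i (\<lambda>p. f p + g p))" for i
    by (rule growth_times_cong[OF U Suc.IH[of "dxi i f" "dxi i g"]])
      (use Suc.prems D in \<open>auto simp: smooth_on_dxi dxi_add\<close>)
  ultimately show ?case using Suc.prems growth_add by auto
qed (auto intro: growth_add)

lemma growth_times_mult:
  assumes U: "open U"
  shows "smooth_on (U \<times> UNIV) f \<Longrightarrow> smooth_on (U \<times> UNIV) g \<Longrightarrow>
    growth_times n U m f \<Longrightarrow> growth_times n U m' g \<Longrightarrow> growth_times n U (m + m') (\<lambda>p. f p * g p)"
proof (induction n arbitrary: m m' f g)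
  case (Suc n)
  note O = open_phase[OF U]
  note f = Suc.prems(1) and g = Suc.prems(2)
  note D = f[THEN smooth_on_differentiable_at, OF O] g[THEN smooth_on_differentiable_at, OF O]
  note S = Suc.prems(3,4)[THEN growth_times_Suc]
  have df: "growth_times n U m (dx i f)" "growth_times n U (m - 1) (dxi i f)"
    and dg: "growth_times n U m' (dx i g)" "growth_times n U (m' - 1) (dxi i g)" for i
    using Suc.prems(3,4) by simp_all
  have e: "m - 1 + m' = m + m' - 1" "m + (m' - 1) = m + m' - 1" by simp_all
  have x: "growth_times n U (m + m') (dx i (\<lambda>p. f p * g p))" for i
  proof (rule growth_times_cong[OF U growth_times_add[OF U]])
    show "growth_times n U (m + m') (\<lambda>p. dx i f p * g p)"
      by (rule Suc.IH[OF smooth_on_dx[OF f] g df(1) S(2)])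
    show "growth_times n U (m + m') (\<lambda>p. f p * dx i g p)"
      by (rule Suc.IH[OF f smooth_on_dx[OF g] S(1) dg(1)])
  qed (simp_all add: O smooth_on_mult f g smooth_on_dx dx_mult D)
  have xi: "growth_times n U (m + m' - 1) (dxi i (\<lambda>p. f p * g p))" for i
  proof (rule growth_times_cong[OF U growth_times_add[OF U]])
    show "growth_times n U (m + m' - 1) (\<lambda>p. dxi i f p * g p)"
      by (rule Suc.IH[OF smooth_on_dxi[OF f] g df(2) S(2), unfolded e])
    show "growth_times n U (m + m' - 1) (\<lambda>p. f p * dxi i g p)"
      by (rule Suc.IH[OF f smooth_on_dxi[OF g] S(1) dg(2), unfolded e])
  qed (simp_all add: O smooth_on_mult f g smooth_on_dxi dxi_mult D)
  have "growth U (m + m') (\<lambda>p. f p * g p)"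
    by (rule growth_mult) (rule Suc.prems(3,4)[THEN growth_times_growth])+
  then show ?case using x xi by simp
qed (simp add: growth_mult)

context
  fixes U :: "(real^'n::finite) set"
  assumes U: "open U"
begin

lemma symbol_cong:
  "symbol U m f \<Longrightarrow> (\<And>x \<xi>. x \<in> U \<Longrightarrow> f (x, \<xi>) = g (x, \<xi>)) \<Longrightarrow> symbol U m g"
  unfolding symbol_iff[OF U]
  using growth_times_cong[OF U, of _ m f g] smooth_on_cong[OF open_phase[OF U], of f g] by auto

lemma symbol_mono: "symbol U m f \<Longrightarrow> m \<le> m' \<Longrightarrow> symbol U m' f"
  unfolding symbol_iff[OF U] using growth_times_mono by blast

lemma symbol_add: "symbol U m f \<Longrightarrow> symbol U m g \<Longrightarrow> symbol U m (\<lambda>p. f p + g p)"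
  unfolding symbol_iff[OF U] using growth_times_add[OF U] smooth_on_add[OF open_phase[OF U]] by blast

lemma symbol_mult: "symbol U m f \<Longrightarrow> symbol U m' g \<Longrightarrow> symbol U (m + m') (\<lambda>p. f p * g p)"
  unfolding symbol_iff[OF U] using growth_times_mult[OF U] smooth_on_mult[OF open_phase[OF U]] by blast

lemma growth_times_zero: "growth_times n U m (\<lambda>p. 0)"
  by (induction n arbitrary: m) (auto simp: growth_def dx_eq_dird dxi_eq_dird intro: exI[of _ 0])

lemma symbol_zero: "symbol U m (\<lambda>p. 0)"
  by (simp add: symbol_iff[OF U] smooth_on_const growth_times_zero)

lemma symbol_const: "symbol U 0 (\<lambda>p. c)"
proof -
  have "growth U (0::real) (\<lambda>p. c)" for c unfolding growth_def
    by (auto intro!: exI[of _ "norm c"] simp: add_nonneg_eq_0_iff)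
  then have "growth_times n U 0 (\<lambda>p. c)" for n
    by (induction n arbitrary: c) (auto simp: dx_eq_dird dxi_eq_dird growth_times_zero)
  then show ?thesis by (simp add: symbol_iff[OF U] smooth_on_const)
qed

lemma symbol_scale: "symbol U m f \<Longrightarrow> symbol U m (\<lambda>p. c * f p)"
  using symbol_mult[OF symbol_const] by fastforce

lemma symbol_sum: "(\<And>i. i \<in> I \<Longrightarrow> symbol U m (f i)) \<Longrightarrow> symbol U m (\<lambda>p. \<Sum>i\<in>I. f i p)"
  by (induction I rule: infinite_finite_induct) (auto intro: symbol_zero symbol_add)

end


section \<open>Homogeneous functions and classical expansions\<close>

lemma open_punctured: "open U \<Longrightarrow> open (U \<times> (UNIV - {0 :: 'b::real_normed_vector}))"
  by (intro open_Times) (auto intro: open_Diff)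

lemma pos_homogeneousD:
  "pos_homogeneous U a h \<Longrightarrow> x \<in> U \<Longrightarrow> \<xi> \<noteq> 0 \<Longrightarrow> t > 0 \<Longrightarrow>
    h (x, t *\<^sub>R \<xi>) = complex_of_real t powr a * h (x, \<xi>)"
  by (simp add: pos_homogeneous_def)

lemma pos_homogeneousI:
  fixes h :: "'n::finite pt \<Rightarrow> complex"
  assumes "\<And>x \<xi> t. x \<in> U \<Longrightarrow> \<xi> \<noteq> 0 \<Longrightarrow> t > 0 \<Longrightarrow>
    h (x, t *\<^sub>R \<xi>) = complex_of_real t powr a * h (x, \<xi>)"
  shows "pos_homogeneous U a h"
  unfolding pos_homogeneous_def by (intro ballI allI impI assms) auto

text \<open>Differentiate the homogeneity relation along \<open>v\<close>: the chain rule turns \<open>(u, w)\<close> into \<open>(u, t w)\<close>.\<close>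

lemma dird_homogeneous:
  fixes h :: "'n::finite pt \<Rightarrow> complex"
  assumes U: "open U" and h: "smooth_on (U \<times> (UNIV - {0})) h" "pos_homogeneous U a h"
    and x: "x \<in> U" "\<xi> \<noteq> 0" "t > 0"
  shows "dird (u, t *\<^sub>R w) h (x, t *\<^sub>R \<xi>) = complex_of_real t powr a * dird (u, w) h (x, \<xi>)"
proof -
  define L where "L p = (fst p, t *\<^sub>R snd p)" for p :: "'n pt"
  note O = open_punctured[OF U]
  have L: "(L has_derivative L) (at (x, \<xi>))"
    unfolding L_def by (auto intro!: derivative_eq_intros)
  have D: "(h has_derivative (\<lambda>v. dird v h (L (x, \<xi>)))) (at (L (x, \<xi>)))"
    using x by (intro differentiable_has_dird smooth_on_differentiable_at[OF h(1) O]) (auto simp: L_def)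
  have "dird (u, w) (\<lambda>p. h (L p)) (x, \<xi>) = dird (L (u, w)) h (L (x, \<xi>))"
    by (rule dird_eq[OF has_derivative_compose[OF L D]])
  moreover have "dird (u, w) (\<lambda>p. h (L p)) (x, \<xi>)
      = dird (u, w) (\<lambda>p. complex_of_real t powr a * h p) (x, \<xi>)"
    using x by (intro dird_cong[OF O]) (auto simp: L_def intro!: pos_homogeneousD[OF h(2)])
  moreover have "\<dots> = complex_of_real t powr a * dird (u, w) h (x, \<xi>)"
    using x by (intro dird_bounded_linear smooth_on_differentiable_at[OF h(1) O])
      (auto intro: bounded_linear_mult_right)
  ultimately show ?thesis by (simp add: L_def)
qed

lemma pos_homogeneous_dx:
  assumes "open U" "smooth_on (U \<times> (UNIV - {0})) h" "pos_homogeneous U a h"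
  shows "pos_homogeneous U a (dx i h)"
  using dird_homogeneous[OF assms, of _ _ _ "axis i 1" 0]
  by (intro pos_homogeneousI) (simp add: dx_eq_dird)

text \<open>Scaling acts on the fibre direction as well, so linearity of the derivative in its
  direction produces a factor \<open>t\<close>; dividing by it lowers the degree by one.\<close>

lemma pos_homogeneous_dxi:
  fixes h :: "'n::finite pt \<Rightarrow> complex"
  assumes U: "open U" and h: "smooth_on (U \<times> (UNIV - {0})) h" "pos_homogeneous U a h"
  shows "pos_homogeneous U (a - 1) (dxi j h)"
proof (rule pos_homogeneousI)
  fix x and \<xi> :: "real^'n" and t :: real assume x: "x \<in> U" "\<xi> \<noteq> 0" "t > 0"
  have "(h has_derivative (\<lambda>v. dird v h (x, t *\<^sub>R \<xi>))) (at (x, t *\<^sub>R \<xi>))"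
    using x by (intro differentiable_has_dird smooth_on_differentiable_at[OF h(1) open_punctured[OF U]]) auto
  then have "dird (t *\<^sub>R (0, axis j 1)) h (x, t *\<^sub>R \<xi>) = t *\<^sub>R dird (0, axis j 1) h (x, t *\<^sub>R \<xi>)"
    by (rule linear_scale[OF has_derivative_linear])
  then have "of_real t * dxi j h (x, t *\<^sub>R \<xi>) = of_real t powr a * dxi j h (x, \<xi>)"
    using dird_homogeneous[OF assms x, of 0 "axis j 1"] by (simp add: dxi_eq_dird scaleR_conv_of_real)
  then show "dxi j h (x, t *\<^sub>R \<xi>) = complex_of_real t powr (a - 1) * dxi j h (x, \<xi>)"
    using x by (simp add: powr_diff field_simps)
qed

lemma pos_homogeneous_add:
  "pos_homogeneous U a f \<Longrightarrow> pos_homogeneous U a g \<Longrightarrow> pos_homogeneous U a (\<lambda>p. f p + g p)"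
  by (intro pos_homogeneousI) (simp add: pos_homogeneousD algebra_simps)

lemma pos_homogeneous_zero: "pos_homogeneous U a (\<lambda>p. 0)"
  by (intro pos_homogeneousI) simp

lemma pos_homogeneous_sum:
  "(\<And>i. i \<in> I \<Longrightarrow> pos_homogeneous U a (f i)) \<Longrightarrow> pos_homogeneous U a (\<lambda>p. \<Sum>i\<in>I. f i p)"
  by (induction I rule: infinite_finite_induct) (auto intro: pos_homogeneous_zero pos_homogeneous_add)

lemma pos_homogeneous_mult:
  assumes "pos_homogeneous U a f" "pos_homogeneous U b g"
  shows "pos_homogeneous U (a + b) (\<lambda>p. f p * g p)"
  by (intro pos_homogeneousI)
    (simp add: pos_homogeneousD[OF assms(1)] pos_homogeneousD[OF assms(2)] powr_add)

lemma pos_homogeneous_cong: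
  fixes f :: "'n::finite pt \<Rightarrow> complex"
  assumes "pos_homogeneous U a f" "\<And>x \<xi>. x \<in> U \<Longrightarrow> \<xi> \<noteq> 0 \<Longrightarrow> f (x, \<xi>) = g (x, \<xi>)"
  shows "pos_homogeneous U a g"
proof (rule pos_homogeneousI)
  fix x and \<xi> :: "real^'n" and t :: real assume x: "x \<in> U" "\<xi> \<noteq> 0" "t > 0"
  then show "g (x, t *\<^sub>R \<xi>) = complex_of_real t powr a * g (x, \<xi>)"
    using assms(2)[of x "t *\<^sub>R \<xi>"] assms(2)[of x \<xi>] pos_homogeneousD[OF assms(1) x] by simp
qed

text \<open>Compactness bounds \<open>f\<close> over \<open>K\<close> on the fibre ball of radius 2
  and \<open>h\<close> over \<open>K\<close> on the unit sphere. Homogeneity carries the second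
  bound outwards along rays.\<close>

lemma growth_eventually_homogeneous:
  fixes f h :: "'n::finite pt \<Rightarrow> complex"
  assumes f: "continuous_on (U \<times> UNIV) f" and h: "continuous_on (U \<times> (UNIV - {0})) h" "pos_homogeneous U a h"
    and eq: "\<And>x \<xi>. x \<in> U \<Longrightarrow> norm \<xi> > 1 \<Longrightarrow> f (x, \<xi>) = h (x, \<xi>)"
  shows "growth U (Re a) f"
proof (rule growthI)
  fix K assume K: "compact K" "K \<subseteq> U"
  let ?r = "Re a"
  have "compact (K \<times> cball (0::real^'n) 2)" "compact (K \<times> sphere (0::real^'n) 1)"
    using K by (auto intro: compact_Times)
  moreover have "continuous_on (K \<times> cball 0 2) f" "continuous_on (K \<times> sphere 0 1) h"
    using K by (auto intro: continuous_on_subset[OF f] continuous_on_subset[OF h(1)])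
  ultimately have bf: "bounded (f ` (K \<times> cball 0 2))" and bh: "bounded (h ` (K \<times> sphere 0 1))"
    by (auto intro: compact_imp_bounded compact_continuous_image)
  obtain A where A0: "A > 0" "\<forall>z \<in> f ` (K \<times> cball 0 2). norm z \<le> A"
    using bf unfolding bounded_pos by auto
  obtain B where B0: "B > 0" "\<forall>z \<in> h ` (K \<times> sphere 0 1). norm z \<le> B"
    using bh unfolding bounded_pos by auto
  have A: "norm (f (x, \<xi>)) \<le> A" if "x \<in> K" "norm \<xi> \<le> 2" for x \<xi>
    using A0(2) that by auto
  have B: "norm (h (x, \<xi>)) \<le> B" if "x \<in> K" "norm \<xi> = 1" for x \<xi>
    using B0(2) that by auto
  \<comment> \<open>Comparison of \<open>1\<close> and of \<open>s powr ?r\<close> with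
    \<open>(1 + s) powr ?r\<close>, using \<open>1 \<le> 1 + s \<le> 3\<close> on the ball and
    \<open>s \<le> 1 + s \<le> 2 * s\<close> outside. The exponent \<open>\<bar>?r\<bar>\<close> in
    the constant serves both signs of \<open>?r\<close>.\<close>
  have one: "1 \<le> 3 powr \<bar>?r\<bar> * (1 + s) powr ?r" if "0 \<le> s" "s \<le> 2" for s :: real
  proof (cases "?r \<ge> 0")
    case True
    have "1 \<le> (3::real) powr ?r" "1 \<le> (1 + s) powr ?r" using True that by (auto intro: ge_one_powr_ge_zero)
    then show ?thesis using True mult_mono[of 1 "3 powr ?r" 1 "(1 + s) powr ?r"] by simp
  next
    case False
    have "(3::real) powr ?r \<le> (1 + s) powr ?r" using False that by (intro powr_mono2') auto
    then have "3 powr - ?r * 3 powr ?r \<le> 3 powr - ?r * (1 + s) powr ?r" by (intro mult_left_mono) auto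
    then show ?thesis using False by (simp add: powr_minus)
  qed
  have two: "s powr ?r \<le> 2 powr \<bar>?r\<bar> * (1 + s) powr ?r" if "s \<ge> 1" for s :: real
  proof (cases "?r \<ge> 0")
    case True
    have "1 \<le> (2::real) powr ?r" "s powr ?r \<le> (1 + s) powr ?r"
      using True that by (auto intro: ge_one_powr_ge_zero powr_mono2)
    then show ?thesis using True mult_mono[of 1 "2 powr ?r" "s powr ?r" "(1 + s) powr ?r"] by simp
  next
    case False
    have "(2 * s) powr ?r \<le> (1 + s) powr ?r" using False that by (intro powr_mono2') auto
    then have "2 powr - ?r * (2 powr ?r * s powr ?r) \<le> 2 powr - ?r * (1 + s) powr ?r"
      using that by (intro mult_left_mono) (auto simp: powr_mult)
    moreover have "2 powr - ?r * (2 powr ?r * s powr ?r) = s powr ?r"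
      by (simp add: powr_minus field_simps)
    ultimately show ?thesis using False by simp
  qed
  let ?C = "A * 3 powr \<bar>?r\<bar> + B * 2 powr \<bar>?r\<bar>"
  have "norm (f (x, \<xi>)) \<le> ?C * (1 + norm \<xi>) powr ?r" if x: "x \<in> K" for x \<xi>
  proof (cases "norm \<xi> \<le> 2")
    case True
    have "norm (f (x, \<xi>)) \<le> A * 1" using A[OF x True] by simp
    also have "\<dots> \<le> A * (3 powr \<bar>?r\<bar> * (1 + norm \<xi>) powr ?r)"
      using A0(1) one True by (intro mult_left_mono) auto
    also have "\<dots> \<le> ?C * (1 + norm \<xi>) powr ?r"
      using B0(1) by (simp add: algebra_simps)
    finally show ?thesis .
  next
    case False
    define \<eta> where "\<eta> = (1 / norm \<xi>) *\<^sub>R \<xi>"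
    have n: "norm \<xi> > 2" "\<eta> \<noteq> 0" "norm \<eta> = 1" "\<xi> = norm \<xi> *\<^sub>R \<eta>"
      using False by (auto simp: \<eta>_def)
    have "f (x, \<xi>) = h (x, norm \<xi> *\<^sub>R \<eta>)" using eq[of x \<xi>] x K n by auto
    also have "\<dots> = complex_of_real (norm \<xi>) powr a * h (x, \<eta>)"
      using x K n by (intro pos_homogeneousD[OF h(2)]) auto
    finally have "norm (f (x, \<xi>)) = norm \<xi> powr ?r * norm (h (x, \<eta>))"
      using n by (simp add: norm_mult norm_powr_real_powr)
    also have "\<dots> \<le> (2 powr \<bar>?r\<bar> * (1 + norm \<xi>) powr ?r) * B"
      using two[of "norm \<xi>"] B[OF x n(3)] n by (intro mult_mono) auto
    also have "\<dots> \<le> ?C * (1 + norm \<xi>) powr ?r"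
      using A0(1) by (simp add: algebra_simps)
    finally show ?thesis .
  qed
  then show "\<exists>C. \<forall>x\<in>K. \<forall>\<xi>. norm (f (x, \<xi>)) \<le> C * (1 + norm \<xi>) powr ?r" by (intro exI[of _ ?C]) simp
qed

text \<open>The strict inequality \<open>norm \<xi> > 1\<close> defines an open set, so the
  agreement of \<open>f\<close> with \<open>h\<close> passes to derivatives. These are again
  eventually homogeneous, of degree \<open>a\<close> or \<open>a - 1\<close>, and the growth bound
  applies to them inductively.\<close>

lemma symbol_eventually_homogeneous:
  fixes f h :: "'n::finite pt \<Rightarrow> complex"
  assumes U: "open U"
    and f: "smooth_on (U \<times> UNIV) f" and h: "smooth_on (U \<times> (UNIV - {0})) h" "pos_homogeneous U a h"
    and eq: "\<And>x \<xi>. x \<in> U \<Longrightarrow> norm \<xi> > 1 \<Longrightarrow> f (x, \<xi>) = h (x, \<xi>)"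
  shows "symbol U (Re a) f"
proof -
  have "growth_times n U (Re a) f" for n
    using f h eq
  proof (induction n arbitrary: a f h)
    case 0
    show ?case using growth_eventually_homogeneous[of U f h a] 0 by (simp add: smooth_on_continuous_on)
  next
    case (Suc n)
    let ?W = "U \<times> {\<xi>::real^'n. norm \<xi> > 1}"
    have W: "open ?W" using U by (intro open_Times open_Collect_less) (auto intro: continuous_intros)
    have eq': "f q = h q" if "q \<in> ?W" for q using Suc.prems(4) that by auto
    have d: "dx i f (x, \<xi>) = dx i h (x, \<xi>)" "dxi i f (x, \<xi>) = dxi i h (x, \<xi>)"
      if "x \<in> U" "norm \<xi> > 1" for x \<xi> i
      by (rule dx_cong[OF W _ eq'] dxi_cong[OF W _ eq']; use that in simp)+
    have "growth_times n U (Re a) (dx i f)" for i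
      using Suc.prems d by (intro Suc.IH[of "dx i f" "dx i h"] smooth_on_dx pos_homogeneous_dx U) auto
    moreover have "growth_times n U (Re a - 1) (dxi i f)" for i
      using Suc.IH[of "dxi i f" "dxi i h" "a - 1"] Suc.prems d
      by (simp add: smooth_on_dxi pos_homogeneous_dxi U)
    moreover have "growth U (Re a) f"
      using growth_eventually_homogeneous[of U f h a] Suc.prems by (simp add: smooth_on_continuous_on)
    ultimately show ?case by simp
  qed
  then show ?thesis using f by (simp add: symbol_iff[OF U])
qed

context
  fixes U :: "(real^'n::finite) set" and \<kappa> :: "'n pt \<Rightarrow> complex"
  assumes U: "open U" and \<kappa>: "cutoff U \<kappa>"
begin

lemma cutoff_smooth: "smooth_on (U \<times> UNIV) \<kappa>"
  and cutoff_0: "x \<in> U \<Longrightarrow> norm \<xi> \<le> 1/2 \<Longrightarrow> \<kappa> (x, \<xi>) = 0"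
  and cutoff_1: "x \<in> U \<Longrightarrow> norm \<xi> \<ge> 1 \<Longrightarrow> \<kappa> (x, \<xi>) = 1"
  using \<kappa> by (auto simp: cutoff_def)

text \<open>The values of \<open>h\<close> on the zero section are arbitrary, but the product is
  zero near it. This neighbourhood and the complement of the zero section are two open sets covering
  \<open>U \<times> UNIV\<close>.\<close>

lemma smooth_on_vanishing_mult:
  fixes g h :: "'n pt \<Rightarrow> complex"
  assumes g: "smooth_on (U \<times> UNIV) g" "\<And>x \<xi>. x \<in> U \<Longrightarrow> norm \<xi> < 1/2 \<Longrightarrow> g (x, \<xi>) = 0"
    and h: "smooth_on (U \<times> (UNIV - {0})) h"
  shows "smooth_on (U \<times> UNIV) (\<lambda>p. g p * h p)"
proof -
  let ?V = "U \<times> {\<xi>::real^'n. norm \<xi> < 1/2}"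
  have V: "open ?V" using U by (intro open_Times open_Collect_less) (auto intro: continuous_intros)
  have "smooth_on ?V (\<lambda>p. g p * h p)"
    by (rule smooth_on_cong[OF V smooth_on_const[of _ 0]]) (auto simp: g(2))
  moreover have "smooth_on (U \<times> (UNIV - {0})) (\<lambda>p. g p * h p)"
    by (intro smooth_on_mult open_punctured U h smooth_on_subset[OF _ g(1)]) auto
  ultimately have "smooth_on (?V \<union> U \<times> (UNIV - {0})) (\<lambda>p. g p * h p)"
    by (intro smooth_on_Un V open_punctured U)
  moreover have "?V \<union> U \<times> (UNIV - {0}) = U \<times> UNIV" by auto
  ultimately show ?thesis by simp
qed

lemma symbol_cutoff_homogeneous:
  assumes "smooth_on (U \<times> (UNIV - {0})) h" "pos_homogeneous U a h"
  shows "symbol U (Re a) (\<lambda>p. \<kappa> p * h p)"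
  by (rule symbol_eventually_homogeneous[OF U _ assms])
    (auto intro!: smooth_on_vanishing_mult cutoff_smooth assms simp: cutoff_0 cutoff_1)

text \<open>Such a product eventually equals 0, which is homogeneous of every degree, hence it is a
  symbol of every order. This disposes of the errors caused by the cutoff: terms with a derivative
  of \<kappa>, and terms with \<open>\<kappa> p * \<kappa> p - \<kappa> p\<close>.\<close>

lemma symbol_compact_in_fibre:
  fixes g h :: "'n pt \<Rightarrow> complex"
  assumes "smooth_on (U \<times> UNIV) g" "\<And>x \<xi>. x \<in> U \<Longrightarrow> norm \<xi> < 1/2 \<Longrightarrow> g (x, \<xi>) = 0"
    and "\<And>x \<xi>. x \<in> U \<Longrightarrow> norm \<xi> > 1 \<Longrightarrow> g (x, \<xi>) = 0"
    and "smooth_on (U \<times> (UNIV - {0})) h"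
  shows "symbol U m (\<lambda>p. g p * h p)"
  using symbol_eventually_homogeneous[OF U smooth_on_vanishing_mult[OF assms(1,2,4)]
      smooth_on_const[of _ 0] pos_homogeneous_zero, of "of_real m"] assms(3) by simp

end


context
  fixes U :: "(real^'n::finite) set" and \<kappa> :: "'n pt \<Rightarrow> complex"
  assumes U: "open U" and \<kappa>: "cutoff U \<kappa>"
begin

lemma dird_cutoff:
  assumes "x \<in> U" "norm \<xi> < 1/2 \<or> norm \<xi> > 1"
  shows "dird v \<kappa> (x, \<xi>) = 0"
proof -
  let ?V = "U \<times> {\<xi>::real^'n. norm \<xi> < 1/2}" and ?W = "U \<times> {\<xi>::real^'n. norm \<xi> > 1}"
  have "open ?V" "open ?W" using U by (auto intro!: open_Times open_Collect_less continuous_intros)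
  then have "dird v \<kappa> (x, \<xi>) = dird v (\<lambda>p. 0) (x, \<xi>) \<or> dird v \<kappa> (x, \<xi>) = dird v (\<lambda>p. 1) (x, \<xi>)"
    using assms dird_cong[of ?V "(x, \<xi>)" \<kappa> "\<lambda>p. 0" v] dird_cong[of ?W "(x, \<xi>)" \<kappa> "\<lambda>p. 1" v]
    by (auto simp: cutoff_0[OF U \<kappa>] cutoff_1[OF U \<kappa>])
  then show ?thesis by simp
qed

lemma smooth_on_cutoff_mult:
  "smooth_on (U \<times> (UNIV - {0})) h \<Longrightarrow> smooth_on (U \<times> UNIV) (\<lambda>p. \<kappa> p * h p)"
  by (rule smooth_on_vanishing_mult[OF U \<kappa> cutoff_smooth[OF U \<kappa>]]) (simp_all add: cutoff_0[OF U \<kappa>])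

lemma dird_cutoff_mult:
  assumes h: "smooth_on (U \<times> (UNIV - {0})) h" and x: "x \<in> U"
  shows "dird v (\<lambda>p. \<kappa> p * h p) (x, \<xi>) = dird v \<kappa> (x, \<xi>) * h (x, \<xi>) + \<kappa> (x, \<xi>) * dird v h (x, \<xi>)"
proof (cases "\<xi> = 0")
  case True
  let ?V = "U \<times> {\<xi>::real^'n. norm \<xi> < 1/2}"
  have "open ?V" using U by (intro open_Times open_Collect_less) (auto intro: continuous_intros)
  then have "dird v (\<lambda>p. \<kappa> p * h p) (x, \<xi>) = dird v (\<lambda>p. 0) (x, \<xi>)"
    using x True by (intro dird_cong) (auto simp: cutoff_0[OF U \<kappa>])
  then show ?thesis using x True by (simp add: dird_cutoff cutoff_0[OF U \<kappa>])
next
  case False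
  then show ?thesis
    using x by (intro dird_mult smooth_on_differentiable_at[OF h open_punctured[OF U]]
        smooth_on_differentiable_at[OF cutoff_smooth[OF U \<kappa>] open_phase[OF U]]) auto
qed

lemma expansionD:
  assumes "classical_expansion U \<kappa> m \<sigma> s"
  shows "symbol U (Re m) \<sigma>" "smooth_on (U \<times> (UNIV - {0})) (s i)" "pos_homogeneous U (m - of_nat i) (s i)"
    "N > 0 \<Longrightarrow> symbol U (Re m - real N - 1) (\<lambda>p. \<sigma> p - (\<Sum>i\<le>N. \<kappa> p * s i p))"
    "smooth_on (U \<times> UNIV) \<sigma>"
  using assms by (simp_all add: classical_expansion_def symbol_def)

lemma expansionI:
  assumes "symbol U (Re m) \<sigma>" "\<And>i. smooth_on (U \<times> (UNIV - {0})) (s i)"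
    "\<And>i. pos_homogeneous U (m - of_nat i) (s i)"
    "\<And>N. N > 0 \<Longrightarrow> symbol U (Re m - real N - 1) (\<lambda>p. \<sigma> p - (\<Sum>i\<le>N. \<kappa> p * s i p))"
  shows "classical_expansion U \<kappa> m \<sigma> s"
  unfolding classical_expansion_def using assms by blast

text \<open>Stated for both kinds of direction at once: \<open>d = 0\<close> for a base direction
  and \<open>d = 1\<close> for a fibre direction. Differentiating the remainder also produces terms
  with \<open>dird v \<kappa>\<close>; they live in a bounded part of the fibres and are absorbed by
  the new remainder.\<close>

lemma expansion_dird:
  fixes d :: real
  assumes sym: "\<And>m f. symbol U m f \<Longrightarrow> symbol U (m - d) (dird v f)"
    and hom: "\<And>a h. smooth_on (U \<times> (UNIV - {0})) h \<Longrightarrow> pos_homogeneous U a h \<Longrightarrow>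
      pos_homogeneous U (a - of_real d) (dird v h)"
    and e: "classical_expansion U \<kappa> m \<sigma> s"
  shows "classical_expansion U \<kappa> (m - of_real d) (dird v \<sigma>) (\<lambda>i. dird v (s i))"
proof (rule expansionI)
  show "symbol U (Re (m - of_real d)) (dird v \<sigma>)"
    using sym[OF expansionD(1)[OF e]] by simp
  show "smooth_on (U \<times> (UNIV - {0})) (dird v (s i))" for i
    by (rule smooth_on_dird[OF expansionD(2)[OF e]])
  have "m - of_real d - of_nat i = m - of_nat i - of_real d" for i by simp
  then show "pos_homogeneous U (m - of_real d - of_nat i) (dird v (s i))" for i
    using hom[OF expansionD(2,3)[OF e], of i] by (simp only:)
  fix N :: nat assume N: "N > 0"
  note O = open_phase[OF U]
  note ks = smooth_on_cutoff_mult[OF expansionD(2)[OF e]]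
  have "symbol U (Re m - real N - 1 - d) (dird v (\<lambda>p. \<sigma> p - (\<Sum>i\<le>N. \<kappa> p * s i p)))"
    by (rule sym[OF expansionD(4)[OF e N]])
  moreover have "symbol U (Re m - real N - 1 - d) (\<lambda>p. \<Sum>i\<le>N. dird v \<kappa> p * s i p)"
    by (intro symbol_sum[OF U] symbol_compact_in_fibre[OF U \<kappa>] smooth_on_dird cutoff_smooth[OF U \<kappa>]
        expansionD(2)[OF e] dird_cutoff) auto
  ultimately have "symbol U (Re m - real N - 1 - d) (\<lambda>p. dird v (\<lambda>p. \<sigma> p - (\<Sum>i\<le>N. \<kappa> p * s i p)) p
      + (\<Sum>i\<le>N. dird v \<kappa> p * s i p))"
    by (rule symbol_add[OF U])
  moreover have "Re (m - of_real d) - real N - 1 = Re m - real N - 1 - d" by simp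
  ultimately show "symbol U (Re (m - of_real d) - real N - 1)
      (\<lambda>p. dird v \<sigma> p - (\<Sum>i\<le>N. \<kappa> p * dird v (s i) p))"
  proof (simp only:, elim symbol_cong[OF U])
    fix x :: "real^'n" and \<xi> :: "real^'n" assume x: "x \<in> U"
    then have p: "(x, \<xi>) \<in> U \<times> UNIV" by simp
    have "dird v (\<lambda>p. \<sigma> p - (\<Sum>i\<le>N. \<kappa> p * s i p)) (x, \<xi>)
        = dird v \<sigma> (x, \<xi>) - dird v (\<lambda>p. \<Sum>i\<le>N. \<kappa> p * s i p) (x, \<xi>)"
      by (intro dird_diff smooth_on_differentiable_at[OF expansionD(5)[OF e] O p]
          smooth_on_differentiable_at[OF _ O p] smooth_on_sum O ks)
    also have "dird v (\<lambda>p. \<Sum>i\<le>N. \<kappa> p * s i p) (x, \<xi>) = (\<Sum>i\<le>N. dird v (\<lambda>p. \<kappa> p * s i p) (x, \<xi>))"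
      by (rule dird_sum[OF smooth_on_differentiable_at[OF ks O p]])
    also have "\<dots> = (\<Sum>i\<le>N. dird v \<kappa> (x, \<xi>) * s i (x, \<xi>)) + (\<Sum>i\<le>N. \<kappa> (x, \<xi>) * dird v (s i) (x, \<xi>))"
      by (simp add: dird_cutoff_mult[OF expansionD(2)[OF e] x] sum.distrib)
    finally show "dird v (\<lambda>p. \<sigma> p - (\<Sum>i\<le>N. \<kappa> p * s i p)) (x, \<xi>)
      + (\<Sum>i\<le>N. dird v \<kappa> (x, \<xi>) * s i (x, \<xi>)) = dird v \<sigma> (x, \<xi>) - (\<Sum>i\<le>N. \<kappa> (x, \<xi>) * dird v (s i) (x, \<xi>))"
      by simp
  qed
qed

lemma expansion_scale:
  assumes e: "classical_expansion U \<kappa> m \<sigma> s"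
  shows "classical_expansion U \<kappa> m (\<lambda>p. c * \<sigma> p) (\<lambda>i p. c * s i p)"
proof (rule expansionI)
  show "symbol U (Re m) (\<lambda>p. c * \<sigma> p)" by (rule symbol_scale[OF U expansionD(1)[OF e]])
  show "smooth_on (U \<times> (UNIV - {0})) (\<lambda>p. c * s i p)" for i
    by (intro smooth_on_mult smooth_on_const expansionD(2)[OF e] open_punctured U)
  show "pos_homogeneous U (m - of_nat i) (\<lambda>p. c * s i p)" for i
    by (rule pos_homogeneousI) (simp add: pos_homogeneousD[OF expansionD(3)[OF e]])
  fix N :: nat assume "N > 0"
  from symbol_scale[OF U expansionD(4)[OF e this], of c]
  show "symbol U (Re m - real N - 1) (\<lambda>p. c * \<sigma> p - (\<Sum>i\<le>N. \<kappa> p * (c * s i p)))"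
    by (simp add: sum_distrib_left right_diff_distrib mult.left_commute)
qed

text \<open>The components form a Cauchy product. With partial sums \<open>S\<close> and
  \<open>S'\<close>, the remainder comes from \<open>\<sigma> \<sigma>' = S (\<sigma>' - S') +
  (\<sigma> - S) \<sigma>' + S S'\<close>: the first two terms have the required order, and
  \<open>S S'\<close> is compared with the cut-off Cauchy sum.\<close>

lemma expansion_mult:
  assumes e: "classical_expansion U \<kappa> m \<sigma> s" and e': "classical_expansion U \<kappa> m' \<sigma>' s'"
  shows "classical_expansion U \<kappa> (m + m') (\<lambda>p. \<sigma> p * \<sigma>' p) (\<lambda>k p. \<Sum>i\<le>k. s i p * s' (k - i) p)"
proof (rule expansionI)
  note O = open_phase[OF U] and O' = open_punctured[OF U]
  show "symbol U (Re (m + m')) (\<lambda>p. \<sigma> p * \<sigma>' p)"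
    using symbol_mult[OF U expansionD(1)[OF e] expansionD(1)[OF e']] by simp
  show "smooth_on (U \<times> (UNIV - {0})) (\<lambda>p. \<Sum>i\<le>k. s i p * s' (k - i) p)" for k
    by (intro smooth_on_sum smooth_on_mult O' expansionD(2)[OF e] expansionD(2)[OF e'])
  show "pos_homogeneous U (m + m' - of_nat k) (\<lambda>p. \<Sum>i\<le>k. s i p * s' (k - i) p)" for k
  proof (rule pos_homogeneous_sum)
    fix i assume "i \<in> {..k}"
    then have "m - of_nat i + (m' - of_nat (k - i)) = m + m' - of_nat k" by (simp add: of_nat_diff)
    then show "pos_homogeneous U (m + m' - of_nat k) (\<lambda>p. s i p * s' (k - i) p)"
      using pos_homogeneous_mult[OF expansionD(3)[OF e] expansionD(3)[OF e']] by metis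
  qed
  fix N :: nat assume N: "N > 0"
  define S S' where "S p = (\<Sum>i\<le>N. \<kappa> p * s i p)" and "S' p = (\<Sum>i\<le>N. \<kappa> p * s' i p)" for p
  let ?r = "Re m + Re m' - real N - 1"
  \<comment> \<open>The discrepancy between \<open>S S'\<close> and the cut-off Cauchy sum, entry by
    entry. For \<open>i + j \<le> N\<close> only \<kappa> squared against \<kappa> matters, a
    difference that vanishes for \<open>norm \<xi> \<ge> 1\<close>. For \<open>i + j > N\<close> the
    entry is absent from the Cauchy sum and its order is already at most that of the
    remainder.\<close>
  let ?T = "\<lambda>i j p. if i + j \<le> N then (\<kappa> p * \<kappa> p - \<kappa> p) * (s i p * s' j p)
     else (\<kappa> p * s i p) * (\<kappa> p * s' j p)"
  have k: "symbol U (Re m - real i) (\<lambda>p. \<kappa> p * s i p)" "symbol U (Re m' - real i) (\<lambda>p. \<kappa> p * s' i p)" for i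
    using symbol_cutoff_homogeneous[OF U \<kappa> expansionD(2,3)[OF e], of i]
      symbol_cutoff_homogeneous[OF U \<kappa> expansionD(2,3)[OF e'], of i] by simp_all
  have "symbol U (Re m) S" unfolding S_def
    by (intro symbol_sum[OF U] symbol_mono[OF U k(1)]) simp
  from symbol_mult[OF U this expansionD(4)[OF e' N]]
  have 1: "symbol U ?r (\<lambda>p. S p * (\<sigma>' p - S' p))" by (simp add: S'_def algebra_simps)
  from symbol_mult[OF U expansionD(4)[OF e N] expansionD(1)[OF e']]
  have 2: "symbol U ?r (\<lambda>p. (\<sigma> p - S p) * \<sigma>' p)" by (simp add: S_def algebra_simps)
  have 3: "symbol U ?r (\<lambda>p. ?T i j p)" for i j
  proof (cases "i + j \<le> N")
    case True
    have "symbol U ?r (\<lambda>p. (\<kappa> p * \<kappa> p - \<kappa> p) * (s i p * s' j p))"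
      by (rule symbol_compact_in_fibre[OF U \<kappa>])
        (auto intro!: smooth_on_diff smooth_on_mult O O' cutoff_smooth[OF U \<kappa>] expansionD(2)[OF e]
          expansionD(2)[OF e'] simp: cutoff_0[OF U \<kappa>] cutoff_1[OF U \<kappa>])
    then show ?thesis using True by simp
  next
    case False
    have "symbol U ?r (\<lambda>p. (\<kappa> p * s i p) * (\<kappa> p * s' j p))"
      by (rule symbol_mono[OF U symbol_mult[OF U k]]) (use False in linarith)
    then show ?thesis using False by simp
  qed
  have "symbol U ?r (\<lambda>p. S p * (\<sigma>' p - S' p) + (\<sigma> p - S p) * \<sigma>' p + (\<Sum>i\<le>N. \<Sum>j\<le>N. ?T i j p))"
    by (intro symbol_add[OF U] symbol_sum[OF U] 1 2 3)
  moreover have "S p * (\<sigma>' p - S' p) + (\<sigma> p - S p) * \<sigma>' p + (\<Sum>i\<le>N. \<Sum>j\<le>N. ?T i j p)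
      = \<sigma> p * \<sigma>' p - (\<Sum>k\<le>N. \<kappa> p * (\<Sum>i\<le>k. s i p * s' (k - i) p))" for p
  proof -
    have SS: "S p * S' p = (\<Sum>i\<le>N. \<Sum>j\<le>N. (\<kappa> p * s i p) * (\<kappa> p * s' j p))"
      unfolding S_def S'_def by (rule sum_product)
    have "(\<Sum>k\<le>N. \<kappa> p * (\<Sum>i\<le>k. s i p * s' (k - i) p)) = (\<Sum>k\<le>N. \<Sum>i\<le>k. \<kappa> p * (s i p * s' (k - i) p))"
      by (simp add: sum_distrib_left)
    also have "\<dots> = (\<Sum>(i, j)\<in>{(i, j). i + j \<le> N}. \<kappa> p * (s i p * s' j p))"
      by (rule sum.triangle_reindex_eq[symmetric])
    also have "\<dots> = (\<Sum>(i, j)\<in>{..N} \<times> {..N}. if i + j \<le> N then \<kappa> p * (s i p * s' j p) else 0)"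
      by (rule sum.mono_neutral_cong_left) (auto split: if_splits)
    also have "\<dots> = (\<Sum>i\<le>N. \<Sum>j\<le>N. if i + j \<le> N then \<kappa> p * (s i p * s' j p) else 0)"
      by (simp add: sum.cartesian_product)
    finally have P: "(\<Sum>k\<le>N. \<kappa> p * (\<Sum>i\<le>k. s i p * s' (k - i) p)) = \<dots>" .
    have "S p * S' p - (\<Sum>k\<le>N. \<kappa> p * (\<Sum>i\<le>k. s i p * s' (k - i) p)) = (\<Sum>i\<le>N. \<Sum>j\<le>N. ?T i j p)"
      unfolding SS P sum_subtractf[symmetric] by (intro sum.cong refl) (simp add: algebra_simps)
    then show ?thesis by (simp add: algebra_simps)
  qed
  ultimately show "symbol U (Re (m + m') - real N - 1)
      (\<lambda>p. \<sigma> p * \<sigma>' p - (\<Sum>k\<le>N. \<kappa> p * (\<Sum>i\<le>k. s i p * s' (k - i) p)))"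
    by simp
qed

end


section \<open>Uniqueness of homogeneous components\<close>

lemma powr_separates:
  assumes "a \<noteq> b"
  obtains h :: real where "h > 0" "of_real h powr a \<noteq> (of_real h powr b :: complex)"
proof
  \<comment> \<open>Equality of the two powers at \<open>exp u\<close> would make
    \<open>(a - b) * of_real u\<close> an integer multiple of \<open>2 * pi * \<i>\<close>. This
    \<open>u\<close> gives it modulus 1, which is neither 0 nor at least
    \<open>2 * pi\<close>.\<close>
  define u where "u = 1 / norm (a - b)"
  have u: "u > 0" using assms by (simp add: u_def)
  show "exp u > 0" by simp
  have ln: "ln (of_real (exp u) :: complex) = of_real u"
    using Ln_of_real[of "exp u"] by simp
  have powr: "of_real (exp u) powr c = exp (c * of_real u)" for c :: complex
    unfolding powr_def ln by simp
  show "of_real (exp u) powr a \<noteq> (of_real (exp u) powr b :: complex)"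
  proof
    assume "of_real (exp u) powr a = (of_real (exp u) powr b :: complex)"
    then have "exp ((a - b) * of_real u) = 1"
      unfolding powr by (simp add: left_diff_distrib exp_diff)
    then obtain n :: int where n: "(a - b) * of_real u = of_real (of_int (2 * n) * pi) * \<i>"
      unfolding exp_eq_1 by (auto simp: complex_eq_iff)
    have "norm ((a - b) * of_real u) = 1" using assms u by (simp add: norm_divide u_def)
    then have "\<bar>of_int (2 * n) * pi\<bar> = 1" unfolding n by (simp add: norm_mult)
    then have "real_of_int \<bar>2 * n\<bar> * pi = 1" by (simp add: abs_mult)
    moreover have "real_of_int \<bar>2 * n\<bar> * pi > 1" if "n \<noteq> 0"
    proof -
      have "real_of_int \<bar>2 * n\<bar> \<ge> 1" using that by linarith
      then have "real_of_int \<bar>2 * n\<bar> * pi \<ge> 1 * pi" by (intro mult_right_mono) auto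
      then show ?thesis using pi_gt3 by linarith
    qed
    ultimately show False by (cases "n = 0") auto
  qed
qed

lemma powr_bigo_imp_le:
  assumes "(\<lambda>t. k * of_real t powr b :: complex) \<in> O[at_top](\<lambda>t::real. of_real (t powr -L))" "Re b > -L"
  shows "k = 0"
proof -
  obtain C where "eventually (\<lambda>t. norm (k * of_real t powr b) \<le> C * norm (of_real (t powr -L) :: complex)) at_top"
    using assms(1) by (elim landau_o.bigE)
  then have "eventually (\<lambda>t. norm k \<le> C * t powr (- (L + Re b))) at_top"
    using eventually_gt_at_top[of 0]
  proof eventually_elim
    case (elim t)
    then have "norm k * t powr Re b \<le> C * t powr -L" by (simp add: norm_mult norm_powr_real_powr)
    then have "(norm k * t powr Re b) * t powr (- Re b) \<le> (C * t powr -L) * t powr (- Re b)"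
      by (intro mult_right_mono) auto
    moreover have "(norm k * t powr Re b) * t powr (- Re b) = norm k"
      using elim by (simp add: powr_minus)
    moreover have "(C * t powr -L) * t powr (- Re b) = C * t powr (- (L + Re b))"
      by (simp add: powr_add[symmetric])
    ultimately show ?case by simp
  qed
  moreover have "((\<lambda>t::real. C * t powr (- (L + Re b))) \<longlongrightarrow> C * 0) at_top"
    using assms(2) by (intro tendsto_mult tendsto_const tendsto_neg_powr filterlim_ident) auto
  ultimately have "norm k \<le> C * 0"
    using tendsto_lowerbound[of "\<lambda>t::real. C * t powr (- (L + Re b))" "C * 0" at_top "norm k"] by simp
  then show ?thesis by simp
qed

lemma powr_bigo:
  assumes "Re b \<le> -L"
  shows "(\<lambda>t. k * of_real t powr b :: complex) \<in> O[at_top](\<lambda>t::real. of_real (t powr -L))"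
proof (rule landau_o.bigI[of "norm k + 1"])
  show "\<forall>\<^sub>F t in at_top. norm (k * of_real t powr b :: complex) \<le> (norm k + 1) * norm (of_real (t powr -L) :: complex)"
    using eventually_ge_at_top[of "1::real"]
  proof eventually_elim
    case (elim t)
    have "norm k * t powr Re b \<le> (norm k + 1) * t powr -L"
      using assms elim by (intro mult_mono powr_mono) auto
    then show ?case using elim by (simp add: norm_mult norm_powr_real_powr)
  qed
qed (use norm_ge_zero[of k] in linarith)

text \<open>Passing from \<open>f t\<close> to \<open>f (h * t) - of_real h powr b * f t\<close>
  preserves the decay, removes the exponent \<open>b\<close> and multiplies the coefficient of
  \<open>a\<close> by \<open>of_real h powr a - of_real h powr b\<close>. A dilation
  \<open>h\<close> for which this factor is nonzero reduces the claim for \<open>a\<close> to a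
  shorter sum.\<close>

lemma powr_sum_bigo_imp_zero:
  assumes "finite A"
    and "(\<lambda>t. \<Sum>a\<in>A. k a * of_real t powr a :: complex) \<in> O[at_top](\<lambda>t::real. of_real (t powr -L))"
    and "a \<in> A" "Re a > -L"
  shows "k a = 0"
  using assms
proof (induction A arbitrary: k a rule: finite_induct)
  case (insert b A)
  define f where "f t = (\<Sum>a\<in>insert b A. k a * of_real t powr a)" for t :: real
  let ?O = "O[at_top](\<lambda>t::real. complex_of_real (t powr -L))"
  have f: "f \<in> ?O" using insert.prems(1) by (simp add: f_def[abs_def])
  have A: "k a = 0" if a: "a \<in> A" "Re a > -L" for a
  proof -
    have "a \<noteq> b" using a insert.hyps by auto
    then obtain h :: real where h: "h > 0" "of_real h powr a \<noteq> (of_real h powr b :: complex)"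
      using powr_separates by blast
    have "(\<lambda>t. f (h * t)) \<in> O[at_top](\<lambda>t. complex_of_real ((h * t) powr -L))"
      by (rule landau_o.big.compose[OF f])
        (use h in \<open>auto intro!: filterlim_tendsto_pos_mult_at_top[OF tendsto_const] filterlim_ident\<close>)
    also have "(\<lambda>t. complex_of_real ((h * t) powr -L)) \<in> ?O"
    proof (rule landau_o.bigI[of "h powr -L"])
      show "\<forall>\<^sub>F t in at_top. norm (complex_of_real ((h * t) powr -L))
          \<le> h powr -L * norm (complex_of_real (t powr -L))"
        using eventually_gt_at_top[of 0] by eventually_elim (use h in \<open>simp add: powr_mult norm_mult\<close>)
    qed (use h in simp)
    finally have "(\<lambda>t. f (h * t)) \<in> ?O" .
    moreover have "(\<lambda>t. of_real h powr b * f t) \<in> ?O"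
      using f by (cases "h = 0") simp_all
    ultimately have "(\<lambda>t. f (h * t) - of_real h powr b * f t) \<in> ?O"
      by (rule sum_in_bigo)
    also have "?this \<longleftrightarrow> (\<lambda>t. \<Sum>a\<in>A. (k a * (of_real h powr a - of_real h powr b)) * of_real t powr a) \<in> ?O"
    proof (rule landau_o.big.in_cong)
      show "\<forall>\<^sub>F t in at_top. f (h * t) - of_real h powr b * f t
          = (\<Sum>a\<in>A. (k a * (of_real h powr a - of_real h powr b)) * of_real t powr a)"
        using eventually_gt_at_top[of 0]
      proof eventually_elim
        case (elim t)
        have pm: "of_real (h * t) powr c = of_real h powr c * (of_real t powr c :: complex)" for c :: complex
          using h elim by (simp add: powr_times_real)
        have "f (h * t) - of_real h powr b * f t
           = (\<Sum>a\<in>insert b A. (k a * (of_real h powr a - of_real h powr b)) * of_real t powr a)"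
          unfolding f_def sum_distrib_left sum_subtractf[symmetric] pm
          by (intro sum.cong refl) (simp add: algebra_simps)
        also have "\<dots> = (\<Sum>a\<in>A. (k a * (of_real h powr a - of_real h powr b)) * of_real t powr a)"
          using insert.hyps by simp
        finally show ?case .
      qed
    qed
    finally have "k a * (of_real h powr a - of_real h powr b) = 0"
      by (intro insert.IH a)
    then show ?thesis using h by simp
  qed
  show ?case
  proof (cases "a = b")
    case True
    \<comment> \<open>Exponents with real part above \<open>-L\<close> have coefficient 0 by
      \<open>A\<close>, and the others decay fast enough by themselves. Subtracting them isolates
      the term of exponent \<open>b\<close>.\<close>
    have "(\<lambda>t. \<Sum>a\<in>A. k a * of_real t powr a) \<in> ?O"
    proof (rule big_sum_in_bigo)
      fix c assume "c \<in> A"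
      then show "(\<lambda>t. k c * of_real t powr c) \<in> ?O"
        using A[of c] powr_bigo[of c L "k c"] by (cases "Re c > -L") auto
    qed
    then have "(\<lambda>t. f t - (\<Sum>a\<in>A. k a * of_real t powr a)) \<in> ?O"
      using f by (intro sum_in_bigo)
    also have "(\<lambda>t. f t - (\<Sum>a\<in>A. k a * of_real t powr a)) = (\<lambda>t. k b * of_real t powr b)"
      using insert.hyps by (simp add: f_def)
    finally show ?thesis using powr_bigo_imp_le insert.prems True by blast
  next
    case False
    then show ?thesis using A insert.prems by auto
  qed
qed simp


text \<open>Components of all degrees are carried along together, since a \<xi>-derivative shifts
  degrees and a product mixes them. Adding one expansion at a time replaces finite sums with indexed
  data by a rule induction. All conditions are restricted to \<open>U\<close> and, for components,
  to \<xi> \<noteq> 0, where alone these functions are determined.\<close>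

inductive has_components ::
  "(real^'n::finite) set \<Rightarrow> ('n pt \<Rightarrow> complex) \<Rightarrow> ('n pt \<Rightarrow> complex) \<Rightarrow> (complex \<Rightarrow> 'n pt \<Rightarrow> complex) \<Rightarrow> bool"
  for U :: "(real^'n::finite) set" and \<kappa> :: "'n pt \<Rightarrow> complex" where
  zero: "(\<And>x \<xi>. x \<in> U \<Longrightarrow> \<sigma> (x, \<xi>) = 0) \<Longrightarrow> (\<And>a x \<xi>. x \<in> U \<Longrightarrow> \<xi> \<noteq> 0 \<Longrightarrow> c a (x, \<xi>) = 0) \<Longrightarrow>
    has_components U \<kappa> \<sigma> c"
| add: "has_components U \<kappa> \<sigma> c \<Longrightarrow> classical_expansion U \<kappa> m \<rho> s \<Longrightarrow>
    (\<And>x \<xi>. x \<in> U \<Longrightarrow> \<sigma>' (x, \<xi>) = \<sigma> (x, \<xi>) + \<rho> (x, \<xi>)) \<Longrightarrow>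
    (\<And>a x \<xi>. x \<in> U \<Longrightarrow> \<xi> \<noteq> 0 \<Longrightarrow> c' a (x, \<xi>) = c a (x, \<xi>) + (\<Sum>i | m - of_nat i = a. s i (x, \<xi>))) \<Longrightarrow>
    has_components U \<kappa> \<sigma>' c'"

lemma has_components_cong:
  assumes "has_components U \<kappa> \<sigma> c" "\<And>x \<xi>. x \<in> U \<Longrightarrow> \<sigma>' (x, \<xi>) = \<sigma> (x, \<xi>)"
    "\<And>a x \<xi>. x \<in> U \<Longrightarrow> \<xi> \<noteq> 0 \<Longrightarrow> c' a (x, \<xi>) = c a (x, \<xi>)"
  shows "has_components U \<kappa> \<sigma>' c'"
  using assms
proof (cases rule: has_components.cases)
  case zero
  then show ?thesis using assms by (intro has_components.zero) simp_all
next
  case (add \<sigma>0 c0 m \<rho> s)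
  show ?thesis by (rule has_components.add[OF add(1,2)]) (simp_all add: assms add)
qed

lemma has_components_zero: "has_components U \<kappa> (\<lambda>p. 0) (\<lambda>a p. 0)"
  by (rule has_components.zero) simp_all

lemma has_components_expansion:
  assumes "classical_expansion U \<kappa> m \<sigma> s"
  shows "has_components U \<kappa> \<sigma> (\<lambda>a p. \<Sum>i | m - of_nat i = a. s i p)"
  by (rule has_components.add[OF has_components_zero assms]) simp_all

lemma has_components_add:
  assumes "has_components U \<kappa> \<sigma> c" "has_components U \<kappa> \<sigma>' c'"
  shows "has_components U \<kappa> (\<lambda>p. \<sigma> p + \<sigma>' p) (\<lambda>a p. c a p + c' a p)"
  using assms(2)
proof (induction)
  case (zero \<sigma>' c')
  show ?case by (rule has_components_cong[OF assms(1)]) (simp_all add: zero)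
next
  case (add \<sigma>' c' m \<rho> s \<sigma>'' c'')
  show ?case by (rule has_components.add[OF add.IH add.hyps(2)]) (simp_all add: add.hyps)
qed

lemma has_components_sum:
  assumes "\<And>i. i \<in> I \<Longrightarrow> has_components U \<kappa> (\<sigma> i) (c i)"
  shows "has_components U \<kappa> (\<lambda>p. \<Sum>i\<in>I. \<sigma> i p) (\<lambda>a p. \<Sum>i\<in>I. c i a p)"
  using assms
  by (induction I rule: infinite_finite_induct) (auto intro: has_components_zero has_components_add)

lemma smooth_on_punctured_cong:
  fixes f :: "'n::finite pt \<Rightarrow> complex"
  assumes "open U" "smooth_on (U \<times> (UNIV - {0})) f"
    and "\<And>x \<xi>. x \<in> U \<Longrightarrow> \<xi> \<noteq> 0 \<Longrightarrow> g (x, \<xi>) = f (x, \<xi>)"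
  shows "smooth_on (U \<times> (UNIV - {0})) g"
proof (rule smooth_on_cong[OF open_punctured[OF assms(1)] assms(2)])
  show "f y = g y" if "y \<in> U \<times> (UNIV - {0})" for y
    using that by (cases y) (simp add: assms(3))
qed

lemma dird_punctured_cong:
  fixes f :: "'n::finite pt \<Rightarrow> complex"
  assumes "open U" "x \<in> U" "\<xi> \<noteq> 0" and "\<And>x \<xi>. x \<in> U \<Longrightarrow> \<xi> \<noteq> 0 \<Longrightarrow> f (x, \<xi>) = g (x, \<xi>)"
  shows "dird v f (x, \<xi>) = dird v g (x, \<xi>)"
proof (rule dird_cong[OF open_punctured[OF assms(1)]])
  show "f y = g y" if "y \<in> U \<times> (UNIV - {0})" for y
    using that by (cases y) (simp add: assms(4))
qed (use assms(2,3) in simp)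

context
  fixes U :: "(real^'n::finite) set" and \<kappa> :: "'n pt \<Rightarrow> complex"
  assumes U: "open U" and \<kappa>: "cutoff U \<kappa>"
begin

lemma has_components_scale:
  "has_components U \<kappa> \<sigma> c \<Longrightarrow> has_components U \<kappa> (\<lambda>p. k * \<sigma> p) (\<lambda>a p. k * c a p)"
proof (induction rule: has_components.induct)
  case (zero \<sigma> c)
  then show ?case by (intro has_components.zero) simp_all
next
  case (add \<sigma> c m \<rho> s \<sigma>' c')
  show ?case by (rule has_components.add[OF add.IH expansion_scale[OF U \<kappa> add.hyps(2), of k]])
    (simp_all add: add.hyps sum_distrib_left distrib_left)
qed

lemma has_components_smooth:
  "has_components U \<kappa> \<sigma> c \<Longrightarrow> smooth_on (U \<times> UNIV) \<sigma>"
  and has_components_smooth_component: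
  "has_components U \<kappa> \<sigma> c \<Longrightarrow> smooth_on (U \<times> (UNIV - {0})) (c a)"
  and has_components_homogeneous:
  "has_components U \<kappa> \<sigma> c \<Longrightarrow> pos_homogeneous U a (c a)"
proof (induction rule: has_components.induct)
  case (zero \<sigma> c)
  { case 1
    show ?case by (rule smooth_on_cong[OF open_phase[OF U] smooth_on_const[of _ 0]]) (auto simp: zero) }
  { case 2
    show ?case by (rule smooth_on_punctured_cong[OF U smooth_on_const[of _ 0]]) (simp add: zero) }
  { case 3
    show ?case by (rule pos_homogeneousI) (simp add: zero) }
next
  case (add \<sigma> c m \<rho> s \<sigma>' c')
  note e = expansionD[OF U \<kappa> add.hyps(2)]
  { case 1
    show ?case
      by (rule smooth_on_cong[OF open_phase[OF U] smooth_on_add[OF open_phase[OF U] add.IH(1) e(5)]])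
        (auto simp: add.hyps) }
  { case 2
    show ?case
      by (rule smooth_on_punctured_cong[OF U smooth_on_add[OF open_punctured[OF U] add.IH(2)
            smooth_on_sum[OF open_punctured[OF U] e(2)]]])
        (simp add: add.hyps) }
  { case 3
    show ?case
      by (rule pos_homogeneous_cong[OF pos_homogeneous_add[OF add.IH(3) pos_homogeneous_sum]])
        (auto intro: e(3) simp: add.hyps) }
qed

lemma has_components_dird:
  fixes d :: real
  assumes sym: "\<And>m f. symbol U m f \<Longrightarrow> symbol U (m - d) (dird v f)"
    and hom: "\<And>a h. smooth_on (U \<times> (UNIV - {0})) h \<Longrightarrow> pos_homogeneous U a h \<Longrightarrow>
      pos_homogeneous U (a - of_real d) (dird v h)"
    and "has_components U \<kappa> \<sigma> c"
  shows "has_components U \<kappa> (dird v \<sigma>) (\<lambda>a. dird v (c (a + of_real d)))"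
  using assms(3)
proof (induction rule: has_components.induct)
  case (zero \<sigma> c)
  have "dird v \<sigma> (x, \<xi>) = dird v (\<lambda>p. 0) (x, \<xi>)" if "x \<in> U" for x \<xi>
    by (rule dird_cong[OF open_phase[OF U]]) (auto simp: that zero)
  moreover have "dird v (c a) (x, \<xi>) = dird v (\<lambda>p. 0) (x, \<xi>)" if "x \<in> U" "\<xi> \<noteq> 0" for x \<xi> a
    by (rule dird_punctured_cong[OF U that]) (simp add: zero)
  ultimately show ?case by (intro has_components.zero) simp_all
next
  case (add \<sigma> c m \<rho> s \<sigma>' c')
  note e = expansionD[OF U \<kappa> add.hyps(2)]
  show ?case
  proof (rule has_components.add[OF add.IH expansion_dird[OF U \<kappa> sym hom add.hyps(2)]])
    fix x \<xi> :: "real^'n" assume x: "x \<in> U"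
    then have p: "(x, \<xi>) \<in> U \<times> UNIV" by simp
    have "dird v \<sigma>' (x, \<xi>) = dird v (\<lambda>p. \<sigma> p + \<rho> p) (x, \<xi>)"
      by (rule dird_cong[OF open_phase[OF U] p]) (auto simp: add.hyps)
    also have "\<dots> = dird v \<sigma> (x, \<xi>) + dird v \<rho> (x, \<xi>)"
      by (intro dird_add smooth_on_differentiable_at[OF _ open_phase[OF U] p] e(5)
          has_components_smooth[OF add.hyps(1)])
    finally show "dird v \<sigma>' (x, \<xi>) = dird v \<sigma> (x, \<xi>) + dird v \<rho> (x, \<xi>)" .
    fix a :: complex assume \<xi>: "\<xi> \<noteq> 0"
    with x have q: "(x, \<xi>) \<in> U \<times> (UNIV - {0})" by simp
    let ?I = "{i. m - of_nat i = a + of_real d}"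
    note D = smooth_on_differentiable_at[OF _ open_punctured[OF U] q]
    have "dird v (c' (a + of_real d)) (x, \<xi>) = dird v (\<lambda>p. c (a + of_real d) p + (\<Sum>i\<in>?I. s i p)) (x, \<xi>)"
      by (rule dird_punctured_cong[OF U x \<xi>]) (simp add: add.hyps)
    also have "\<dots> = dird v (c (a + of_real d)) (x, \<xi>) + dird v (\<lambda>p. \<Sum>i\<in>?I. s i p) (x, \<xi>)"
      by (intro dird_add D smooth_on_sum open_punctured U e(2) has_components_smooth_component[OF add.hyps(1)])
    also have "dird v (\<lambda>p. \<Sum>i\<in>?I. s i p) (x, \<xi>) = (\<Sum>i\<in>?I. dird v (s i) (x, \<xi>))"
      by (intro dird_sum D e(2))
    also have "?I = {i. m - of_real d - of_nat i = a}" by (auto simp: algebra_simps)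
    finally show "dird v (c' (a + of_real d)) (x, \<xi>) = dird v (c (a + of_real d)) (x, \<xi>)
      + (\<Sum>i | m - of_real d - of_nat i = a. dird v (s i) (x, \<xi>))" .
  qed
qed

lemma has_components_dx:
  assumes "has_components U \<kappa> \<sigma> c"
  shows "has_components U \<kappa> (dx i \<sigma>) (\<lambda>a. dx i (c a))"
  using has_components_dird[of 0 "(axis i 1, 0)" \<sigma> c] symbol_dx[OF U, of _ _ i] pos_homogeneous_dx[OF U, of _ _ i] assms
  by (simp add: dx_eq_dird)

lemma has_components_dxi:
  assumes "has_components U \<kappa> \<sigma> c"
  shows "has_components U \<kappa> (dxi i \<sigma>) (\<lambda>a. dxi i (c (a + 1)))"
  using has_components_dird[of 1 "(0, axis i 1)" \<sigma> c] symbol_dxi[of U _ _ i] pos_homogeneous_dxi[OF U, of _ _ i] assms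
  by (simp add: dxi_eq_dird)

lemma has_components_mult_expansion:
  assumes e: "classical_expansion U \<kappa> m \<rho> s" and "has_components U \<kappa> \<sigma> c"
  shows "\<exists>c'. has_components U \<kappa> (\<lambda>p. \<rho> p * \<sigma> p) c'"
  using assms(2)
proof (induction rule: has_components.induct)
  case (zero \<sigma> c)
  have "has_components U \<kappa> (\<lambda>p. \<rho> p * \<sigma> p) (\<lambda>a p. 0)" by (rule has_components.zero) (simp_all add: zero)
  then show ?case by (rule exI[of _ "\<lambda>a p. 0"])
next
  case (add \<sigma> c m' \<rho>' s' \<sigma>' c')
  from add.IH obtain c0 where c0: "has_components U \<kappa> (\<lambda>p. \<rho> p * \<sigma> p) c0" ..
  show ?case
    by (rule exI, rule has_components_cong[OF has_components_add[OF c0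
            has_components_expansion[OF expansion_mult[OF U \<kappa> e add.hyps(2)]]]])
      (simp_all add: add.hyps distrib_left)
qed

text \<open>By bilinearity this reduces to products of two expansions. Existence of a family is
  enough here, because uniqueness pins it down afterwards.\<close>

lemma has_components_mult:
  assumes "has_components U \<kappa> \<sigma> c" "has_components U \<kappa> \<sigma>' c'"
  shows "\<exists>c''. has_components U \<kappa> (\<lambda>p. \<sigma> p * \<sigma>' p) c''"
  using assms(1)
proof (induction rule: has_components.induct)
  case (zero \<sigma> c)
  have "has_components U \<kappa> (\<lambda>p. \<sigma> p * \<sigma>' p) (\<lambda>a p. 0)" by (rule has_components.zero) (simp_all add: zero)
  then show ?case by (rule exI[of _ "\<lambda>a p. 0"])
next
  case (add \<sigma> c m \<rho> s \<tau> c1)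
  from add.IH obtain c2 where c2: "has_components U \<kappa> (\<lambda>p. \<sigma> p * \<sigma>' p) c2" ..
  obtain c3 where c3: "has_components U \<kappa> (\<lambda>p. \<rho> p * \<sigma>' p) c3"
    using has_components_mult_expansion[OF add.hyps(2) assms(2)] ..
  show ?case
    by (rule exI, rule has_components_cong[OF has_components_add[OF c2 c3]])
      (simp_all add: add.hyps distrib_right)
qed

end

lemma has_components_imp_is_component:
  fixes U :: "(real^'n::finite) set"
  assumes "has_components U \<kappa> \<sigma> c"
  shows "is_component U \<kappa> \<sigma> a (c a)"
proof -
  have "\<exists>r m \<rho> s. (\<forall>k<r::nat. classical_expansion U \<kappa> (m k) (\<rho> k) (s k)) \<and>
        (\<forall>x\<in>U. \<forall>\<xi>. \<sigma> (x, \<xi>) = (\<Sum>k<r. \<rho> k (x, \<xi>))) \<and>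
        (\<forall>a. \<forall>x\<in>U. \<forall>\<xi>. \<xi> \<noteq> 0 \<longrightarrow> c a (x, \<xi>) = (\<Sum>k<r. \<Sum>i | m k - of_nat i = a. s k i (x, \<xi>)))"
    using assms
  proof (induction rule: has_components.induct)
    case (zero \<sigma> c)
    then show ?case by (intro exI[of _ 0]) simp
  next
    case (add \<sigma> c m0 \<rho>0 s0 \<sigma>' c')
    from add.IH obtain r m \<rho> s where IH: "\<forall>k<r::nat. classical_expansion U \<kappa> (m k) (\<rho> k) (s k)"
      "\<forall>x\<in>U. \<forall>\<xi>. \<sigma> (x, \<xi>) = (\<Sum>k<r. \<rho> k (x, \<xi>))"
      "\<forall>a. \<forall>x\<in>U. \<forall>\<xi>. \<xi> \<noteq> 0 \<longrightarrow> c a (x, \<xi>) = (\<Sum>k<r. \<Sum>i | m k - of_nat i = a. s k i (x, \<xi>))"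
      by (elim exE conjE)
    show ?case
    proof (intro exI[of _ "Suc r"] exI[of _ "m(r := m0)"] exI[of _ "\<rho>(r := \<rho>0)"] exI[of _ "s(r := s0)"]
        conjI allI impI ballI)
      fix k assume "k < Suc r"
      then show "classical_expansion U \<kappa> ((m(r := m0)) k) ((\<rho>(r := \<rho>0)) k) ((s(r := s0)) k)"
        using IH(1) add.hyps(2) by (cases "k = r") auto
    next
      fix x \<xi> assume "x \<in> U"
      then show "\<sigma>' (x, \<xi>) = (\<Sum>k<Suc r. (\<rho>(r := \<rho>0)) k (x, \<xi>))"
        using IH(2) by (simp add: add.hyps)
    next
      fix a x and \<xi> :: "real^'n" assume "x \<in> U" "\<xi> \<noteq> 0"
      then show "c' a (x, \<xi>) = (\<Sum>k<Suc r. \<Sum>i | (m(r := m0)) k - of_nat i = a. (s(r := s0)) k i (x, \<xi>))"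
        using IH(3) by (simp add: add.hyps)
    qed
  qed
  then show ?thesis unfolding is_component_def
    by (elim ex_forward conj_forward) (assumption | simp)+
qed

text \<open>The witnesses of \<open>is_component\<close> for one degree consist of whole expansions,
  so they yield the components of every degree.\<close>

lemma is_component_imp_has_components:
  fixes U :: "(real^'n::finite) set"
  assumes "is_component U \<kappa> \<sigma> a \<tau>"
  shows "\<exists>c. has_components U \<kappa> \<sigma> c \<and> (\<forall>x\<in>U. \<forall>\<xi>. \<xi> \<noteq> 0 \<longrightarrow> \<tau> (x, \<xi>) = c a (x, \<xi>))"
proof -
  from assms obtain r m \<rho> s where *: "\<forall>k<r::nat. classical_expansion U \<kappa> (m k) (\<rho> k) (s k)"
      "\<forall>x\<in>U. \<forall>\<xi>. \<sigma> (x, \<xi>) = (\<Sum>k<r. \<rho> k (x, \<xi>))"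
      "\<forall>x\<in>U. \<forall>\<xi>. \<xi> \<noteq> 0 \<longrightarrow> \<tau> (x, \<xi>) = (\<Sum>k<r. \<Sum>i | m k - of_nat i = a. s k i (x, \<xi>))"
    unfolding is_component_def by (elim exE conjE)
  let ?c = "\<lambda>a p. \<Sum>k<r. \<Sum>i | m k - of_nat i = a. s k i p"
  have "has_components U \<kappa> (\<lambda>p. \<Sum>k<r. \<rho> k p) ?c"
    by (rule has_components_sum, rule has_components_expansion) (use *(1) in simp)
  then have "has_components U \<kappa> \<sigma> ?c"
    by (rule has_components_cong) (use *(2) in simp_all)
  then show ?thesis using *(3) by (intro exI[of _ ?c]) simp
qed


text \<open>As soon as \<open>t \<ge> 1 / norm \<xi>\<close> the cutoff is 1, and homogeneity turns
  the partial sum into powers of \<open>t\<close>. The third condition on \<open>N\<close> makes the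
  exponent nonpositive, so that \<open>1 + norm (t *\<^sub>R \<xi>)\<close> may be replaced by the
  smaller \<open>t * norm \<xi>\<close>.\<close>

lemma expansion_ray_asymptotics:
  fixes U :: "(real^'n::finite) set"
  assumes U: "open U" and \<kappa>: "cutoff U \<kappa>"
    and e: "classical_expansion U \<kappa> m \<rho> s" and x: "x \<in> U" "\<xi> \<noteq> 0"
    and N: "N > 0" "Re m - real N - 1 \<le> -L" "Re m - real N - 1 \<le> 0"
  shows "(\<lambda>t. \<rho> (x, t *\<^sub>R \<xi>) - (\<Sum>i\<le>N. of_real t powr (m - of_nat i) * s i (x, \<xi>)))
    \<in> O[at_top](\<lambda>t::real. of_real (t powr -L))"
proof -
  let ?e = "Re m - real N - 1" and ?R = "\<lambda>p. \<rho> p - (\<Sum>i\<le>N. \<kappa> p * s i p)"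
  have "growth U ?e ?R" by (rule symbol_growth[OF expansionD(4)[OF U \<kappa> e N(1)]])
  from growthD[OF this, of "{x}"] x
  obtain C where C: "\<And>\<xi>. norm (?R (x, \<xi>)) \<le> C * (1 + norm \<xi>) powr ?e" by auto
  let ?C = "\<bar>C\<bar> * norm \<xi> powr ?e + 1"
  show ?thesis
  proof (rule landau_o.bigI[of ?C])
    show "\<forall>\<^sub>F t in at_top. norm (\<rho> (x, t *\<^sub>R \<xi>) - (\<Sum>i\<le>N. of_real t powr (m - of_nat i) * s i (x, \<xi>)))
        \<le> ?C * norm (complex_of_real (t powr -L))"
      using eventually_ge_at_top[of 1] eventually_ge_at_top[of "1 / norm \<xi>"]
    proof eventually_elim
      case (elim t)
      have t: "norm (t *\<^sub>R \<xi>) \<ge> 1" using elim x by (simp add: field_simps)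
      have "?R (x, t *\<^sub>R \<xi>) = \<rho> (x, t *\<^sub>R \<xi>) - (\<Sum>i\<le>N. of_real t powr (m - of_nat i) * s i (x, \<xi>))"
        using elim x by (simp add: cutoff_1[OF U \<kappa> x(1) t] pos_homogeneousD[OF expansionD(3)[OF U \<kappa> e]])
      then have "norm (\<rho> (x, t *\<^sub>R \<xi>) - (\<Sum>i\<le>N. of_real t powr (m - of_nat i) * s i (x, \<xi>)))
          \<le> C * (1 + norm (t *\<^sub>R \<xi>)) powr ?e"
        using C[of "t *\<^sub>R \<xi>"] by simp
      also have "\<dots> \<le> \<bar>C\<bar> * (t * norm \<xi>) powr ?e"
        using elim x N(3) by (intro mult_mono powr_mono2') auto
      also have "\<dots> = \<bar>C\<bar> * norm \<xi> powr ?e * t powr ?e"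
        using elim by (simp add: powr_mult)
      also have "\<dots> \<le> ?C * t powr -L"
        using elim N(2) by (intro mult_mono powr_mono) auto
      finally show ?case using elim by simp
    qed
  qed (simp add: add_nonneg_pos)
qed

text \<open>Quantifying over all finite supersets of \<open>A0\<close> is what lets the induction go
  through: the exponents of a newly added expansion can be joined to those found before, and
  coinciding exponents are merged without case distinctions.\<close>

lemma has_components_ray_asymptotics:
  fixes U :: "(real^'n::finite) set"
  assumes U: "open U" and \<kappa>: "cutoff U \<kappa>" and x: "x \<in> U" "\<xi> \<noteq> 0"
    and "has_components U \<kappa> \<sigma> c"
  shows "\<exists>A0. finite A0 \<and> (\<forall>A. finite A \<longrightarrow> A0 \<subseteq> A \<longrightarrow>
    (\<lambda>t. \<sigma> (x, t *\<^sub>R \<xi>) - (\<Sum>a\<in>A. c a (x, \<xi>) * of_real t powr a))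
      \<in> O[at_top](\<lambda>t::real. of_real (t powr -L)))"
  using assms(5)
proof (induction rule: has_components.induct)
  case (zero \<sigma> c)
  show ?case using x by (intro exI[of _ "{}"]) (simp add: zero)
next
  case (add \<sigma> c m \<rho> s \<sigma>' c')
  let ?O = "O[at_top](\<lambda>t::real. complex_of_real (t powr -L))"
  from add.IH obtain A0 where A0: "finite A0" "\<And>A. finite A \<Longrightarrow> A0 \<subseteq> A \<Longrightarrow>
    (\<lambda>t. \<sigma> (x, t *\<^sub>R \<xi>) - (\<Sum>a\<in>A. c a (x, \<xi>) * of_real t powr a)) \<in> ?O" by auto
  \<comment> \<open>Large enough for the remainder after \<open>N\<close> terms to be of nonpositive
    order at most \<open>-L\<close>, and for each single term beyond \<open>N\<close> to decay at
    that rate too.\<close>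
  obtain N :: nat where N: "real N > \<bar>Re m\<bar> + \<bar>L\<bar>" using reals_Archimedean2 by blast
  have N': "N > 0" "Re m - real N - 1 \<le> -L" "Re m - real N - 1 \<le> 0" using N by auto
  show ?case
  proof (intro exI[of _ "A0 \<union> (\<lambda>i. m - of_nat i) ` {..N}"] conjI allI impI)
    fix A :: "complex set" assume A: "finite A" "A0 \<union> (\<lambda>i. m - of_nat i) ` {..N} \<subseteq> A"
    \<comment> \<open>\<open>A\<close> may contain exponents of this expansion beyond index
      \<open>N\<close>. Injectivity of \<open>i \<mapsto> m - of_nat i\<close> keeps
      \<open>J\<close> finite, and the extra terms are negligible.\<close>
    define J where "J = {i. m - of_nat i \<in> A}"
    have "finite ((\<lambda>i. m - of_nat i) -` A)"
      by (rule finite_vimageI[OF A(1)]) (simp add: inj_def)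
    then have J: "finite J" "{..N} \<subseteq> J" using A(2) by (auto simp: J_def vimage_def)
    let ?g = "\<lambda>t::real. \<lambda>i. of_real t powr (m - of_nat i) * s i (x, \<xi>)"
    have "(\<lambda>t. \<Sum>i\<in>J - {..N}. ?g t i) \<in> ?O"
    proof (rule big_sum_in_bigo)
      fix i assume "i \<in> J - {..N}"
      then have "real i > real N" by simp
      then have "Re (m - of_nat i) \<le> -L" using N by simp
      from powr_bigo[OF this, of "s i (x, \<xi>)"] show "(\<lambda>t. ?g t i) \<in> ?O" by (simp add: mult.commute)
    qed
    note S1 = this
    have S2: "(\<lambda>t. \<sigma> (x, t *\<^sub>R \<xi>) - (\<Sum>a\<in>A. c a (x, \<xi>) * of_real t powr a)) \<in> ?O"
      using A by (intro A0) auto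
    have S3: "(\<lambda>t. \<rho> (x, t *\<^sub>R \<xi>) - (\<Sum>i\<le>N. ?g t i)) \<in> ?O"
      by (rule expansion_ray_asymptotics[OF U \<kappa> add.hyps(2) x N'])
    have "(\<lambda>t. (\<sigma> (x, t *\<^sub>R \<xi>) - (\<Sum>a\<in>A. c a (x, \<xi>) * of_real t powr a))
      + (\<rho> (x, t *\<^sub>R \<xi>) - (\<Sum>i\<le>N. ?g t i)) - (\<Sum>i\<in>J - {..N}. ?g t i)) \<in> ?O"
      by (rule sum_in_bigo(2)[OF sum_in_bigo(1)[OF S2 S3] S1])
    moreover have "(\<sigma> (x, t *\<^sub>R \<xi>) - (\<Sum>a\<in>A. c a (x, \<xi>) * of_real t powr a))
      + (\<rho> (x, t *\<^sub>R \<xi>) - (\<Sum>i\<le>N. ?g t i)) - (\<Sum>i\<in>J - {..N}. ?g t i)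
      = \<sigma>' (x, t *\<^sub>R \<xi>) - (\<Sum>a\<in>A. c' a (x, \<xi>) * of_real t powr a)" for t
    proof -
      have "(\<Sum>a\<in>A. (\<Sum>i | m - of_nat i = a. s i (x, \<xi>)) * of_real t powr a)
        = (\<Sum>a\<in>A. \<Sum>i\<in>{i \<in> J. m - of_nat i = a}. ?g t i)"
        unfolding sum_distrib_right by (intro sum.cong) (auto simp: J_def mult.commute)
      also have "\<dots> = (\<Sum>i\<in>J. ?g t i)"
        using J A by (intro sum.group) (auto simp: J_def)
      also have "\<dots> = (\<Sum>i\<in>J - {..N}. ?g t i) + (\<Sum>i\<le>N. ?g t i)"
        by (rule sum.subset_diff[OF J(2,1)])
      finally have *: "(\<Sum>a\<in>A. (\<Sum>i | m - of_nat i = a. s i (x, \<xi>)) * of_real t powr a)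
        = (\<Sum>i\<in>J - {..N}. ?g t i) + (\<Sum>i\<le>N. ?g t i)" .
      show ?thesis using x by (simp add: add.hyps distrib_right sum.distrib *)
    qed
    ultimately show "(\<lambda>t. \<sigma>' (x, t *\<^sub>R \<xi>) - (\<Sum>a\<in>A. c' a (x, \<xi>) * of_real t powr a)) \<in> ?O"
      by simp
  qed (use A0 in simp)
qed

text \<open>The symbol has to vanish only over the one point \<open>x\<close>. So the lemma serves
  twice: for uniqueness of components, and for showing that components inherit the support in
  x.\<close>

lemma has_components_zero_on_ray:
  fixes U :: "(real^'n::finite) set"
  assumes U: "open U" and \<kappa>: "cutoff U \<kappa>" and x: "x \<in> U" "\<xi> \<noteq> 0"
    and c: "has_components U \<kappa> \<sigma> c" and 0: "\<And>\<xi>. \<sigma> (x, \<xi>) = 0"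
  shows "c a (x, \<xi>) = 0"
proof -
  \<comment> \<open>Chosen so that \<open>Re a = -L + 1\<close> lies above the decay rate
    \<open>-L\<close>. The exponent \<open>a\<close> is then inserted into the set, in case it does
    not occur there.\<close>
  define L where "L = - Re a + 1"
  obtain A0 where A0: "finite A0" "\<And>A. finite A \<Longrightarrow> A0 \<subseteq> A \<Longrightarrow>
    (\<lambda>t. \<sigma> (x, t *\<^sub>R \<xi>) - (\<Sum>a\<in>A. c a (x, \<xi>) * of_real t powr a))
      \<in> O[at_top](\<lambda>t::real. of_real (t powr -L))"
    using has_components_ray_asymptotics[OF U \<kappa> x c, of L] by auto
  show ?thesis
  proof (rule powr_sum_bigo_imp_zero[of "insert a A0" "\<lambda>a. c a (x, \<xi>)" L])
    have "(\<lambda>t. - (\<Sum>a\<in>insert a A0. c a (x, \<xi>) * of_real t powr a)) \<in> O[at_top](\<lambda>t::real. of_real (t powr -L))"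
      using A0(2)[OF finite.insertI[OF A0(1)] subset_insertI, of a] unfolding 0 diff_0 .
    then show "(\<lambda>t. \<Sum>a\<in>insert a A0. c a (x, \<xi>) * of_real t powr a) \<in> O[at_top](\<lambda>t::real. of_real (t powr -L))"
      by (simp only: landau_o.big.uminus_in_iff)
  qed (use A0 in \<open>auto simp: L_def\<close>)
qed

text \<open>The chosen component belongs to some family for \<sigma>. Its difference from the given
  family is a family for \<open>\<sigma> - \<sigma>\<close>, the zero symbol, and therefore
  vanishes.\<close>

lemma component_eq:
  fixes U :: "(real^'n::finite) set"
  assumes U: "open U" and \<kappa>: "cutoff U \<kappa>" and c: "has_components U \<kappa> \<sigma> c"
    and x: "x \<in> U" "\<xi> \<noteq> 0"
  shows "component U \<kappa> \<sigma> a (x, \<xi>) = c a (x, \<xi>)"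
proof -
  have "is_component U \<kappa> \<sigma> a (component U \<kappa> \<sigma> a)"
    unfolding component_def by (rule someI[of "is_component U \<kappa> \<sigma> a"])
      (rule has_components_imp_is_component[OF c])
  then obtain c' where c': "has_components U \<kappa> \<sigma> c'"
    "\<forall>x\<in>U. \<forall>\<xi>. \<xi> \<noteq> 0 \<longrightarrow> component U \<kappa> \<sigma> a (x, \<xi>) = c' a (x, \<xi>)"
    using is_component_imp_has_components by blast
  have "has_components U \<kappa> (\<lambda>p. \<sigma> p + (-1) * \<sigma> p) (\<lambda>a p. c a p + (-1) * c' a p)"
    by (intro has_components_add has_components_scale U \<kappa> c c'(1))
  from has_components_zero_on_ray[OF U \<kappa> x this, of a] show ?thesis
    using c'(2) x by simp
qed

lemma has_components_sum_ex:
  assumes "\<And>i. i \<in> I \<Longrightarrow> \<exists>c. has_components U \<kappa> (\<sigma> i) c"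
  shows "\<exists>c. has_components U \<kappa> (\<lambda>p. \<Sum>i\<in>I. \<sigma> i p) c"
proof -
  have "\<forall>i\<in>I. \<exists>c. has_components U \<kappa> (\<sigma> i) c" using assms by blast
  from bchoice[OF this] obtain c where "\<forall>i\<in>I. has_components U \<kappa> (\<sigma> i) (c i)" ..
  then have "has_components U \<kappa> (\<lambda>p. \<Sum>i\<in>I. \<sigma> i p) (\<lambda>a p. \<Sum>i\<in>I. c i a p)"
    by (intro has_components_sum) simp
  then show ?thesis by (rule exI[of _ "\<lambda>a p. \<Sum>i\<in>I. c i a p"])
qed

lemma \<Omega>CS_has_components:
  fixes U :: "(real^'n::{finite,linorder}) set"
  assumes U: "open U" and \<kappa>: "cutoff U \<kappa>" and "\<beta> \<in> \<Omega>CS U \<kappa>"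
  shows "\<exists>c. has_components U \<kappa> (\<beta> I J) c"
  using assms(3)
proof (induction arbitrary: I J)
  case (base k m \<alpha>)
  show ?case
  proof (cases "card I + card J = k")
    case True
    then obtain s where "classical_expansion U \<kappa> (m - of_nat (card J)) (\<alpha> I J) s"
      using base unfolding classical_form_def classical_symbol_def by blast
    then show ?thesis using has_components_expansion by blast
  next
    case False
    then have "\<forall>x\<in>U. \<forall>\<xi>. \<alpha> I J (x, \<xi>) = 0" using base by (auto simp: classical_form_def)
    then have "has_components U \<kappa> (\<alpha> I J) (\<lambda>a p. 0)" by (intro has_components.zero) simp_all
    then show ?thesis by (rule exI[of _ "\<lambda>a p. 0"])
  qed
next
  case (add \<alpha> \<beta>)
  obtain c where c: "has_components U \<kappa> (\<alpha> I J) c" using add.IH(1) ..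
  obtain c' where c': "has_components U \<kappa> (\<beta> I J) c'" using add.IH(2) ..
  from has_components_add[OF c c'] show ?case by (rule exI[of _ "\<lambda>a p. c a p + c' a p"])
next
  case (scale \<alpha> k)
  obtain c where "has_components U \<kappa> (\<alpha> I J) c" using scale.IH ..
  from has_components_scale[OF U \<kappa> this] show ?case by (rule exI[of _ "\<lambda>a p. k * c a p"])
next
  case (wedge \<alpha> \<beta>)
  let ?e = "\<lambda>A B. (-1) ^ (card B * card (I - A)) * shuffle_sign A (I - A) * shuffle_sign B (J - B)"
  have "\<exists>c. has_components U \<kappa> (\<lambda>p. ?e A B * (\<alpha> A B p * \<beta> (I - A) (J - B) p)) c" for A B
  proof -
    obtain c where c: "has_components U \<kappa> (\<alpha> A B) c" using wedge.IH(1) ..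
    obtain c' where c': "has_components U \<kappa> (\<beta> (I - A) (J - B)) c'" using wedge.IH(2) ..
    obtain c'' where "has_components U \<kappa> (\<lambda>p. \<alpha> A B p * \<beta> (I - A) (J - B) p) c''"
      using has_components_mult[OF U \<kappa> c c'] ..
    from has_components_scale[OF U \<kappa> this, of "?e A B"]
    show ?thesis by (rule exI[of _ "\<lambda>a p. ?e A B * c'' a p"])
  qed
  then have "\<exists>c. has_components U \<kappa> (\<lambda>p. \<Sum>A\<in>Pow I. \<Sum>B\<in>Pow J. ?e A B * (\<alpha> A B p * \<beta> (I - A) (J - B) p)) c"
    by (intro has_components_sum_ex)
  then obtain c where "has_components U \<kappa> (\<lambda>p. \<Sum>A\<in>Pow I. \<Sum>B\<in>Pow J. ?e A B * (\<alpha> A B p * \<beta> (I - A) (J - B) p)) c" ..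
  then have "has_components U \<kappa> (wedge \<alpha> \<beta> I J) c"
    by (rule has_components_cong) (simp_all add: wedge_def mult.assoc)
  then show ?case by (rule exI[of _ c])
qed

text \<open>The signs are left unspecified, since the contribution of each single derivative to the
  residue will vanish separately.\<close>

lemma ext_d_top_degree:
  fixes \<beta> :: "'n::{finite,linorder} form"
  shows "\<exists>e e'. ext_d \<beta> UNIV UNIV = (\<lambda>p. (\<Sum>i\<in>UNIV. e i * dx i (\<beta> (UNIV - {i}) UNIV) p) +
    (\<Sum>j\<in>UNIV. e' j * dxi j (\<beta> UNIV (UNIV - {j})) p))"
proof -
  let ?e = "\<lambda>(A::'n set) (B::'n set). (-1) ^ (card B * card (UNIV - A)) * shuffle_sign A (UNIV - A) * shuffle_sign B (UNIV - B)"
  have "wedge (basis_form A0 B0) \<omega> UNIV UNIV p = ?e A0 B0 * \<omega> (UNIV - A0) (UNIV - B0) p"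
    for A0 B0 p and \<omega> :: "'n form"
  proof -
    have "wedge (basis_form A0 B0) \<omega> UNIV UNIV p
      = (\<Sum>A\<in>UNIV. \<Sum>B\<in>UNIV. if A = A0 then if B = B0 then ?e A B * \<omega> (UNIV - A) (UNIV - B) p else 0 else 0)"
      unfolding wedge_def basis_form_def by (intro sum.cong) auto
    also have "\<dots> = (\<Sum>A\<in>UNIV. if A = A0 then ?e A B0 * \<omega> (UNIV - A) (UNIV - B0) p else 0)"
      by (intro sum.cong refl) (simp add: sum.delta)
    also have "\<dots> = ?e A0 B0 * \<omega> (UNIV - A0) (UNIV - B0) p"
      by (simp add: sum.delta)
    finally show ?thesis .
  qed
  then have "ext_d \<beta> UNIV UNIV = (\<lambda>p. (\<Sum>i\<in>UNIV. ?e {i} {} * dx i (\<beta> (UNIV - {i}) UNIV) p) +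
    (\<Sum>j\<in>UNIV. ?e {} {j} * dxi j (\<beta> UNIV (UNIV - {j})) p))"
    by (simp add: fun_eq_iff ext_d_def)
  then show ?thesis by (intro exI)
qed


section \<open>Polar coordinates\<close>

definition insert_coord :: "'n::finite \<Rightarrow> real \<Rightarrow> ('n \<Rightarrow> real) \<Rightarrow> real^'n" where
  "insert_coord i s \<eta> = (\<chi> k. if k = i then s else \<eta> k)"

definition sqsum :: "'n::finite \<Rightarrow> ('n \<Rightarrow> real) \<Rightarrow> real" where
  "sqsum i \<eta> = (\<Sum>l\<in>UNIV - {i}. (\<eta> l)\<^sup>2)"

abbreviation coord_measure :: "'n::finite \<Rightarrow> ('n \<Rightarrow> real) measure" where
  "coord_measure i \<equiv> Pi\<^sub>M (UNIV - {i}) (\<lambda>_. lborel)"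

lemma sphere_point_eq: "sphere_point i \<epsilon> \<eta> = insert_coord i (\<epsilon> * sqrt (1 - sqsum i \<eta>)) \<eta>"
  by (simp add: sphere_point_def insert_coord_def sqsum_def)

lemma sqsum_nonneg: "sqsum i \<eta> \<ge> 0"
  by (simp add: sqsum_def sum_nonneg)

lemma norm_insert_coord: "norm (insert_coord i s \<eta>) = sqrt (s\<^sup>2 + sqsum i \<eta>)"
proof -
  have "(\<Sum>k\<in>UNIV. (insert_coord i s \<eta> $ k)\<^sup>2) = s\<^sup>2 + sqsum i \<eta>"
    by (subst sum.remove[of _ i]) (auto simp: insert_coord_def sqsum_def intro!: sum.cong)
  then show ?thesis by (simp add: norm_vec_def L2_set_def)
qed

lemma sigma_finite_coord_measure: "sigma_finite_measure (coord_measure (i :: 'n::finite))"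
proof -
  interpret product_sigma_finite "\<lambda>_::'n. lborel :: real measure" by standard
  show ?thesis by (rule sigma_finite) simp
qed

lemma pair_sigma_finite_coord: "pair_sigma_finite lborel (coord_measure i)"
  by (intro pair_sigma_finite.intro sigma_finite_coord_measure sigma_finite_lborel)

lemma measurable_coord [measurable]: "l \<in> UNIV - {i} \<Longrightarrow> (\<lambda>\<eta>. \<eta> l) \<in> borel_measurable (coord_measure i)"
  using measurable_component_singleton[of l "UNIV - {i}" "\<lambda>_. lborel"] by simp

lemma measurable_sqsum [measurable]: "sqsum i \<in> borel_measurable (coord_measure i)"
  unfolding sqsum_def[abs_def]
  by (intro borel_measurable_sum borel_measurable_power) (rule measurable_coord)

lemma measurable_insert_coord:
  fixes i :: "'n::finite"
  assumes [measurable]: "f \<in> borel_measurable N" "g \<in> N \<rightarrow>\<^sub>M coord_measure i"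
  shows "(\<lambda>z. insert_coord i (f z) (g z)) \<in> borel_measurable N"
proof (subst borel_measurable_euclidean_space, rule ballI)
  fix b :: "real^'n" assume "b \<in> Basis"
  then obtain k where b: "b = axis k 1" by (auto simp: Basis_vec_def)
  have "(\<lambda>z. insert_coord i (f z) (g z) $ k) \<in> borel_measurable N"
  proof (cases "k = i")
    case False
    have "(\<lambda>z. g z k) \<in> borel_measurable N"
      using measurable_compose[OF assms(2) measurable_coord[of k i]] False by simp
    then show ?thesis using False by (simp add: insert_coord_def)
  qed (simp add: insert_coord_def)
  then show "(\<lambda>z. insert_coord i (f z) (g z) \<bullet> b) \<in> borel_measurable N"
    by (simp add: b inner_axis)
qed

text \<open>Connects Lebesgue measure on \<open>real^'n\<close> with the product measures over
  \<open>UNIV - {i}\<close> in which the sphere integral is written. Both sides assign its volume to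
  every box.\<close>

lemma lborel_eq_insert_coord:
  "(lborel :: (real^'n::finite) measure)
    = distr (lborel \<Otimes>\<^sub>M coord_measure i) borel (\<lambda>(s, \<eta>). insert_coord i s \<eta>)"
proof (rule lborel_eqI)
  interpret P: product_sigma_finite "\<lambda>_::'n. lborel :: real measure" by standard
  interpret M: sigma_finite_measure "coord_measure i" by (rule sigma_finite_coord_measure)
  fix l u :: "real^'n" assume lu: "\<And>b. b \<in> Basis \<Longrightarrow> l \<bullet> b \<le> u \<bullet> b"
  then have lu': "l $ k \<le> u $ k" for k
    using lu[of "axis k 1"] by (simp add: inner_axis axis_in_Basis_iff)
  have meas: "(\<lambda>(s, \<eta>). insert_coord i s \<eta>) \<in> lborel \<Otimes>\<^sub>M coord_measure i \<rightarrow>\<^sub>M borel"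
    unfolding case_prod_beta by (intro measurable_insert_coord) auto
  have split: "(\<forall>k. P k) \<longleftrightarrow> P i \<and> (\<forall>k\<in>UNIV - {i}. P k)" for P by auto
  have "insert_coord i s \<eta> \<in> box l u \<longleftrightarrow> s \<in> {l $ i<..<u $ i} \<and> (\<forall>k\<in>UNIV - {i}. \<eta> k \<in> {l $ k<..<u $ k})" for s \<eta>
    unfolding mem_box_cart insert_coord_def by (subst split) simp
  then have "(\<lambda>(s, \<eta>). insert_coord i s \<eta>) -` box l u \<inter> space (lborel \<Otimes>\<^sub>M coord_measure i)
      = {l $ i<..<u $ i} \<times> (\<Pi>\<^sub>E k\<in>UNIV - {i}. {l $ k<..<u $ k})"
    by (intro set_eqI) (simp add: space_pair_measure space_PiM PiE_iff mem_Times_iff case_prod_beta conj_commute conj_left_commute)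
  then have "emeasure (distr (lborel \<Otimes>\<^sub>M coord_measure i) borel (\<lambda>(s, \<eta>). insert_coord i s \<eta>)) (box l u)
      = emeasure (lborel \<Otimes>\<^sub>M coord_measure i) ({l $ i<..<u $ i} \<times> (\<Pi>\<^sub>E k\<in>UNIV - {i}. {l $ k<..<u $ k}))"
    using meas by (subst emeasure_distr) auto
  also have "\<dots> = emeasure lborel {l $ i<..<u $ i} * emeasure (coord_measure i) (\<Pi>\<^sub>E k\<in>UNIV - {i}. {l $ k<..<u $ k})"
    by (intro M.emeasure_pair_measure_Times) (auto intro!: sets_PiM_I_finite)
  also have "\<dots> = ennreal (u $ i - l $ i) * (\<Prod>k\<in>UNIV - {i}. ennreal (u $ k - l $ k))"
    by (subst P.emeasure_PiM) (simp_all add: lu')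
  also have "\<dots> = (\<Prod>k\<in>UNIV. ennreal (u $ k - l $ k))"
    by (subst prod.remove[of UNIV i]) simp_all
  also have "\<dots> = ennreal (\<Prod>k\<in>UNIV. u $ k - l $ k)"
    by (subst prod_ennreal) (simp_all add: lu')
  also have "(\<Prod>k\<in>UNIV. u $ k - l $ k) = (\<Prod>b\<in>Basis. (u - l) \<bullet> b)"
  proof -
    have B: "(Basis :: (real^'n) set) = (\<lambda>k. axis k 1) ` UNIV" by (auto simp: Basis_vec_def)
    show ?thesis unfolding B
      by (subst prod.reindex) (auto simp: inj_on_def axis_eq_axis inner_axis)
  qed
  finally show "emeasure (distr (lborel \<Otimes>\<^sub>M coord_measure i) borel (\<lambda>(s, \<eta>). insert_coord i s \<eta>)) (box l u)
    = ennreal (\<Prod>b\<in>Basis. (u - l) \<bullet> b)" .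
qed simp

text \<open>Boxes determine a product measure, and on a box each of the \<open>CARD('n) - 1\<close>
  coordinates contributes one factor \<open>r\<close>.\<close>

lemma coord_measure_scale:
  fixes r :: real and i :: "'n::finite"
  assumes r: "r > 0"
  defines "S \<equiv> \<lambda>\<eta>::'n \<Rightarrow> real. \<lambda>k\<in>UNIV - {i}. r * \<eta> k"
  shows "coord_measure i = density (distr (coord_measure i) (coord_measure i) S) (\<lambda>_. ennreal (r ^ (CARD('n) - 1)))"
proof (rule sym, rule product_sigma_finite.PiM_eqI)
  interpret P: product_sigma_finite "\<lambda>_::'n. lborel :: real measure" by standard
  show "product_sigma_finite (\<lambda>_::'n. lborel :: real measure)" by (rule P.product_sigma_finite_axioms)
  have S[measurable]: "S \<in> coord_measure i \<rightarrow>\<^sub>M coord_measure i"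
    unfolding S_def by (intro measurable_restrict) (auto intro!: borel_measurable_times measurable_coord)
  fix A :: "'n \<Rightarrow> real set" assume A: "\<And>k. k \<in> UNIV - {i} \<Longrightarrow> A k \<in> sets lborel"
  have PA: "Pi\<^sub>E (UNIV - {i}) A \<in> sets (coord_measure i)"
    using A by (intro sets_PiM_I_finite) auto
  have pre: "S -` Pi\<^sub>E (UNIV - {i}) A \<inter> space (coord_measure i) = (\<Pi>\<^sub>E k\<in>UNIV - {i}. (\<lambda>x. 0 + r * x) -` A k)"
    by (auto simp: S_def space_PiM PiE_iff)
  have sc: "ennreal r * emeasure lborel ((\<lambda>x. 0 + r * x) -` B) = emeasure lborel B" if "B \<in> sets lborel" for B
  proof -
    have "emeasure lborel B = emeasure (density (distr lborel borel (\<lambda>x. 0 + r * x)) (\<lambda>_. ennreal \<bar>r\<bar>)) B"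
      using lborel_real_affine[of r 0] r by simp
    also have "\<dots> = ennreal r * emeasure lborel ((\<lambda>x. 0 + r * x) -` B)"
      using that r by (simp add: emeasure_density_const emeasure_distr)
    finally show ?thesis by simp
  qed
  have "emeasure (density (distr (coord_measure i) (coord_measure i) S) (\<lambda>_. ennreal (r ^ (CARD('n) - 1)))) (Pi\<^sub>E (UNIV - {i}) A)
    = ennreal (r ^ (CARD('n) - 1)) * emeasure (coord_measure i) (\<Pi>\<^sub>E k\<in>UNIV - {i}. (\<lambda>x. 0 + r * x) -` A k)"
    using PA by (simp add: emeasure_density_const emeasure_distr pre)
  also have "\<dots> = ennreal (r ^ (CARD('n) - 1)) * (\<Prod>k\<in>UNIV - {i}. emeasure lborel ((\<lambda>x. 0 + r * x) -` A k))"
  proof (subst P.emeasure_PiM)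
    fix k assume "k \<in> UNIV - {i}"
    then have "(\<lambda>x. 0 + r * x) -` A k \<inter> space borel \<in> sets borel"
      using A[of k] by (intro measurable_sets[of _ borel borel]) auto
    then show "(\<lambda>x. 0 + r * x) -` A k \<in> sets lborel" by simp
  qed simp_all
  also have "\<dots> = (\<Prod>k\<in>UNIV - {i}. ennreal r) * (\<Prod>k\<in>UNIV - {i}. emeasure lborel ((\<lambda>x. 0 + r * x) -` A k))"
    using r by (simp add: ennreal_power card_Diff_singleton)
  also have "\<dots> = (\<Prod>k\<in>UNIV - {i}. ennreal r * emeasure lborel ((\<lambda>x. 0 + r * x) -` A k))"
    by (simp add: prod.distrib)
  also have "\<dots> = (\<Prod>k\<in>UNIV - {i}. emeasure lborel (A k))"
    using A by (intro prod.cong refl sc) auto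
  finally show "emeasure (density (distr (coord_measure i) (coord_measure i) S)
     (\<lambda>_. ennreal (r ^ (CARD('n) - 1)))) (Pi\<^sub>E (UNIV - {i}) A) = (\<Prod>k\<in>UNIV - {i}. emeasure lborel (A k))" .
qed simp_all

lemma integral_coord_measure_scale:
  fixes F :: "('n::finite \<Rightarrow> real) \<Rightarrow> complex"
  assumes r: "r > 0" and F[measurable]: "F \<in> borel_measurable (coord_measure i)"
  shows "(LINT \<eta>|coord_measure i. F \<eta>)
    = of_real (r ^ (CARD('n) - 1)) * (LINT \<eta>|coord_measure i. F (\<lambda>k\<in>UNIV - {i}. r * \<eta> k))"
proof -
  let ?S = "\<lambda>\<eta>::'n \<Rightarrow> real. \<lambda>k\<in>UNIV - {i}. r * \<eta> k"
  have S[measurable]: "?S \<in> coord_measure i \<rightarrow>\<^sub>M coord_measure i"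
    by (intro measurable_restrict) (auto intro!: borel_measurable_times measurable_coord)
  have "(LINT \<eta>|coord_measure i. F \<eta>) = (LINT \<eta>|density (distr (coord_measure i) (coord_measure i) ?S)
     (\<lambda>_. ennreal (r ^ (CARD('n) - 1))). F \<eta>)"
    using coord_measure_scale[OF r, of i] by simp
  also have "\<dots> = (LINT \<eta>|distr (coord_measure i) (coord_measure i) ?S. r ^ (CARD('n) - 1) *\<^sub>R F \<eta>)"
    using r by (subst integral_density) auto
  also have "\<dots> = of_real (r ^ (CARD('n) - 1)) * (LINT \<eta>|coord_measure i. F (?S \<eta>))"
    by (subst integral_distr) (auto simp: scaleR_conv_of_real)
  finally show ?thesis .
qed


text \<open>The square root is the modulus of the coordinate of index \<open>i\<close> at the sphere
  point; it stems from the coefficient of the omitted differential in the form on the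
  sphere.\<close>

abbreviation hemisphere_integrand ::
  "(real^'n::finite \<Rightarrow> complex) \<Rightarrow> 'n \<Rightarrow> real \<Rightarrow> ('n \<Rightarrow> real) \<Rightarrow> complex" where
  "hemisphere_integrand f i \<epsilon> \<eta> \<equiv> indicator {\<eta>. sqsum i \<eta> < 1} \<eta> *\<^sub>R
    (of_real (sqrt (1 - sqsum i \<eta>)) * f (sphere_point i \<epsilon> \<eta>))"

lemma insert_coord_eq: "insert_coord i s \<eta> = insert_coord i 0 \<eta> + s *\<^sub>R axis i 1"
  by (simp add: insert_coord_def vec_eq_iff axis_def)

lemma integral_real_split:
  fixes h :: "real \<Rightarrow> complex"
  assumes h: "integrable lborel h"
  shows "(LINT s|lborel. h s) = (LINT s|lborel. indicator {0<..} s *\<^sub>R h s) + (LINT s|lborel. indicator {0<..} s *\<^sub>R h (- s))"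
proof -
  have i: "integrable lborel (\<lambda>s. indicator {0<..} s *\<^sub>R h s)" "integrable lborel (\<lambda>s. indicator {..<0} s *\<^sub>R h s)"
    using h by (auto intro: integrable_mult_indicator)
  have "(LINT s|lborel. h s) = (LINT s|lborel. indicator {0<..} s *\<^sub>R h s + indicator {..<0} s *\<^sub>R h s)"
  proof (rule integral_cong_AE)
    show "AE s in lborel. h s = indicator {0<..} s *\<^sub>R h s + indicator {..<0} s *\<^sub>R h s"
      using AE_lborel_singleton[of "0::real"] by eventually_elim (auto simp: indicator_def)
    show "h \<in> borel_measurable lborel" using h by simp
    show "(\<lambda>s. indicator {0<..} s *\<^sub>R h s + indicator {..<0} s *\<^sub>R h s) \<in> borel_measurable lborel"
      using i by (intro borel_measurable_add) (auto dest: borel_measurable_integrable)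
  qed
  also have "\<dots> = (LINT s|lborel. indicator {0<..} s *\<^sub>R h s) + (LINT s|lborel. indicator {..<0} s *\<^sub>R h s)"
    by (rule Bochner_Integration.integral_add[OF i])
  also have "(LINT s|lborel. indicator {..<0} s *\<^sub>R h s) = (LINT s|lborel. indicator {0<..} s *\<^sub>R h (- s))"
    using lborel_integral_real_affine[of "-1" "\<lambda>s. indicator {..<0} s *\<^sub>R h s" 0]
    by (simp add: indicator_def)
  finally show ?thesis .
qed

section \<open>Polar coordinates over a pair of opposite hemispheres\<close>

context
  fixes f :: "real^'n::finite \<Rightarrow> complex" and \<Psi> :: "real \<Rightarrow> real"
  assumes cont_f: "continuous_on (UNIV - {0}) f"
    and meas_f: "f \<in> borel_measurable borel"
    and hom_f: "\<And>\<xi> t. \<xi> \<noteq> 0 \<Longrightarrow> t > 0 \<Longrightarrow> f (t *\<^sub>R \<xi>) = f \<xi> / of_real (t ^ CARD('n))"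
    and cont_\<Psi>: "continuous_on UNIV \<Psi>"
    and supp_\<Psi>: "\<And>r. r \<le> 1 \<or> r \<ge> 2 \<Longrightarrow> \<Psi> r = 0"
begin

lemma annulus_bounds:
  "\<exists>B P. B \<ge> 0 \<and> P \<ge> 0 \<and> (\<forall>\<xi>. 1 \<le> norm \<xi> \<longrightarrow> norm \<xi> \<le> 2 \<longrightarrow> norm (f \<xi>) \<le> B) \<and> (\<forall>r. \<bar>\<Psi> r\<bar> \<le> P)"
proof -
  have "compact (cball (0::real^'n) 2 - ball 0 1)" by (intro compact_diff) auto
  moreover have "continuous_on (cball (0::real^'n) 2 - ball 0 1) f"
    by (rule continuous_on_subset[OF cont_f]) auto
  ultimately have "bounded (f ` (cball 0 2 - ball 0 1))"
    by (intro compact_imp_bounded compact_continuous_image)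
  then obtain B where B: "B > 0" "\<forall>z \<in> f ` (cball 0 2 - ball 0 1). norm z \<le> B"
    unfolding bounded_pos by auto
  have "bounded (\<Psi> ` {1..2})"
    by (intro compact_imp_bounded compact_continuous_image continuous_on_subset[OF cont_\<Psi>]) auto
  then obtain P where P: "P > 0" "\<forall>z \<in> \<Psi> ` {1..2}. norm z \<le> P"
    unfolding bounded_pos by auto
  have "\<bar>\<Psi> r\<bar> \<le> P" for r
    using P supp_\<Psi>[of r] by (cases "r \<in> {1..2}") auto
  moreover have "norm (f \<xi>) \<le> B" if "1 \<le> norm \<xi>" "norm \<xi> \<le> 2" for \<xi>
    using B(2) that by simp
  ultimately show ?thesis using B(1) P(1) by (intro exI[of _ B] exI[of _ P]) simp
qed

lemma meas_\<Psi>: "\<Psi> \<in> borel_measurable borel"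
  by (rule borel_measurable_continuous_onI[OF cont_\<Psi>])

text \<open>With \<xi> the inserted point, the quotient is
  \<open>(\<xi> $ i)\<^sup>2 / (norm \<xi>)\<^sup>2\<close>. It is designed for the passage from the
  height \<open>s\<close> to the radius \<open>r = norm \<xi>\<close>: since
  \<open>s ds = r dr\<close>, the weight \<open>s\<^sup>2 / r\<^sup>2\<close> becomes
  \<open>s / r\<close>, the weight in \<open>radial_integrand\<close>. After scaling to the unit
  sphere this is the square root in \<open>hemisphere_integrand\<close>.\<close>

definition height_integrand :: "'n \<Rightarrow> real \<Rightarrow> real \<Rightarrow> ('n \<Rightarrow> real) \<Rightarrow> complex" where
  "height_integrand i \<epsilon> s \<eta> = indicator {0<..} s *\<^sub>R (f (insert_coord i (\<epsilon> * s) \<eta>) *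
     of_real (s\<^sup>2 / (s\<^sup>2 + sqsum i \<eta>) * \<Psi> (sqrt (s\<^sup>2 + sqsum i \<eta>))))"

definition radial_integrand :: "'n \<Rightarrow> real \<Rightarrow> ('n \<Rightarrow> real) \<Rightarrow> real \<Rightarrow> complex" where
  "radial_integrand i \<epsilon> \<eta> r = indicator {sqrt (sqsum i \<eta>)<..} r *\<^sub>R
     (f (insert_coord i (\<epsilon> * sqrt (r\<^sup>2 - sqsum i \<eta>)) \<eta>) * of_real (sqrt (r\<^sup>2 - sqsum i \<eta>) / r * \<Psi> r))"

lemma measurable_sqsum_comp:
  "g \<in> N \<rightarrow>\<^sub>M coord_measure i \<Longrightarrow> (\<lambda>z. sqsum i (g z)) \<in> borel_measurable N"
  by (rule measurable_compose[OF _ measurable_sqsum])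

lemma measurable_height_integrand:
  assumes [measurable]: "a \<in> borel_measurable N" "g \<in> N \<rightarrow>\<^sub>M coord_measure i"
  shows "(\<lambda>z. height_integrand i \<epsilon> (a z) (g z)) \<in> borel_measurable N"
proof -
  note [measurable] = measurable_sqsum_comp[OF assms(2)] meas_\<Psi>
  have [measurable]: "(\<lambda>z. f (insert_coord i (\<epsilon> * a z) (g z))) \<in> borel_measurable N"
    by (rule measurable_compose[OF measurable_insert_coord meas_f]) measurable
  show ?thesis unfolding height_integrand_def by measurable
qed

lemma measurable_radial_integrand:
  assumes [measurable]: "a \<in> borel_measurable N" "g \<in> N \<rightarrow>\<^sub>M coord_measure i"
  shows "(\<lambda>z. radial_integrand i \<epsilon> (g z) (a z)) \<in> borel_measurable N"
proof -
  note [measurable] = measurable_sqsum_comp[OF assms(2)] meas_\<Psi>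
  have [measurable]: "(\<lambda>z. f (insert_coord i (\<epsilon> * sqrt ((a z)\<^sup>2 - sqsum i (g z))) (g z))) \<in> borel_measurable N"
    by (rule measurable_compose[OF measurable_insert_coord meas_f]) measurable
  have "(\<lambda>z. indicator {z \<in> space N. sqrt (sqsum i (g z)) < a z} z *\<^sub>R
     (f (insert_coord i (\<epsilon> * sqrt ((a z)\<^sup>2 - sqsum i (g z))) (g z)) * of_real (sqrt ((a z)\<^sup>2 - sqsum i (g z)) / a z * \<Psi> (a z))))
     \<in> borel_measurable N" (is "?F \<in> _") by measurable
  also have "?F \<in> borel_measurable N \<longleftrightarrow> (\<lambda>z. radial_integrand i \<epsilon> (g z) (a z)) \<in> borel_measurable N"
    by (rule measurable_cong) (simp add: radial_integrand_def indicator_def)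
  finally show ?thesis .
qed

lemma integrand_bounds:
  assumes \<epsilon>: "\<epsilon> = 1 \<or> \<epsilon> = -1"
  shows "\<exists>C. (\<forall>s \<eta>. norm (height_integrand i \<epsilon> s \<eta>) \<le> C) \<and> (\<forall>r \<eta>. norm (radial_integrand i \<epsilon> \<eta> r) \<le> C)"
proof -
  obtain B P where B: "B \<ge> 0" "P \<ge> 0" "\<forall>\<xi>. 1 \<le> norm \<xi> \<longrightarrow> norm \<xi> \<le> 2 \<longrightarrow> norm (f \<xi>) \<le> B"
    "\<forall>r. \<bar>\<Psi> r\<bar> \<le> P" using annulus_bounds by (elim exE conjE)
  have key: "norm (f \<xi> * of_real (w * \<Psi> (norm \<xi>))) \<le> B * (1 * P)" if "0 \<le> w" "w \<le> 1" for \<xi> w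
  proof (cases "1 \<le> norm \<xi> \<and> norm \<xi> \<le> 2")
    case True
    have "norm (f \<xi> * of_real (w * \<Psi> (norm \<xi>))) = norm (f \<xi>) * (w * \<bar>\<Psi> (norm \<xi>)\<bar>)"
      using that by (simp add: norm_mult abs_mult)
    also have "\<dots> \<le> B * (1 * P)"
      using that B True by (intro mult_mono) auto
    finally show ?thesis .
  next
    case False
    then have "\<Psi> (norm \<xi>) = 0" by (intro supp_\<Psi>) auto
    then show ?thesis using B by simp
  qed
  have e2: "(\<epsilon> * s)\<^sup>2 = s\<^sup>2" for s using \<epsilon> by auto
  have "norm (height_integrand i \<epsilon> s \<eta>) \<le> B * (1 * P)" for s \<eta>
  proof (cases "s > 0")
    case True
    then have "s\<^sup>2 / (s\<^sup>2 + sqsum i \<eta>) \<le> 1" "s\<^sup>2 / (s\<^sup>2 + sqsum i \<eta>) \<ge> 0"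
      using sqsum_nonneg[of i \<eta>] by (simp_all add: add_pos_nonneg)
    then show ?thesis using key[of "s\<^sup>2 / (s\<^sup>2 + sqsum i \<eta>)" "insert_coord i (\<epsilon> * s) \<eta>"] True
      by (simp add: height_integrand_def norm_insert_coord e2)
  qed (use B in \<open>simp add: height_integrand_def\<close>)
  moreover have "norm (radial_integrand i \<epsilon> \<eta> r) \<le> B * (1 * P)" for r \<eta>
  proof (cases "sqrt (sqsum i \<eta>) < r")
    case True
    have r: "r > 0" using True real_sqrt_ge_zero[OF sqsum_nonneg[of i \<eta>]] by linarith
    have "(sqrt (sqsum i \<eta>))\<^sup>2 < r\<^sup>2"
      using True sqsum_nonneg[of i \<eta>] by (intro power_strict_mono) auto
    then have lt: "sqsum i \<eta> < r\<^sup>2" using sqsum_nonneg[of i \<eta>] by simp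
    then have "sqrt (r\<^sup>2 - sqsum i \<eta>) \<le> sqrt (r\<^sup>2)" using sqsum_nonneg[of i \<eta>] by (intro real_sqrt_le_mono) simp
    then have "sqrt (r\<^sup>2 - sqsum i \<eta>) / r \<le> 1" "sqrt (r\<^sup>2 - sqsum i \<eta>) / r \<ge> 0" using r lt by simp_all
    then show ?thesis
      using key[of "sqrt (r\<^sup>2 - sqsum i \<eta>) / r" "insert_coord i (\<epsilon> * sqrt (r\<^sup>2 - sqsum i \<eta>)) \<eta>"] r lt True
      by (simp add: radial_integrand_def norm_insert_coord e2)
  qed (use B in \<open>simp add: radial_integrand_def\<close>)
  ultimately show ?thesis by (intro exI[of _ "B * (1 * P)"]) simp
qed

lemma sqsum_bounds_coord: "sqsum i \<eta> < 4 \<Longrightarrow> l \<noteq> i \<Longrightarrow> \<bar>\<eta> l\<bar> \<le> 2"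
proof -
  assume a: "sqsum i \<eta> < 4" "l \<noteq> i"
  have "(\<eta> l)\<^sup>2 \<le> sqsum i \<eta>" unfolding sqsum_def using a(2) by (intro member_le_sum) auto
  then have "(\<eta> l)\<^sup>2 \<le> 2\<^sup>2" using a by simp
  then show ?thesis using abs_le_square_iff[of "\<eta> l" 2] by simp
qed

lemma height_integrand_support:
  assumes "height_integrand i \<epsilon> s \<eta> \<noteq> 0"
  shows "0 < s" "s < 2" "sqsum i \<eta> < 4"
proof -
  have *: "s > 0" "\<Psi> (sqrt (s\<^sup>2 + sqsum i \<eta>)) \<noteq> 0"
    using assms by (auto simp: height_integrand_def indicator_def split: if_splits)
  have "\<not> (sqrt (s\<^sup>2 + sqsum i \<eta>) \<le> 1 \<or> sqrt (s\<^sup>2 + sqsum i \<eta>) \<ge> 2)" using *(2) supp_\<Psi> by blast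
  then have "sqrt (s\<^sup>2 + sqsum i \<eta>) < 2" by simp
  then have "s\<^sup>2 + sqsum i \<eta> < 2\<^sup>2" using real_sqrt_less_iff[of "s\<^sup>2 + sqsum i \<eta>" "2\<^sup>2"] by simp
  then have "s\<^sup>2 + sqsum i \<eta> < 4" by simp
  then have "s\<^sup>2 < 4" "sqsum i \<eta> < 4" using sqsum_nonneg[of i \<eta>] zero_le_power2[of s]
    by linarith+
  then show "0 < s" "s < 2" "sqsum i \<eta> < 4" using * power_less_imp_less_base[of s 2 2] by auto
qed

lemma radial_integrand_support:
  assumes "radial_integrand i \<epsilon> \<eta> r \<noteq> 0"
  shows "1 < r" "r < 2" "sqrt (sqsum i \<eta>) < r" "sqsum i \<eta> < 4"
proof -
  have *: "sqrt (sqsum i \<eta>) < r" "\<Psi> r \<noteq> 0"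
    using assms by (auto simp: radial_integrand_def indicator_def split: if_splits)
  have "\<not> (r \<le> 1 \<or> r \<ge> 2)" using *(2) supp_\<Psi> by blast
  then show "1 < r" "r < 2" "sqrt (sqsum i \<eta>) < r" using * by simp_all
  then have "sqrt (sqsum i \<eta>) < sqrt 4" by simp
  then show "sqsum i \<eta> < 4" by (simp only: real_sqrt_less_iff)
qed

definition coord_box :: "'n \<Rightarrow> ('n \<Rightarrow> real) set" where
  "coord_box i = (\<Pi>\<^sub>E k\<in>UNIV - {i}. {-2..2})"

lemma coord_box: "coord_box i \<in> sets (coord_measure i)" "emeasure (coord_measure i) (coord_box i) < \<infinity>"
proof -
  interpret P: product_sigma_finite "\<lambda>_::'n. lborel :: real measure" by standard
  show "coord_box i \<in> sets (coord_measure i)"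
    unfolding coord_box_def by (intro sets_PiM_I_finite) auto
  show "emeasure (coord_measure i) (coord_box i) < \<infinity>"
    unfolding coord_box_def by (subst P.emeasure_PiM) (simp_all add: ennreal_prod_eq_top less_top[symmetric] power_eq_top_ennreal)
qed

lemma in_coord_box: "\<eta> \<in> space (coord_measure i) \<Longrightarrow> sqsum i \<eta> < 4 \<Longrightarrow> \<eta> \<in> coord_box i"
  using sqsum_bounds_coord[of i \<eta>] by (auto simp: coord_box_def space_PiM PiE_iff abs_le_iff minus_le_iff)

text \<open>Boundedness suffices because the support lies in a set of finite measure. The second
  conclusion holds for every slice, not just almost every one, which is the form that the
  one-dimensional substitution asks for.\<close>

lemma integrable_supported:
  fixes F :: "real \<Rightarrow> ('n \<Rightarrow> real) \<Rightarrow> complex"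
  assumes meas: "(\<lambda>z. F (fst z) (snd z)) \<in> borel_measurable (lborel \<Otimes>\<^sub>M coord_measure i)"
    and C: "\<And>s \<eta>. norm (F s \<eta>) \<le> C"
    and supp: "\<And>s \<eta>. F s \<eta> \<noteq> 0 \<Longrightarrow> s \<in> {0..2} \<and> sqsum i \<eta> < 4"
  shows "integrable (lborel \<Otimes>\<^sub>M coord_measure i) (\<lambda>(s, \<eta>). F s \<eta>)"
    and "\<eta> \<in> space (coord_measure i) \<Longrightarrow> integrable lborel (\<lambda>s. F s \<eta>)"
proof -
  interpret M: sigma_finite_measure "coord_measure i" by (rule sigma_finite_coord_measure)
  show "integrable (lborel \<Otimes>\<^sub>M coord_measure i) (\<lambda>(s, \<eta>). F s \<eta>)"
  proof (rule integrableI_bounded_set[of "{0..2::real} \<times> coord_box i" _ _ C])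
    show "{0..2::real} \<times> coord_box i \<in> sets (lborel \<Otimes>\<^sub>M coord_measure i)"
      using coord_box(1) by (intro pair_measureI) auto
    show "(\<lambda>(s, \<eta>). F s \<eta>) \<in> borel_measurable (lborel \<Otimes>\<^sub>M coord_measure i)"
      unfolding case_prod_beta by (rule meas)
    show "emeasure (lborel \<Otimes>\<^sub>M coord_measure i) ({0..2::real} \<times> coord_box i) < \<infinity>"
      using coord_box by (subst M.emeasure_pair_measure_Times) (auto simp: ennreal_mult_less_top)
    show "AE z in (lborel :: real measure) \<Otimes>\<^sub>M coord_measure i.
        z \<notin> {0..2::real} \<times> coord_box i \<longrightarrow> (case z of (s, \<eta>) \<Rightarrow> F s \<eta>) = 0"
    proof (rule AE_I2, rule impI)
      fix z assume a: "z \<in> space ((lborel :: real measure) \<Otimes>\<^sub>M coord_measure i)" "z \<notin> {0..2} \<times> coord_box i"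
      obtain s \<eta> where z: "z = (s, \<eta>)" by (cases z)
      then have "\<eta> \<in> space (coord_measure i)" using a by (simp add: space_pair_measure)
      then have "F s \<eta> = 0"
        using a(2) supp[of s \<eta>] in_coord_box[of \<eta> i] by (cases "F s \<eta> = 0") (simp_all add: z)
      then show "(case z of (s, \<eta>) \<Rightarrow> F s \<eta>) = 0" by (simp add: z)
    qed
  qed (use C in auto)
  assume \<eta>: "\<eta> \<in> space (coord_measure i)"
  show "integrable lborel (\<lambda>s. F s \<eta>)"
  proof (rule integrableI_bounded_set[of "{0..2}" _ _ C])
    have "(\<lambda>s. (s, \<eta>)) \<in> lborel \<rightarrow>\<^sub>M lborel \<Otimes>\<^sub>M coord_measure i"
      using \<eta> by (rule measurable_Pair2')
    from measurable_compose[OF this meas] show "(\<lambda>s. F s \<eta>) \<in> borel_measurable lborel" by simp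
    have "F s \<eta> = 0" if "s \<notin> {0..2}" for s
      using that supp[of s \<eta>] by (cases "F s \<eta> = 0") simp_all
    then show "AE s in lborel. s \<notin> {0..2} \<longrightarrow> F s \<eta> = 0" by simp
  qed (use C in simp_all)
qed

lemma integrable_height_integrand:
  assumes \<epsilon>: "\<epsilon> = 1 \<or> \<epsilon> = -1"
  shows "integrable (lborel \<Otimes>\<^sub>M coord_measure i) (\<lambda>(s, \<eta>). height_integrand i \<epsilon> s \<eta>)"
    and "\<eta> \<in> space (coord_measure i) \<Longrightarrow> integrable lborel (\<lambda>s. height_integrand i \<epsilon> s \<eta>)"
proof -
  obtain C where C: "\<And>s \<eta>. norm (height_integrand i \<epsilon> s \<eta>) \<le> C" using integrand_bounds[OF \<epsilon>, of i] by blast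
  have s: "s \<in> {0..2} \<and> sqsum i \<eta> < 4" if "height_integrand i \<epsilon> s \<eta> \<noteq> 0" for s \<eta>
    using height_integrand_support[OF that] by simp
  have "(\<lambda>z. height_integrand i \<epsilon> (fst z) (snd z)) \<in> borel_measurable (lborel \<Otimes>\<^sub>M coord_measure i)"
    by (rule measurable_height_integrand) measurable
  note integrable_supported[of "height_integrand i \<epsilon>", OF this C s]
  then show "integrable (lborel \<Otimes>\<^sub>M coord_measure i) (\<lambda>(s, \<eta>). height_integrand i \<epsilon> s \<eta>)"
    "\<eta> \<in> space (coord_measure i) \<Longrightarrow> integrable lborel (\<lambda>s. height_integrand i \<epsilon> s \<eta>)" by blast+
qed

lemma integrable_radial_integrand:
  assumes \<epsilon>: "\<epsilon> = 1 \<or> \<epsilon> = -1"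
  shows "integrable (lborel \<Otimes>\<^sub>M coord_measure i) (\<lambda>(r, \<eta>). radial_integrand i \<epsilon> \<eta> r)"
    and "\<eta> \<in> space (coord_measure i) \<Longrightarrow> integrable lborel (\<lambda>r. radial_integrand i \<epsilon> \<eta> r)"
proof -
  obtain C where C: "\<And>r \<eta>. norm (radial_integrand i \<epsilon> \<eta> r) \<le> C" using integrand_bounds[OF \<epsilon>, of i] by blast
  have s: "r \<in> {0..2} \<and> sqsum i \<eta> < 4" if "radial_integrand i \<epsilon> \<eta> r \<noteq> 0" for r \<eta>
    using radial_integrand_support[OF that] by simp
  have "(\<lambda>z. radial_integrand i \<epsilon> (snd z) (fst z)) \<in> borel_measurable (lborel \<Otimes>\<^sub>M coord_measure i)"
    by (rule measurable_radial_integrand) measurable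
  note integrable_supported[of "\<lambda>r \<eta>. radial_integrand i \<epsilon> \<eta> r", OF this C s]
  then show "integrable (lborel \<Otimes>\<^sub>M coord_measure i) (\<lambda>(r, \<eta>). radial_integrand i \<epsilon> \<eta> r)"
    "\<eta> \<in> space (coord_measure i) \<Longrightarrow> integrable lborel (\<lambda>r. radial_integrand i \<epsilon> \<eta> r)" by blast+
qed

text \<open>The substitution \<open>r = sqrt (s\<^sup>2 + |\<eta>|\<^sup>2)\<close> in the coordinate \<open>s\<close>.\<close>

lemma height_integral_eq_radial_integral:
  assumes \<epsilon>: "\<epsilon> = 1 \<or> \<epsilon> = -1" and \<eta>: "\<eta> \<in> space (coord_measure i)"
  shows "(LINT s|lborel. height_integrand i \<epsilon> s \<eta>) = (LINT r|lborel. radial_integrand i \<epsilon> \<eta> r)"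
proof -
  define q where "q = sqsum i \<eta>"
  have q: "q \<ge> 0" by (simp add: q_def sqsum_nonneg)
  define F where "F r = f (insert_coord i (\<epsilon> * sqrt (r\<^sup>2 - q)) \<eta>) * of_real (sqrt (r\<^sup>2 - q) / r * \<Psi> r)" for r
  define g where "g s = sqrt (s\<^sup>2 + q)" for s
  define g' where "g' s = s / sqrt (s\<^sup>2 + q)" for s
  have pos: "s\<^sup>2 + q > 0" if "s > 0" for s using that q by (simp add: add_pos_nonneg)
  have gF: "indicator {0<..} s *\<^sub>R (g' s *\<^sub>R F (g s)) = height_integrand i \<epsilon> s \<eta>" for s
  proof (cases "s > 0")
    case True
    have "(g s)\<^sup>2 = s\<^sup>2 + q" using pos[OF True] by (simp add: g_def)
    then have "F (g s) = f (insert_coord i (\<epsilon> * s) \<eta>) * of_real (s / sqrt (s\<^sup>2 + q) * \<Psi> (sqrt (s\<^sup>2 + q)))"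
      using True by (simp add: F_def g_def)
    moreover have "g' s *\<^sub>R (z * of_real (s / sqrt (s\<^sup>2 + q) * w)) = z * of_real (s\<^sup>2 / (s\<^sup>2 + q) * w)"
      for z :: complex and w
    proof -
      have "g' s * (s / sqrt (s\<^sup>2 + q) * w) = s\<^sup>2 / (s\<^sup>2 + q) * w"
        using pos[OF True] by (simp add: g'_def power2_eq_square)
      then show ?thesis by (metis mult_scaleR_right scaleR_conv_of_real scaleR_scaleR mult.commute)
    qed
    ultimately show ?thesis using True by (simp add: height_integrand_def q_def)
  qed (simp add: height_integrand_def)
  then have gF': "(indicator {0<..} s * g' s) *\<^sub>R F (g s) = height_integrand i \<epsilon> s \<eta>" for s by simp
  have F: "indicator {sqrt q<..} r *\<^sub>R F r = radial_integrand i \<epsilon> \<eta> r" for r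
    by (simp add: radial_integrand_def F_def q_def)
  have "(LBINT r=ereal (sqrt q)..\<infinity>. F r) = (LBINT s=ereal 0..\<infinity>. g' s *\<^sub>R F (g s))"
  proof (rule interval_integral_substitution_integrable)
    fix s :: real assume "ereal 0 < ereal s" "ereal s < \<infinity>"
    then have s: "s > 0" by simp
    show "DERIV g s :> g' s"
      unfolding g_def[abs_def] g'_def using pos[OF s]
      by (auto intro!: derivative_eq_intros simp: field_simps)
    show "isCont g' s"
      unfolding g'_def[abs_def] using pos[OF s] by (auto intro!: continuous_intros)
    have ne: "insert_coord i (\<epsilon> * sqrt ((g s)\<^sup>2 - q)) \<eta> \<noteq> 0"
    proof -
      have "insert_coord i (\<epsilon> * sqrt ((g s)\<^sup>2 - q)) \<eta> $ i \<noteq> 0"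
        using \<epsilon> s pos[OF s] by (auto simp: insert_coord_def g_def)
      then show ?thesis by (metis zero_index)
    qed
    have "isCont f (insert_coord i (\<epsilon> * sqrt ((g s)\<^sup>2 - q)) \<eta>)"
      using cont_f ne continuous_on_eq_continuous_at[of "UNIV - {0}" f] by (auto simp: open_Diff)
    moreover have "isCont (\<lambda>r. insert_coord i (\<epsilon> * sqrt (r\<^sup>2 - q)) \<eta>) (g s)"
      by (subst insert_coord_eq) (intro continuous_intros)
    ultimately have "isCont (\<lambda>r. f (insert_coord i (\<epsilon> * sqrt (r\<^sup>2 - q)) \<eta>)) (g s)"
      using isCont_o2 by blast
    moreover have "isCont \<Psi> (g s)" using cont_\<Psi> by (simp add: continuous_on_eq_continuous_at)
    moreover have "g s \<noteq> 0" using pos[OF s] by (simp add: g_def)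
    ultimately show "isCont F (g s)" unfolding F_def[abs_def] by (intro continuous_intros) auto
  next
    have "g 0 = sqrt q" by (simp add: g_def)
    moreover have "(g \<longlongrightarrow> g 0) (at_right 0)"
      unfolding g_def[abs_def] by (intro tendsto_intros)
    ultimately have "((\<lambda>x. ereal (g x)) \<longlongrightarrow> ereal (sqrt q)) (at_right 0)"
      by (simp only: tendsto_ereal)
    then show "((ereal \<circ> g \<circ> real_of_ereal) \<longlongrightarrow> ereal (sqrt q)) (at_right (ereal 0))"
      by (subst ereal_tendsto_simps) (simp add: o_def)
    have "filterlim g at_top at_top"
    proof (rule filterlim_at_top_mono[OF filterlim_ident])
      show "\<forall>\<^sub>F s in at_top. s \<le> g s" unfolding g_def using q
        by (intro always_eventually allI real_le_rsqrt) simp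
    qed
    then show "((ereal \<circ> g \<circ> real_of_ereal) \<longlongrightarrow> \<infinity>) (at_left \<infinity>)"
      by (subst ereal_tendsto_simps) (simp add: o_def tendsto_PInfty_eq_at_top)
    show "set_integrable lborel (einterval (ereal 0) \<infinity>) (\<lambda>s. g' s *\<^sub>R F (g s))"
      using integrable_height_integrand(2)[OF \<epsilon> \<eta>] by (simp only: set_integrable_def einterval_eq_Ici gF)
    show "set_integrable lborel (einterval (ereal (sqrt q)) \<infinity>) F"
      using integrable_radial_integrand(2)[OF \<epsilon> \<eta>] by (simp add: set_integrable_def einterval_eq_Ici F)
  qed (auto simp: g'_def q)
  then show ?thesis
    by (simp add: interval_lebesgue_integral_def set_lebesgue_integral_def einterval_eq_Ici gF' F)
qed

text \<open>Scaling \<eta> by \<open>r\<close> gives the Jacobian \<open>r ^ (CARD('n) - 1)\<close>,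
  and homogeneity gives \<open>r\<close> to the power \<open>- CARD('n)\<close>. What remains is
  \<open>1 / r\<close>; the weight \<open>s / r\<close> is invariant under scaling.\<close>

lemma radial_integral_slice:
  assumes \<epsilon>: "\<epsilon> = 1 \<or> \<epsilon> = -1"
  shows "(LINT \<eta>|coord_measure i. radial_integrand i \<epsilon> \<eta> r) = of_real (\<Psi> r / r) *
    (LINT \<eta>|coord_measure i. hemisphere_integrand f i \<epsilon> \<eta>)"
proof (cases "1 < r \<and> r < 2")
  case False
  then have "\<Psi> r = 0" by (intro supp_\<Psi>) auto
  then show ?thesis by (simp add: radial_integrand_def)
next
  case True
  then have r: "r > 0" by simp
  let ?S = "\<lambda>\<eta>::'n \<Rightarrow> real. \<lambda>k\<in>UNIV - {i}. r * \<eta> k"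
  let ?H = "\<lambda>\<eta>. hemisphere_integrand f i \<epsilon> \<eta>"
  have slice: "radial_integrand i \<epsilon> (?S \<eta>) r = of_real (\<Psi> r / r ^ CARD('n)) * ?H \<eta>" for \<eta>
  proof -
    have q: "sqsum i (?S \<eta>) = r\<^sup>2 * sqsum i \<eta>"
      unfolding sqsum_def sum_distrib_left by (intro sum.cong) (auto simp: power_mult_distrib)
    have lt: "sqrt (sqsum i (?S \<eta>)) < r \<longleftrightarrow> sqsum i \<eta> < 1"
      using r by (simp add: q real_sqrt_mult)
    show ?thesis
    proof (cases "sqsum i \<eta> < 1")
      case True
      have sq: "sqrt (r\<^sup>2 - sqsum i (?S \<eta>)) = r * sqrt (1 - sqsum i \<eta>)"
      proof -
        have "r\<^sup>2 - sqsum i (?S \<eta>) = r\<^sup>2 * (1 - sqsum i \<eta>)" by (simp add: q algebra_simps)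
        then show ?thesis using r by (simp add: real_sqrt_mult)
      qed
      have "insert_coord i (\<epsilon> * (r * sqrt (1 - sqsum i \<eta>))) (?S \<eta>) = r *\<^sub>R sphere_point i \<epsilon> \<eta>"
        by (simp add: sphere_point_eq insert_coord_def vec_eq_iff)
      moreover have "sphere_point i \<epsilon> \<eta> \<noteq> 0"
      proof -
        have "sphere_point i \<epsilon> \<eta> $ i \<noteq> 0" using \<epsilon> True by (auto simp: sphere_point_eq insert_coord_def)
        then show ?thesis by (metis zero_index)
      qed
      ultimately have "f (insert_coord i (\<epsilon> * (r * sqrt (1 - sqsum i \<eta>))) (?S \<eta>))
          = f (sphere_point i \<epsilon> \<eta>) / of_real (r ^ CARD('n))"
        using hom_f r by simp
      then show ?thesis using True r lt
        by (simp add: radial_integrand_def sq field_simps)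
    next
      case False
      then show ?thesis using lt by (simp add: radial_integrand_def)
    qed
  qed
  have "(LINT \<eta>|coord_measure i. radial_integrand i \<epsilon> \<eta> r)
     = of_real (r ^ (CARD('n) - 1)) * (LINT \<eta>|coord_measure i. radial_integrand i \<epsilon> (?S \<eta>) r)"
    by (intro integral_coord_measure_scale r measurable_radial_integrand) auto
  also have "(LINT \<eta>|coord_measure i. radial_integrand i \<epsilon> (?S \<eta>) r)
     = of_real (\<Psi> r / r ^ CARD('n)) * (LINT \<eta>|coord_measure i. ?H \<eta>)"
    unfolding slice by (rule integral_mult_right_zero)
  also have "of_real (r ^ (CARD('n) - 1)) * (of_real (\<Psi> r / r ^ CARD('n)) * (LINT \<eta>|coord_measure i. ?H \<eta>))
    = of_real (\<Psi> r / r) * (LINT \<eta>|coord_measure i. ?H \<eta>)"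
  proof -
    have "r ^ CARD('n) = r * r ^ (CARD('n) - 1)"
      by (subst power_Suc[symmetric]) simp
    then have e: "r ^ (CARD('n) - 1) * (\<Psi> r / r ^ CARD('n)) = \<Psi> r / r"
      using r by simp
    show ?thesis unfolding mult.assoc[symmetric] of_real_mult[symmetric] e ..
  qed
  finally show ?thesis .
qed

lemma height_integral:
  assumes \<epsilon>: "\<epsilon> = 1 \<or> \<epsilon> = -1"
  shows "(LINT \<eta>|coord_measure i. LINT s|lborel. height_integrand i \<epsilon> s \<eta>) =
    (LINT r|lborel. of_real (\<Psi> r / r)) *
    (LINT \<eta>|coord_measure i. hemisphere_integrand f i \<epsilon> \<eta>)"
proof -
  interpret pair_sigma_finite lborel "coord_measure i" by (rule pair_sigma_finite_coord)
  have "(LINT \<eta>|coord_measure i. LINT s|lborel. height_integrand i \<epsilon> s \<eta>)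
      = (LINT \<eta>|coord_measure i. LINT r|lborel. radial_integrand i \<epsilon> \<eta> r)"
    by (intro Bochner_Integration.integral_cong refl height_integral_eq_radial_integral \<epsilon>)
  also have "\<dots> = (LINT r|lborel. LINT \<eta>|coord_measure i. radial_integrand i \<epsilon> \<eta> r)"
    by (rule Fubini_integral) (rule integrable_radial_integrand(1)[OF \<epsilon>])
  also have "\<dots> = (LINT r|lborel. of_real (\<Psi> r / r) * (LINT \<eta>|coord_measure i. hemisphere_integrand f i \<epsilon> \<eta>))"
    by (simp only: radial_integral_slice[OF \<epsilon>])
  finally show ?thesis by (simp only: integral_mult_left_zero)
qed

lemma hemisphere_integrable:
  assumes \<epsilon>: "\<epsilon> = 1 \<or> \<epsilon> = -1"
  shows "integrable (coord_measure i) (\<lambda>\<eta>. hemisphere_integrand f i \<epsilon> \<eta>)"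
proof -
  obtain B P where B: "B \<ge> 0" "\<forall>\<xi>. 1 \<le> norm \<xi> \<longrightarrow> norm \<xi> \<le> 2 \<longrightarrow> norm (f \<xi>) \<le> B"
    using annulus_bounds by (elim exE conjE)
  have e2: "(\<epsilon> * s)\<^sup>2 = s\<^sup>2" for s using \<epsilon> by auto
  have bound: "norm (hemisphere_integrand f i \<epsilon> \<eta>) \<le> 1 * B" for \<eta>
  proof (cases "sqsum i \<eta> < 1")
    case True
    then have "norm (sphere_point i \<epsilon> \<eta>) = 1"
      by (simp add: sphere_point_eq norm_insert_coord e2)
    then have "norm (f (sphere_point i \<epsilon> \<eta>)) \<le> B" using B by simp
    moreover have "sqrt (1 - sqsum i \<eta>) \<le> 1" using sqsum_nonneg[of i \<eta>] by simp
    ultimately have "sqrt (1 - sqsum i \<eta>) * norm (f (sphere_point i \<epsilon> \<eta>)) \<le> 1 * B"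
      by (intro mult_mono) simp_all
    then show ?thesis using True by (simp add: norm_mult)
  qed (use B in simp)
  have m: "(\<lambda>\<eta>. \<epsilon> * sqrt (1 - sqsum i \<eta>)) \<in> borel_measurable (coord_measure i)" by measurable
  have [measurable]: "(\<lambda>\<eta>. f (sphere_point i \<epsilon> \<eta>)) \<in> borel_measurable (coord_measure i)"
    unfolding sphere_point_eq
    by (rule measurable_compose[OF measurable_insert_coord[OF m] meas_f]) simp
  show ?thesis
  proof (rule integrableI_bounded_set[of "coord_box i" _ _ "1 * B"])
    show "coord_box i \<in> sets (coord_measure i)" "emeasure (coord_measure i) (coord_box i) < \<infinity>"
      by (fact coord_box)+
    have "(\<lambda>\<eta>. indicator {\<eta> \<in> space (coord_measure i). sqsum i \<eta> < 1} \<eta> *\<^sub>R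
      (of_real (sqrt (1 - sqsum i \<eta>)) * f (sphere_point i \<epsilon> \<eta>))) \<in> borel_measurable (coord_measure i)" (is "?F \<in> _")
      by measurable
    also have "?F \<in> borel_measurable (coord_measure i) \<longleftrightarrow> (\<lambda>\<eta>. hemisphere_integrand f i \<epsilon> \<eta>) \<in> borel_measurable (coord_measure i)"
      by (rule measurable_cong) (simp add: indicator_def)
    finally show "(\<lambda>\<eta>. hemisphere_integrand f i \<epsilon> \<eta>) \<in> borel_measurable (coord_measure i)" .
    show "AE \<eta> in coord_measure i. \<eta> \<in> coord_box i \<longrightarrow> norm (hemisphere_integrand f i \<epsilon> \<eta>) \<le> 1 * B"
      using bound by simp
    show "AE \<eta> in coord_measure i. \<eta> \<notin> coord_box i \<longrightarrow> hemisphere_integrand f i \<epsilon> \<eta> = 0"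
    proof (rule AE_I2, rule impI)
      fix \<eta> assume "\<eta> \<in> space (coord_measure i)" "\<eta> \<notin> coord_box i"
      then have "\<not> sqsum i \<eta> < 1" using in_coord_box[of \<eta> i] by auto
      then show "hemisphere_integrand f i \<epsilon> \<eta> = 0" by simp
    qed
  qed
qed

lemma integrable_radial_cutoff:
  assumes w: "w \<in> borel_measurable borel" "\<And>\<xi>. \<bar>w \<xi>\<bar> \<le> 1"
  shows "integrable lborel (\<lambda>\<xi>. f \<xi> * of_real (w \<xi> * \<Psi> (norm \<xi>)))"
proof -
  obtain B P where B: "B \<ge> 0" "P \<ge> 0" "\<forall>\<xi>. 1 \<le> norm \<xi> \<longrightarrow> norm \<xi> \<le> 2 \<longrightarrow> norm (f \<xi>) \<le> B"
    "\<forall>r. \<bar>\<Psi> r\<bar> \<le> P" using annulus_bounds by (elim exE conjE)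
  have b: "norm (f \<xi> * of_real (w \<xi> * \<Psi> (norm \<xi>))) \<le> B * (1 * P)" for \<xi>
  proof (cases "1 \<le> norm \<xi> \<and> norm \<xi> \<le> 2")
    case True
    have "norm (f \<xi> * of_real (w \<xi> * \<Psi> (norm \<xi>))) = norm (f \<xi>) * (\<bar>w \<xi>\<bar> * \<bar>\<Psi> (norm \<xi>)\<bar>)"
      by (simp add: norm_mult abs_mult)
    also have "\<dots> \<le> B * (1 * P)" using w B True by (intro mult_mono) auto
    finally show ?thesis .
  next
    case False
    then have "\<Psi> (norm \<xi>) = 0" by (intro supp_\<Psi>) auto
    then show ?thesis using B by simp
  qed
  note [measurable] = meas_f meas_\<Psi> w(1)
  show ?thesis
  proof (rule integrableI_bounded_set[of "cball 0 2" _ _ "B * (1 * P)"])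
    show "AE \<xi> in lborel. \<xi> \<notin> cball 0 2 \<longrightarrow> f \<xi> * of_real (w \<xi> * \<Psi> (norm \<xi>)) = 0"
      by (simp add: supp_\<Psi>)
    show "emeasure lborel (cball 0 2 :: (real^'n) set) < \<infinity>"
      by (intro emeasure_bounded_finite) simp
  qed (use b in \<open>simp_all\<close>, measurable)
qed

text \<open>After splitting off the coordinate of index \<open>i\<close>, the line is cut at 0:
  positive heights sweep out the cone over one hemisphere, negative heights the cone over the
  other.\<close>

lemma radial_integral_coordinate:
  "(LINT \<xi>|lborel. f \<xi> * of_real ((\<xi> $ i)\<^sup>2 / (norm \<xi>)\<^sup>2 * \<Psi> (norm \<xi>))) = (LINT r|lborel. of_real (\<Psi> r / r)) *
    ((LINT \<eta>|coord_measure i. hemisphere_integrand f i 1 \<eta>) +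
     (LINT \<eta>|coord_measure i. hemisphere_integrand f i (-1) \<eta>))"
proof -
  interpret P: pair_sigma_finite lborel "coord_measure i" by (rule pair_sigma_finite_coord)
  let ?G = "\<lambda>\<xi>. f \<xi> * of_real ((\<xi> $ i)\<^sup>2 / (norm \<xi>)\<^sup>2 * \<Psi> (norm \<xi>))"
  let ?T = "\<lambda>(s, \<eta>). insert_coord i s \<eta>"
  have nth: "(\<lambda>\<xi>::real^'n. \<xi> $ i) \<in> borel_measurable borel"
    by (intro borel_measurable_continuous_onI continuous_intros)
  note [measurable] = this
  have "\<bar>(\<xi> $ i)\<^sup>2 / (norm \<xi>)\<^sup>2\<bar> \<le> 1" for \<xi> :: "real^'n"
  proof -
    have "\<bar>\<xi> $ i\<bar>\<^sup>2 \<le> (norm \<xi>)\<^sup>2" using component_le_norm_cart[of \<xi> i] by (intro power_mono) auto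
    then show ?thesis by (simp add: divide_le_eq_1)
  qed
  then have G: "integrable lborel ?G" by (intro integrable_radial_cutoff) measurable
  have T: "?T \<in> lborel \<Otimes>\<^sub>M coord_measure i \<rightarrow>\<^sub>M borel"
    unfolding case_prod_beta by (intro measurable_insert_coord) auto
  have GT: "integrable (lborel \<Otimes>\<^sub>M coord_measure i) (\<lambda>z. ?G (?T z))"
    using G unfolding lborel_eq_insert_coord[of i] by (rule integrable_distr[OF T])
  have Gm: "?G \<in> borel_measurable borel" using borel_measurable_integrable[OF G] by simp
  have "(LINT \<xi>|lborel. ?G \<xi>) = (LINT z|(lborel \<Otimes>\<^sub>M coord_measure i). ?G (?T z))"
    unfolding lborel_eq_insert_coord[of i] by (rule integral_distr[OF T Gm])
  also have "\<dots> = (LINT (s, \<eta>)|(lborel \<Otimes>\<^sub>M coord_measure i). ?G (insert_coord i s \<eta>))"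
    by (simp only: case_prod_unfold)
  also have "\<dots> = (LINT \<eta>|coord_measure i. LINT s|lborel. ?G (insert_coord i s \<eta>))"
    by (rule P.integral_snd[symmetric]) (use GT in \<open>simp only: case_prod_unfold\<close>)
  also have "\<dots> = (LINT \<eta>|coord_measure i. (LINT s|lborel. height_integrand i 1 s \<eta>) +
      (LINT s|lborel. height_integrand i (-1) s \<eta>))"
  proof (rule Bochner_Integration.integral_cong[OF refl])
    fix \<eta> assume \<eta>: "\<eta> \<in> space (coord_measure i)"
    have ith: "insert_coord i s \<eta> $ i = s" for s by (simp add: insert_coord_def)
    have h: "indicator {0<..} s *\<^sub>R ?G (insert_coord i s \<eta>) = height_integrand i 1 s \<eta>"
      "indicator {0<..} s *\<^sub>R ?G (insert_coord i (- s) \<eta>) = height_integrand i (-1) s \<eta>" for s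
      using sqsum_nonneg[of i \<eta>]
      by (auto simp: height_integrand_def norm_insert_coord indicator_def ith)
    have "integrable lborel (\<lambda>s. ?G (insert_coord i s \<eta>))"
    proof -
      have "integrable lborel (\<lambda>s. height_integrand i 1 s \<eta> + height_integrand i (-1) (- s) \<eta>)"
        using lborel_integrable_real_affine[OF integrable_height_integrand(2)[OF _ \<eta>, of "-1"], of "-1" 0]
          integrable_height_integrand(2)[OF _ \<eta>, of 1] by simp
      \<comment> \<open>This holds even at \<open>s = 0\<close>, where the left side vanishes
        through its factor \<open>(\<xi> $ i)\<^sup>2\<close> and the right side through the
        indicators.\<close>
      moreover have "?G (insert_coord i s \<eta>) = height_integrand i 1 s \<eta> + height_integrand i (-1) (- s) \<eta>" for s
        using sqsum_nonneg[of i \<eta>] by (cases "s = 0") (auto simp: h[symmetric] indicator_def ith)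
      ultimately show ?thesis by simp
    qed
    from integral_real_split[OF this] show "(LINT s|lborel. ?G (insert_coord i s \<eta>)) =
      (LINT s|lborel. height_integrand i 1 s \<eta>) + (LINT s|lborel. height_integrand i (-1) s \<eta>)"
      by (simp only: h)
  qed
  also have "\<dots> = (LINT \<eta>|coord_measure i. LINT s|lborel. height_integrand i 1 s \<eta>) +
      (LINT \<eta>|coord_measure i. LINT s|lborel. height_integrand i (-1) s \<eta>)"
    by (intro Bochner_Integration.integral_add P.integrable_snd integrable_height_integrand(1)) simp_all
  also have "\<dots> = (LINT r|lborel. of_real (\<Psi> r / r)) *
    ((LINT \<eta>|coord_measure i. hemisphere_integrand f i 1 \<eta>) +
     (LINT \<eta>|coord_measure i. hemisphere_integrand f i (-1) \<eta>))"
    by (simp only: height_integral simp_thms distrib_left)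
  finally show ?thesis .
qed

end


section \<open>Integration by parts\<close>

text \<open>By translation invariance every difference quotient of \<open>g\<close> in direction
  \<open>v\<close> has integral 0. The quotients converge to \<open>dird v g\<close> and are
  dominated by a constant on a fixed ball.\<close>

lemma integral_dird_eq_0:
  fixes g :: "'a::euclidean_space \<Rightarrow> complex"
  assumes diff: "\<And>p. g differentiable (at p)" and cont: "continuous_on UNIV (dird v g)"
    and K: "compact K" and supp: "\<And>p. p \<notin> K \<Longrightarrow> g p = 0"
  shows "(LINT p|lborel. dird v g p) = 0"
proof -
  obtain R where R: "\<And>p. p \<in> K \<Longrightarrow> norm p \<le> R"
    using compact_imp_bounded[OF K] unfolding bounded_iff by blast
  have supp': "dird v g p = 0" if "p \<notin> K" for p
    using dird_cong[of "- K" p g "\<lambda>p. 0" v] that supp K by (simp add: open_Compl compact_imp_closed)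
  obtain M where M: "M > 0" "\<And>p. norm (dird v g p) \<le> M"
  proof -
    have "bounded (dird v g ` K)"
      by (intro compact_imp_bounded compact_continuous_image continuous_on_subset[OF cont] K) auto
    then obtain M where M: "M > 0" "\<forall>z\<in>dird v g ` K. norm z \<le> M" unfolding bounded_pos by auto
    have "norm (dird v g p) \<le> M" for p
      using M supp'[of p] by (cases "p \<in> K") auto
    with M(1) show ?thesis by (rule that)
  qed
  have D: "(g has_derivative (\<lambda>u. dird u g p)) (at p)" for p
    by (rule differentiable_has_dird[OF diff])
  have line: "((\<lambda>t. g (p + t *\<^sub>R v)) has_derivative (\<lambda>d. d *\<^sub>R dird v g (p + t *\<^sub>R v))) (at t within S)" for p t S
  proof -
    have "((\<lambda>t. p + t *\<^sub>R v) has_derivative (\<lambda>d. d *\<^sub>R v)) (at t within S)"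
      by (auto intro!: derivative_eq_intros)
    from has_derivative_compose[OF this D]
    have "((\<lambda>t. g (p + t *\<^sub>R v)) has_derivative (\<lambda>d. dird (d *\<^sub>R v) g (p + t *\<^sub>R v))) (at t within S)" .
    moreover have "dird (d *\<^sub>R v) g (p + t *\<^sub>R v) = d *\<^sub>R dird v g (p + t *\<^sub>R v)" for d
      by (rule linear_scale[OF has_derivative_linear[OF D]])
    ultimately show ?thesis by simp
  qed
  \<comment> \<open>Steps of length at most 1 keep the supports of all difference quotients inside
    the ball of radius \<open>R + norm v\<close>.\<close>
  define h where "h k = inverse (real (Suc k))" for k
  have h: "h k > 0" "h k \<le> 1" for k by (auto simp: h_def inverse_le_1_iff)
  define Q where "Q k p = (g (p + h k *\<^sub>R v) - g p) /\<^sub>R h k" for k p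
  have cg: "continuous_on UNIV g"
    using diff by (intro differentiable_imp_continuous_on) (simp add: differentiable_on_eq_differentiable_at)
  have gi: "integrable lborel g"
  proof -
    have "integrable lborel (\<lambda>x. indicator K x *\<^sub>R g x)"
      by (rule borel_integrable_compact[OF K continuous_on_subset[OF cg]]) simp
    also have "(\<lambda>x. indicator K x *\<^sub>R g x) = g" using supp by (auto simp: indicator_def fun_eq_iff)
    finally show ?thesis .
  qed
  have shift: "integrable lborel (\<lambda>p. g (p + c))" "(LINT p|lborel. g (p + c)) = (LINT p|lborel. g p)" for c
  proof -
    have m: "(+) c \<in> lborel \<rightarrow>\<^sub>M borel" by simp
    have gi': "integrable (distr lborel borel ((+) c)) g" using gi by (simp add: lborel_distr_plus)
    show "integrable lborel (\<lambda>p. g (p + c))"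
      using integrable_distr[OF m gi'] by (simp add: add.commute)
    show "(LINT p|lborel. g (p + c)) = (LINT p|lborel. g p)"
      using integral_distr[OF m, of g] gi by (simp add: lborel_distr_plus add.commute)
  qed
  have Q0: "(LINT p|lborel. Q k p) = 0" for k
    unfolding Q_def using shift gi by simp
  have "(\<lambda>k. LINT p|lborel. Q k p) \<longlonglongrightarrow> (LINT p|lborel. dird v g p)"
  proof (rule integral_dominated_convergence)
    let ?w = "\<lambda>p::'a. indicator (cball 0 (R + norm v)) p *\<^sub>R M"
    show "dird v g \<in> borel_measurable lborel"
      using borel_measurable_continuous_onI[OF cont] by simp
    show "Q k \<in> borel_measurable lborel" for k
      unfolding Q_def using shift(1) gi by (intro borel_measurable_scaleR borel_measurable_diff) auto
    show "integrable lborel ?w"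
      by (rule borel_integrable_compact) auto
    show "AE p in lborel. (\<lambda>k. Q k p) \<longlonglongrightarrow> dird v g p"
    proof (rule AE_I2)
      fix p
      have lim: "((\<lambda>t. norm (g (p + (0 + t) *\<^sub>R v) - g (p + 0 *\<^sub>R v) - t *\<^sub>R dird v g (p + 0 *\<^sub>R v)) / norm t) \<longlongrightarrow> 0) (at 0)"
        using line[of p 0 UNIV] unfolding has_derivative_at by blast
      have "((\<lambda>t. (g (p + t *\<^sub>R v) - g p) /\<^sub>R t - dird v g p) \<longlongrightarrow> 0) (at 0)"
      proof (rule tendsto_norm_zero_cancel, rule Lim_transform_eventually[OF lim])
        have "norm (z - t *\<^sub>R L) / norm t = norm (z /\<^sub>R t - L)" if "t \<noteq> 0" for t :: real and z L :: complex
        proof -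
          have "z /\<^sub>R t - L = (z - t *\<^sub>R L) /\<^sub>R t" using that by (simp add: scaleR_right_diff_distrib)
          then show ?thesis by (simp add: divide_inverse_commute)
        qed
        then show "\<forall>\<^sub>F t in at 0. norm (g (p + (0 + t) *\<^sub>R v) - g (p + 0 *\<^sub>R v) - t *\<^sub>R dird v g (p + 0 *\<^sub>R v)) / norm t
            = norm ((g (p + t *\<^sub>R v) - g p) /\<^sub>R t - dird v g p)"
          by (auto simp: eventually_at_filter)
      qed
      then have "((\<lambda>t. (g (p + t *\<^sub>R v) - g p) /\<^sub>R t) \<longlongrightarrow> dird v g p) (at 0)"
        by (rule LIM_zero_cancel)
      moreover have "filterlim h (at 0) sequentially"
        unfolding filterlim_at h_def[abs_def] using LIMSEQ_inverse_real_of_nat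
        by simp
      ultimately show "(\<lambda>k. Q k p) \<longlonglongrightarrow> dird v g p"
        unfolding Q_def by (rule filterlim_compose)
    qed
    show "AE p in lborel. norm (Q k p) \<le> ?w p" for k
    proof (rule AE_I2)
      fix p
      \<comment> \<open>The mean value inequality along the segment, with \<open>M\<close> bounding
        the directional derivative, supplies the dominating constant.\<close>
      have "norm (g (p + h k *\<^sub>R v) - g (p + 0 *\<^sub>R v)) \<le> M * norm (h k - 0)"
      proof (rule differentiable_bound[of UNIV "\<lambda>t. g (p + t *\<^sub>R v)" "\<lambda>t d. d *\<^sub>R dird v g (p + t *\<^sub>R v)"])
        show "onorm (\<lambda>d. d *\<^sub>R dird v g (p + t *\<^sub>R v)) \<le> M" for t
        proof (rule onorm_bound)
          show "norm (d *\<^sub>R dird v g (p + t *\<^sub>R v)) \<le> M * norm d" for d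
            using mult_right_mono[OF M(2) abs_ge_zero, of "p + t *\<^sub>R v" d] by (simp add: mult.commute)
        qed (use M in simp)
      qed (auto intro: line)
      moreover have "norm (Q k p) = norm (g (p + h k *\<^sub>R v) - g p) / h k"
        using h(1)[of k] by (simp add: Q_def divide_inverse_commute)
      ultimately have "norm (Q k p) \<le> M" using h(1)[of k] by (simp add: pos_divide_le_eq)
      moreover have "Q k p = 0" if "p \<notin> cball 0 (R + norm v)"
      proof -
        have n: "norm p > R + norm v" using that by simp
        then have "p \<notin> K" using R[of p] norm_ge_zero[of v] by (auto simp del: norm_ge_zero)
        moreover have "p + h k *\<^sub>R v \<notin> K"
        proof
          assume "p + h k *\<^sub>R v \<in> K"
          then have "norm (p + h k *\<^sub>R v) \<le> R" by (rule R)
          moreover have "norm p \<le> norm (p + h k *\<^sub>R v) + norm (h k *\<^sub>R v)"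
            using norm_triangle_ineq4[of "p + h k *\<^sub>R v" "h k *\<^sub>R v"] by simp
          moreover have "norm (h k *\<^sub>R v) \<le> 1 * norm v"
            unfolding norm_scaleR using h[of k] by (intro mult_right_mono) auto
          ultimately show False using n by simp
        qed
        ultimately show ?thesis by (simp add: Q_def supp)
      qed
      ultimately show "norm (Q k p) \<le> ?w p" by (auto simp: indicator_def)
    qed
  qed
  then show ?thesis by (simp add: Q0 LIMSEQ_const_iff)
qed

section \<open>An explicit radial weight supported in the annulus\<close>

lemma has_derivative_max_0_power2:
  fixes x :: real
  shows "((\<lambda>x. (max 0 x)\<^sup>2) has_real_derivative 2 * max 0 x) (at x)"
proof -
  consider "x > 0" | "x < 0" | "x = 0" by linarith
  then show ?thesis
  proof cases
    case 1
    have "((\<lambda>x. x\<^sup>2) has_real_derivative 2 * max 0 x) (at x)"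
      using 1 by (auto intro!: derivative_eq_intros)
    then show ?thesis
      by (rule has_field_derivative_transform_within_open[of _ _ _ "{0<..}"]) (use 1 in auto)
  next
    case 2
    have "((\<lambda>x. 0) has_real_derivative 2 * max 0 x) (at x)"
      using 2 by (auto intro!: derivative_eq_intros)
    then show ?thesis
      by (rule has_field_derivative_transform_within_open[of _ _ _ "{..<0}"]) (use 2 in auto)
  next
    case 3
    have "((\<lambda>h::real. (max 0 h)\<^sup>2 / h) \<longlongrightarrow> 0) (at 0)"
    proof (rule Lim_null_comparison)
      show "((\<lambda>h::real. \<bar>h\<bar>) \<longlongrightarrow> 0) (at 0)" by (intro tendsto_eq_intros) auto
      have "norm ((max 0 h)\<^sup>2 / h) \<le> \<bar>h\<bar>" for h :: real
        by (cases "h > 0") (auto simp: max_def power2_eq_square)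
      then show "\<forall>\<^sub>F h in at 0. norm ((max 0 h)\<^sup>2 / h) \<le> \<bar>h::real\<bar>" by simp
    qed
    then show ?thesis using 3 by (simp add: DERIV_def)
  qed
qed

text \<open>A function of \<open>q = \<xi> \<bullet> \<xi>\<close>, which unlike the norm is
  differentiable everywhere; the zeros 1 and 4 correspond to radii 1 and 2. The squared positive
  part is continuously differentiable, enough for a single integration by parts. The leading factor
  \<open>q\<close> cancels the division by \<open>r\<close> in the polar formula, so that the
  integrand is a polynomial on the annulus.\<close>

definition bump :: "real \<Rightarrow> real" where
  "bump q = q * (max 0 ((q - 1) * (4 - q)))\<^sup>2"

definition bump' :: "real \<Rightarrow> real" where
  "bump' q = (max 0 ((q - 1) * (4 - q)))\<^sup>2 + q * (2 * max 0 ((q - 1) * (4 - q)) * (5 - 2 * q))"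

lemma bump_derivative: "(bump has_real_derivative bump' q) (at q)"
proof -
  have "((\<lambda>q::real. (q - 1) * (4 - q)) has_real_derivative (5 - 2 * q)) (at q)"
    by (auto intro!: derivative_eq_intros)
  from DERIV_chain2[OF has_derivative_max_0_power2 this]
  have "((\<lambda>q. (max 0 ((q - 1) * (4 - q)))\<^sup>2) has_real_derivative 2 * max 0 ((q - 1) * (4 - q)) * (5 - 2 * q)) (at q)" .
  from DERIV_mult[OF DERIV_ident this] show ?thesis
    unfolding bump_def[abs_def] bump'_def by (simp add: algebra_simps)
qed

lemma bump_support: "q \<le> 1 \<or> q \<ge> 4 \<Longrightarrow> bump q = 0" "q \<le> 1 \<or> q \<ge> 4 \<Longrightarrow> bump' q = 0"
proof -
  assume "q \<le> 1 \<or> q \<ge> 4"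
  then have "(q - 1) * (4 - q) \<le> 0" by (auto simp: mult_le_0_iff)
  then show "bump q = 0" "bump' q = 0" by (simp_all add: bump_def bump'_def max_def)
qed

lemma continuous_on_bump: "continuous_on S bump" "continuous_on S bump'"
  unfolding bump_def[abs_def] bump'_def[abs_def] by (intro continuous_intros)+

text \<open>The polar formula wants a weight that vanishes for all \<open>r \<le> 1\<close>. The
  positive part is taken because negative radii between -2 and -1 would otherwise have squares
  inside the support of \<open>bump\<close>.\<close>

definition radial_weight :: "real \<Rightarrow> real" where
  "radial_weight r = bump ((max 0 r)\<^sup>2)"

text \<open>For w = \<open>radial_weight\<close> this is \<open>r\<close> times the derivative of w.
  A \<xi>-derivative of the weight is \<open>(\<xi> $ j) / (norm \<xi>)\<^sup>2\<close> times this
  function of \<open>norm \<xi>\<close>; the first factor joins the homogeneous function, and the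
  \<open>1 / r\<close> of the polar formula leaves the plain derivative of w.\<close>

definition radial_weight' :: "real \<Rightarrow> real" where
  "radial_weight' r = 2 * (max 0 r)\<^sup>2 * bump' ((max 0 r)\<^sup>2)"

lemma continuous_on_radial_weight: "continuous_on S radial_weight" "continuous_on S radial_weight'"
proof -
  have c: "continuous_on S (\<lambda>r::real. (max 0 r)\<^sup>2)" by (intro continuous_intros)
  show "continuous_on S radial_weight" unfolding radial_weight_def[abs_def]
    by (rule continuous_on_compose2[OF continuous_on_bump(1)[of UNIV] c]) simp
  have "continuous_on S (\<lambda>r. bump' ((max 0 r)\<^sup>2))"
    by (rule continuous_on_compose2[OF continuous_on_bump(2)[of UNIV] c]) simp
  then show "continuous_on S radial_weight'" unfolding radial_weight'_def[abs_def]
    by (intro continuous_intros)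
qed

lemma radial_weight_support:
  assumes "r \<le> 1 \<or> r \<ge> 2" shows "radial_weight r = 0" "radial_weight' r = 0"
proof -
  have "(max 0 r)\<^sup>2 \<le> 1 \<or> (max 0 r)\<^sup>2 \<ge> 4"
  proof (cases "r \<le> 1")
    case True
    then have "(max 0 r)\<^sup>2 \<le> 1\<^sup>2" by (intro power_mono) auto
    then show ?thesis by simp
  next
    case False
    then have "2\<^sup>2 \<le> (max 0 r)\<^sup>2" using assms by (intro power_mono) auto
    then show ?thesis by simp
  qed
  then show "radial_weight r = 0" "radial_weight' r = 0"
    by (simp_all add: radial_weight_def radial_weight'_def bump_support)
qed

lemma integral_annulus_FTC:
  fixes F :: "real \<Rightarrow> real"
  assumes "\<And>r. 1 \<le> r \<Longrightarrow> r \<le> 2 \<Longrightarrow> (F has_real_derivative u r) (at r)" "continuous_on {1..2} u"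
    and "\<And>r. r \<le> 1 \<or> r \<ge> 2 \<Longrightarrow> u r = 0"
  shows "(LINT r|lborel. complex_of_real (u r)) = of_real (F 2 - F 1)"
proof -
  have "(LINT r|lborel. indicator {1..2} r *\<^sub>R u r) = F 2 - F 1"
    by (rule integral_FTC_Icc)
      (use assms in \<open>auto simp: has_real_derivative_iff_has_vector_derivative[symmetric] intro: DERIV_subset\<close>)
  also have "(\<lambda>r. indicator {1..2} r *\<^sub>R u r) = u"
  proof
    show "indicator {1..2} r *\<^sub>R u r = u r" for r
      using assms(3)[of r] by (cases "r \<in> {1..2}") auto
  qed
  finally show ?thesis by (simp add: integral_complex_of_real)
qed

lemma radial_weight_integral: "(LINT r|lborel. complex_of_real (radial_weight r / r)) = 81 / 20"
proof -
  \<comment> \<open>With \<open>v = r\<^sup>2 - 1\<close> the integrand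
    \<open>r * ((r\<^sup>2 - 1) * (4 - r\<^sup>2))\<^sup>2\<close> turns into half of
    \<open>(v * (3 - v))\<^sup>2 = 9 * v\<^sup>2 - 6 * v ^ 3 + v ^ 4\<close>, taken from
    \<open>v = 0\<close> to \<open>v = 3\<close>.\<close>
  let ?F = "\<lambda>r::real. (3 * (r\<^sup>2 - 1) ^ 3 - 3 / 2 * (r\<^sup>2 - 1) ^ 4 + (r\<^sup>2 - 1) ^ 5 / 5) / 2"
  have "(LINT r|lborel. complex_of_real (radial_weight r / r)) = of_real (?F 2 - ?F 1)"
  proof (rule integral_annulus_FTC)
    fix r :: real assume r: "1 \<le> r" "r \<le> 2"
    have "1\<^sup>2 \<le> r\<^sup>2" "r\<^sup>2 \<le> 2\<^sup>2" using r by (intro power_mono; simp)+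
    then have "(r\<^sup>2 - 1) * (4 - r\<^sup>2) \<ge> 0" by simp
    then have "radial_weight r / r = r * ((r\<^sup>2 - 1) * (4 - r\<^sup>2))\<^sup>2"
      using r by (simp add: radial_weight_def bump_def max_def power2_eq_square)
    also have "\<dots> = (3 * (3 * (r\<^sup>2 - 1)\<^sup>2 * (2 * r)) - 3 / 2 * (4 * (r\<^sup>2 - 1) ^ 3 * (2 * r)) + 5 * (r\<^sup>2 - 1) ^ 4 * (2 * r) / 5) / 2"
      by algebra
    finally have e: "radial_weight r / r = \<dots>" .
    show "(?F has_real_derivative radial_weight r / r) (at r)"
      unfolding e by (auto intro!: derivative_eq_intros simp: eval_nat_numeral)
  next
    show "continuous_on {1..2} (\<lambda>r. radial_weight r / r)"
      by (intro continuous_intros continuous_on_radial_weight) auto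
  qed (simp add: radial_weight_support)
  then show ?thesis by simp
qed

lemma radial_weight'_integral: "(LINT r|lborel. complex_of_real (radial_weight' r / r)) = 0"
proof -
  have "(LINT r|lborel. complex_of_real (radial_weight' r / r)) = of_real (bump (2\<^sup>2) - bump (1\<^sup>2))"
  proof (rule integral_annulus_FTC)
    fix r :: real assume r: "1 \<le> r" "r \<le> 2"
    have "((\<lambda>r. bump (r\<^sup>2)) has_real_derivative bump' (r\<^sup>2) * (2 * r)) (at r)"
      by (rule DERIV_chain2[OF bump_derivative]) (auto intro!: derivative_eq_intros)
    then show "((\<lambda>r. bump (r\<^sup>2)) has_real_derivative radial_weight' r / r) (at r)"
      using r by (simp add: radial_weight'_def max_def power2_eq_square mult_ac)
  next
    show "continuous_on {1..2} (\<lambda>r. radial_weight' r / r)"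
      by (intro continuous_intros continuous_on_radial_weight) auto
  qed (simp add: radial_weight_support)
  then show ?thesis by (simp add: bump_support)
qed


section \<open>The sphere integral and the polar formula\<close>

lemma norm_sphere_point:
  assumes "\<epsilon> = 1 \<or> \<epsilon> = -1" "sqsum i \<eta> < 1"
  shows "norm (sphere_point i \<epsilon> \<eta>) = 1"
proof -
  have "(\<epsilon> * s)\<^sup>2 = s\<^sup>2" for s using assms(1) by auto
  then show ?thesis using assms(2) by (simp add: sphere_point_eq norm_insert_coord)
qed

lemma sphere_integral_alt:
  fixes f :: "real^'n::{finite,linorder} \<Rightarrow> complex"
  shows "sphere_integral f = (\<Sum>i\<in>UNIV. LINT \<eta>|coord_measure i. indicator {\<eta>. sqsum i \<eta> < 1} \<eta> *\<^sub>R
    (of_real (sqrt (1 - sqsum i \<eta>)) * (f (sphere_point i 1 \<eta>) + f (sphere_point i (-1) \<eta>))))"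
  unfolding sphere_integral_def
proof (intro sum.cong refl)
  fix i :: 'n
  have nth: "sphere_point i \<epsilon> \<eta> $ i = \<epsilon> * sqrt (1 - sqsum i \<eta>)" for \<epsilon> \<eta>
    by (simp add: sphere_point_eq insert_coord_def)
  have s: "(-1) ^ n * ((-1) ^ n * z) = z" for n :: nat and z :: complex
    by (simp add: mult.assoc[symmetric] flip: power_add)
  show "(-1) ^ card {k. k < i} * sphere_form_integral i (\<lambda>\<xi>. of_real (\<xi> $ i) * f \<xi>)
    = (LINT \<eta>|coord_measure i. indicator {\<eta>. sqsum i \<eta> < 1} \<eta> *\<^sub>R
    (of_real (sqrt (1 - sqsum i \<eta>)) * (f (sphere_point i 1 \<eta>) + f (sphere_point i (-1) \<eta>))))"
    unfolding sphere_form_integral_def Let_def s set_lebesgue_integral_def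
    by (rule Bochner_Integration.integral_cong[OF refl])
      (simp add: nth indicator_def sqsum_def[symmetric] distrib_left)
qed

lemma sphere_integral_cong:
  fixes f :: "real^'n::{finite,linorder} \<Rightarrow> complex"
  assumes "\<And>\<xi>. norm \<xi> = 1 \<Longrightarrow> f \<xi> = g \<xi>"
  shows "sphere_integral f = sphere_integral g"
  unfolding sphere_integral_alt
proof (intro sum.cong refl Bochner_Integration.integral_cong)
  fix i :: 'n and \<eta>
  show "indicat_real {\<eta>. sqsum i \<eta> < 1} \<eta> *\<^sub>R
      (of_real (sqrt (1 - sqsum i \<eta>)) * (f (sphere_point i 1 \<eta>) + f (sphere_point i (-1) \<eta>)))
    = indicat_real {\<eta>. sqsum i \<eta> < 1} \<eta> *\<^sub>R
      (of_real (sqrt (1 - sqsum i \<eta>)) * (g (sphere_point i 1 \<eta>) + g (sphere_point i (-1) \<eta>)))"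
    using assms norm_sphere_point[of 1 i \<eta>] norm_sphere_point[of "-1" i \<eta>]
    by (cases "sqsum i \<eta> < 1") simp_all
qed

text \<open>The weights \<open>(\<xi> $ i)\<^sup>2 / (norm \<xi>)\<^sup>2\<close> add up to 1. They
  split the left side into one integral for each coordinate, and each of these yields one summand of
  the sphere integral with the same radial factor.\<close>

lemma polar_integral:
  fixes f :: "real^'n::{finite,linorder} \<Rightarrow> complex" and \<Psi> :: "real \<Rightarrow> real"
  assumes f: "continuous_on (UNIV - {0}) f" "f \<in> borel_measurable borel"
    "\<And>\<xi> t. \<xi> \<noteq> 0 \<Longrightarrow> t > 0 \<Longrightarrow> f (t *\<^sub>R \<xi>) = f \<xi> / of_real (t ^ CARD('n))"
    and \<Psi>: "continuous_on UNIV \<Psi>" "\<And>r. r \<le> 1 \<or> r \<ge> 2 \<Longrightarrow> \<Psi> r = 0"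
  shows "(LINT \<xi>|lborel. f \<xi> * of_real (\<Psi> (norm \<xi>))) = (LINT r|lborel. of_real (\<Psi> r / r)) * sphere_integral f"
proof -
  note A = f \<Psi>
  let ?w = "\<lambda>i (\<xi>::(real, 'n) vec). (\<xi> $ i)\<^sup>2 / (norm \<xi>)\<^sup>2"
  let ?A = "\<lambda>i \<epsilon>. LINT \<eta>|coord_measure i. hemisphere_integrand f i \<epsilon> \<eta>"
  \<comment> \<open>At the origin the quotients are \<open>0 / 0 = 0\<close> and do not add up to 1,
    but there \<Psi> vanishes.\<close>
  have w1: "(\<Sum>i\<in>UNIV. ?w i \<xi>) * \<Psi> (norm \<xi>) = \<Psi> (norm \<xi>)" for \<xi>
  proof (cases "\<xi> = 0")
    case False
    have "(\<Sum>i\<in>UNIV. (\<xi> $ i)\<^sup>2) = (norm \<xi>)\<^sup>2"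
      by (simp add: norm_vec_def L2_set_def sum_nonneg)
    then show ?thesis using False by (simp flip: sum_divide_distrib)
  qed (simp add: \<Psi>(2))
  have "integrable lborel (\<lambda>\<xi>. f \<xi> * of_real (?w i \<xi> * \<Psi> (norm \<xi>)))" for i
  proof (rule integrable_radial_cutoff[OF A])
    have [measurable]: "(\<lambda>\<xi>::(real, 'n) vec. \<xi> $ i) \<in> borel_measurable borel"
      by (intro borel_measurable_continuous_onI continuous_intros)
    show "?w i \<in> borel_measurable borel" by measurable
    have "\<bar>\<xi> $ i\<bar>\<^sup>2 \<le> (norm \<xi>)\<^sup>2" for \<xi> :: "(real, 'n) vec"
      using component_le_norm_cart[of \<xi> i] by (intro power_mono) auto
    then show "\<bar>?w i \<xi>\<bar> \<le> 1" for \<xi> by (simp add: divide_le_eq_1)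
  qed
  then have "(LINT \<xi>|lborel. (\<Sum>i\<in>UNIV. f \<xi> * of_real (?w i \<xi> * \<Psi> (norm \<xi>))))
    = (\<Sum>i\<in>UNIV. LINT \<xi>|lborel. f \<xi> * of_real (?w i \<xi> * \<Psi> (norm \<xi>)))"
    by (rule Bochner_Integration.integral_sum)
  also have "\<dots> = (\<Sum>i\<in>UNIV. (LINT r|lborel. of_real (\<Psi> r / r)) * (?A i 1 + ?A i (-1)))"
    by (intro sum.cong refl radial_integral_coordinate[OF A])
  also have "\<dots> = (LINT r|lborel. of_real (\<Psi> r / r)) * (\<Sum>i\<in>UNIV. ?A i 1 + ?A i (-1))"
    by (rule sum_distrib_left[symmetric])
  also have "(\<Sum>i\<in>UNIV. ?A i 1 + ?A i (-1)) = sphere_integral f"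
    unfolding sphere_integral_alt
  proof (rule sum.cong[OF refl])
    fix i
    have "?A i 1 + ?A i (-1) = (LINT \<eta>|coord_measure i.
      hemisphere_integrand f i 1 \<eta> +
      hemisphere_integrand f i (-1) \<eta>)"
      by (intro Bochner_Integration.integral_add[symmetric] hemisphere_integrable[OF A]) simp_all
    then show "?A i 1 + ?A i (-1) = (LINT \<eta>|coord_measure i. indicator {\<eta>. sqsum i \<eta> < 1} \<eta> *\<^sub>R
      (of_real (sqrt (1 - sqsum i \<eta>)) * (f (sphere_point i 1 \<eta>) + f (sphere_point i (-1) \<eta>))))"
      by (simp add: distrib_left scaleR_add_right)
  qed
  also have "(\<lambda>\<xi>. \<Sum>i\<in>UNIV. f \<xi> * of_real (?w i \<xi> * \<Psi> (norm \<xi>))) = (\<lambda>\<xi>. f \<xi> * of_real (\<Psi> (norm \<xi>)))"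
  proof
    fix \<xi>
    have "(\<Sum>i\<in>UNIV. f \<xi> * of_real (?w i \<xi> * \<Psi> (norm \<xi>))) = f \<xi> * of_real ((\<Sum>i\<in>UNIV. ?w i \<xi>) * \<Psi> (norm \<xi>))"
      unfolding sum_distrib_right of_real_sum sum_distrib_left ..
    then show "(\<Sum>i\<in>UNIV. f \<xi> * of_real (?w i \<xi> * \<Psi> (norm \<xi>))) = f \<xi> * of_real (\<Psi> (norm \<xi>))"
      unfolding w1 .
  qed
  finally show ?thesis .
qed

lemma polar_integral_slice:
  fixes k :: "'n::{finite,linorder} pt \<Rightarrow> complex" and \<Psi> :: "real \<Rightarrow> real"
  assumes k: "continuous_on (U \<times> (UNIV - {0})) k" "pos_homogeneous U (- of_nat CARD('n)) k" and x: "x \<in> U"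
    and \<Psi>: "continuous_on UNIV \<Psi>" "\<And>r. r \<le> 1 \<or> r \<ge> 2 \<Longrightarrow> \<Psi> r = 0"
  shows "(LINT \<xi>|lborel. (if \<xi> = 0 then 0 else k (x, \<xi>)) * of_real (\<Psi> (norm \<xi>)))
    = (LINT r|lborel. of_real (\<Psi> r / r)) * sphere_integral (\<lambda>\<xi>. k (x, \<xi>))"
proof -
  let ?f = "\<lambda>\<xi>. if \<xi> = 0 then 0 else k (x, \<xi>)"
  have c: "continuous_on (UNIV - {0}) (\<lambda>\<xi>. k (x, \<xi>))"
    by (rule continuous_on_compose2[OF k(1)]) (use x in \<open>auto intro!: continuous_intros\<close>)
  have "(LINT \<xi>|lborel. ?f \<xi> * of_real (\<Psi> (norm \<xi>))) = (LINT r|lborel. of_real (\<Psi> r / r)) * sphere_integral ?f"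
  proof (rule polar_integral[OF _ _ _ \<Psi>])
    show "continuous_on (UNIV - {0}) ?f" using c by (subst continuous_on_cong[OF refl, of _ _ "\<lambda>\<xi>. k (x, \<xi>)"]) auto
    have "(\<lambda>\<xi>. indicator (UNIV - {0}) \<xi> *\<^sub>R k (x, \<xi>)) \<in> borel_measurable borel"
      by (rule borel_measurable_continuous_on_indicator[OF _ c]) auto
    also have "(\<lambda>\<xi>. indicator (UNIV - {0}) \<xi> *\<^sub>R k (x, \<xi>)) = ?f" by (auto simp: indicator_def)
    finally show "?f \<in> borel_measurable borel" .
    fix \<xi> :: "(real, 'n) vec" and t :: real assume "\<xi> \<noteq> 0" "t > 0"
    then show "?f (t *\<^sub>R \<xi>) = ?f \<xi> / of_real (t ^ CARD('n))"
      using pos_homogeneousD[OF k(2) x, of \<xi> t] by (simp add: powr_minus powr_nat' divide_inverse mult.commute)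
  qed
  also have "sphere_integral ?f = sphere_integral (\<lambda>\<xi>. k (x, \<xi>))"
    by (rule sphere_integral_cong) auto
  finally show ?thesis .
qed

section \<open>Extension by zero to the whole phase space\<close>

definition phase_extension ::
  "(real^'n::finite) set \<Rightarrow> ('n pt \<Rightarrow> complex) \<Rightarrow> (real^'n \<Rightarrow> real) \<Rightarrow> 'n pt \<Rightarrow> complex" where
  "phase_extension U k u p = (if fst p \<in> U \<and> snd p \<noteq> 0 then k p * of_real (u (snd p)) else 0)"

definition norm_weight :: "real^'n::finite \<Rightarrow> real" where
  "norm_weight \<xi> = bump (\<xi> \<bullet> \<xi>)"

definition norm_weight' :: "real^'n::finite \<Rightarrow> real^'n \<Rightarrow> real" where
  "norm_weight' b \<xi> = bump' (\<xi> \<bullet> \<xi>) * (2 * (\<xi> \<bullet> b))"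

lemma norm_weight_eq: "norm_weight \<xi> = radial_weight (norm \<xi>)"
  by (simp add: norm_weight_def radial_weight_def max_def power2_norm_eq_inner)

lemma norm_weight'_eq:
  "\<xi> \<noteq> 0 \<Longrightarrow> norm_weight' b \<xi> = (\<xi> \<bullet> b) / (norm \<xi>)\<^sup>2 * radial_weight' (norm \<xi>)"
  by (simp add: norm_weight'_def radial_weight'_def max_def power2_norm_eq_inner)

lemma norm_weight_continuous:
  fixes b :: "real^'n::finite"
  shows "continuous_on UNIV (norm_weight :: real^'n \<Rightarrow> real)" "continuous_on UNIV (norm_weight' b)"
proof -
  have c: "continuous_on UNIV (\<lambda>\<xi>::real^'n. \<xi> \<bullet> \<xi>)" by (intro continuous_intros)
  show "continuous_on UNIV (norm_weight :: real^'n \<Rightarrow> real)" unfolding norm_weight_def[abs_def]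
    by (rule continuous_on_compose2[OF continuous_on_bump(1)[of UNIV] c]) simp
  show "continuous_on UNIV (norm_weight' b)" unfolding norm_weight'_def[abs_def]
    by (intro continuous_intros continuous_on_compose2[OF continuous_on_bump(2)[of UNIV] c]) simp
qed

lemma norm_weight_support:
  assumes "norm \<xi> \<le> 1 \<or> norm \<xi> \<ge> 2"
  shows "norm_weight \<xi> = 0" "norm_weight' b \<xi> = 0"
proof -
  show "norm_weight \<xi> = 0" using assms by (simp add: norm_weight_eq radial_weight_support)
  show "norm_weight' b \<xi> = 0"
  proof (cases "\<xi> = 0")
    case False
    then show ?thesis by (simp add: norm_weight'_eq radial_weight_support[OF assms])
  qed (simp add: norm_weight'_def)
qed

lemma norm_weight_derivative:
  "((\<lambda>p::'n::finite pt. complex_of_real (norm_weight (snd p))) has_derivative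
    (\<lambda>v. complex_of_real (norm_weight' (snd v) (snd p)))) (at p)"
proof -
  have "((\<lambda>p::'n pt. snd p \<bullet> snd p) has_derivative (\<lambda>v. 2 * (snd p \<bullet> snd v))) (at p)"
    by (auto intro!: derivative_eq_intros simp: inner_commute)
  from has_derivative_compose[OF this bump_derivative[unfolded has_field_derivative_def]]
  have "((\<lambda>p::'n pt. norm_weight (snd p)) has_derivative (\<lambda>v. norm_weight' (snd v) (snd p))) (at p)"
    by (simp add: norm_weight_def norm_weight'_def)
  then show ?thesis by (rule has_derivative_of_real)
qed

context
  fixes U K :: "(real^'n::finite) set"
  assumes U: "open U" and K: "compact K" "K \<subseteq> U"
begin

lemma compact_shell: "compact (K \<times> (cball (0::real^'n) 2 - ball 0 1))"
  by (intro compact_Times K compact_diff) auto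

lemma phase_extension_eq_0:
  assumes "\<And>x \<xi>. x \<in> U - K \<Longrightarrow> \<xi> \<noteq> 0 \<Longrightarrow> k (x, \<xi>) = 0" "\<And>\<xi>. norm \<xi> \<le> 1 \<or> norm \<xi> \<ge> 2 \<Longrightarrow> u \<xi> = 0"
    and "p \<notin> K \<times> (cball 0 2 - ball 0 1)"
  shows "phase_extension U k u p = 0"
proof (cases p)
  case (Pair x \<xi>)
  then show ?thesis
    using assms(1)[of x \<xi>] assms(2)[of \<xi>] assms(3) by (auto simp: phase_extension_def not_le)
qed

text \<open>Two open sets cover the space: off the zero section over \<open>U\<close> the extension
  is a product of continuous functions, and outside the compact shell it is 0. They cover because
  the shell lies in the first set, by \<open>K \<subseteq> U\<close>.\<close>

lemma phase_extension_continuous: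
  assumes k: "continuous_on (U \<times> (UNIV - {0})) k" "\<And>x \<xi>. x \<in> U - K \<Longrightarrow> \<xi> \<noteq> 0 \<Longrightarrow> k (x, \<xi>) = 0"
    and u: "continuous_on UNIV u" "\<And>\<xi>. norm \<xi> \<le> 1 \<or> norm \<xi> \<ge> 2 \<Longrightarrow> u \<xi> = 0"
  shows "continuous_on UNIV (phase_extension U k u)"
proof -
  let ?W = "U \<times> (UNIV - {0::real^'n})" and ?C = "K \<times> (cball (0::real^'n) 2 - ball 0 1)"
  have "continuous_on ?W (\<lambda>p. k p * of_real (u (snd p)))"
    by (intro continuous_intros k continuous_on_compose2[OF u(1)]) auto
  then have "continuous_on ?W (phase_extension U k u)"
    by (rule continuous_on_eq) (auto simp: phase_extension_def)
  moreover have "continuous_on (- ?C) (phase_extension U k u)"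
    by (rule continuous_on_eq[OF continuous_on_const[of _ 0]])
      (use phase_extension_eq_0[of k u, OF k(2) u(2)] in simp)
  moreover have "open (- ?C)" using compact_shell by (simp add: open_Compl compact_imp_closed)
  ultimately have "continuous_on (?W \<union> - ?C) (phase_extension U k u)"
    by (intro continuous_on_open_Un open_punctured U)
  moreover have "?W \<union> - ?C = UNIV" using K by auto
  ultimately show ?thesis by simp
qed

lemma phase_extension_integrable:
  assumes k: "continuous_on (U \<times> (UNIV - {0})) k" "\<And>x \<xi>. x \<in> U - K \<Longrightarrow> \<xi> \<noteq> 0 \<Longrightarrow> k (x, \<xi>) = 0"
    and u: "continuous_on UNIV u" "\<And>\<xi>. norm \<xi> \<le> 1 \<or> norm \<xi> \<ge> 2 \<Longrightarrow> u \<xi> = 0"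
  shows "integrable lborel (phase_extension U k u)"
proof -
  let ?C = "K \<times> (cball (0::real^'n) 2 - ball 0 1)"
  have "integrable lborel (\<lambda>p. indicator ?C p *\<^sub>R phase_extension U k u p)"
    by (intro borel_integrable_compact compact_shell
        continuous_on_subset[OF phase_extension_continuous[OF k u]]) auto
  also have "(\<lambda>p. indicator ?C p *\<^sub>R phase_extension U k u p) = phase_extension U k u"
  proof
    show "indicator ?C p *\<^sub>R phase_extension U k u p = phase_extension U k u p" for p
      using phase_extension_eq_0[of k u p, OF k(2) u(2)] by (cases "p \<in> ?C") simp_all
  qed
  finally show ?thesis .
qed

text \<open>The product rule for \<open>h\<close> times the weight, integrated; the boundary term is
  absent by compact support. The second conclusion transfers the support of \<open>h\<close> to its
  derivative, which is what the extension lemmas ask of it.\<close>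

lemma phase_extension_by_parts:
  assumes h: "smooth_on (U \<times> (UNIV - {0})) h" "\<And>x \<xi>. x \<in> U - K \<Longrightarrow> \<xi> \<noteq> 0 \<Longrightarrow> h (x, \<xi>) = 0"
  shows "(LINT p|lborel. phase_extension U (dird v h) norm_weight p)
    = - (LINT p|lborel. phase_extension U h (norm_weight' (snd v)) p)"
    and "x \<in> U - K \<Longrightarrow> \<xi> \<noteq> 0 \<Longrightarrow> dird v h (x, \<xi>) = 0"
proof -
  let ?W = "U \<times> (UNIV - {0::real^'n})" and ?C = "K \<times> (cball (0::real^'n) 2 - ball 0 1)"
  note O = open_punctured[OF U]
  have UK: "open (U - K)" using U K by (intro open_Diff compact_imp_closed)
  show h': "dird v h (x, \<xi>) = 0" if "x \<in> U - K" "\<xi> \<noteq> 0" for x \<xi>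
    using dird_punctured_cong[OF UK that, of h "\<lambda>p. 0" v] h(2) by simp
  let ?H = "phase_extension U h norm_weight"
  have D: "(?H has_derivative (\<lambda>v. phase_extension U (dird v h) norm_weight p
      + phase_extension U h (norm_weight' (snd v)) p)) (at p)" for p
  proof (cases "p \<in> ?W")
    case True
    have "((\<lambda>p. h p * of_real (norm_weight (snd p))) has_derivative
      (\<lambda>v. h p * of_real (norm_weight' (snd v) (snd p)) + dird v h p * of_real (norm_weight (snd p)))) (at p)"
      by (intro has_derivative_mult norm_weight_derivative differentiable_has_dird
          smooth_on_differentiable_at[OF h(1) O True])
    then have "(?H has_derivative
      (\<lambda>v. h p * of_real (norm_weight' (snd v) (snd p)) + dird v h p * of_real (norm_weight (snd p)))) (at p)"
      by (rule has_derivative_transform_within_open[OF _ O True]) (auto simp: phase_extension_def)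
    then show ?thesis using True by (simp add: phase_extension_def mem_Times_iff add.commute)
  next
    case False
    then have p: "p \<in> - ?C" using K by auto
    have o: "open (- ?C)" using compact_shell by (simp add: open_Compl compact_imp_closed)
    have z: "?H q = 0" if "q \<in> - ?C" for q
      by (rule phase_extension_eq_0[of h norm_weight, OF h(2) norm_weight_support(1)]) (use that in auto)
    have "(?H has_derivative (\<lambda>v. 0)) (at p)"
      by (rule has_derivative_transform_within_open[OF has_derivative_const[of 0] o p]) (simp add: z)
    moreover have "\<not> (fst p \<in> U \<and> snd p \<noteq> 0)" using False by (auto simp: mem_Times_iff)
    ultimately show ?thesis by (simp only: phase_extension_def if_False add_0)
  qed
  have dH: "dird v ?H = (\<lambda>p. phase_extension U (dird v h) norm_weight p + phase_extension U h (norm_weight' (snd v)) p)"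
    using dird_eq[OF D] by (intro ext)
  note c1 = smooth_on_continuous_on[OF smooth_on_dird[OF h(1)]] h' norm_weight_continuous(1) norm_weight_support(1)
    and c2 = smooth_on_continuous_on[OF h(1)] h(2) norm_weight_continuous(2) norm_weight_support(2)
  have "(LINT p|lborel. dird v ?H p) = 0"
  proof (rule integral_dird_eq_0[OF _ _ compact_shell])
    show "?H differentiable (at p)" for p using D unfolding differentiable_def by blast
    show "continuous_on UNIV (dird v ?H)"
      unfolding dH by (intro continuous_on_add phase_extension_continuous c1 c2)
    show "?H p = 0" if "p \<notin> ?C" for p
      by (rule phase_extension_eq_0[of h norm_weight, OF h(2) norm_weight_support(1) that])
  qed
  also have "(LINT p|lborel. dird v ?H p) = (LINT p|lborel. phase_extension U (dird v h) norm_weight p)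
      + (LINT p|lborel. phase_extension U h (norm_weight' (snd v)) p)"
    unfolding dH by (intro Bochner_Integration.integral_add phase_extension_integrable c1 c2)
  finally show "(LINT p|lborel. phase_extension U (dird v h) norm_weight p)
    = - (LINT p|lborel. phase_extension U h (norm_weight' (snd v)) p)"
    by (simp add: eq_neg_iff_add_eq_0)
qed

end


text \<open>Trades the sphere integral for one over flat space, where the derivatives inside
  \<open>k\<close> are ordinary partial derivatives. Any admissible \<Psi> may be used: the weight
  itself brings in a nonzero radial factor, its derivative a vanishing one.\<close>

lemma sphere_integral_integral_eq:
  fixes k :: "'n::{finite,linorder} pt \<Rightarrow> complex" and \<Psi> :: "real \<Rightarrow> real"
  assumes U: "open U" and K: "compact K" "K \<subseteq> U"
    and k: "continuous_on (U \<times> (UNIV - {0})) k" "\<And>x \<xi>. x \<in> U - K \<Longrightarrow> \<xi> \<noteq> 0 \<Longrightarrow> k (x, \<xi>) = 0"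
    and hom: "pos_homogeneous U (- of_nat CARD('n)) k"
    and \<Psi>: "continuous_on UNIV \<Psi>" "\<And>r. r \<le> 1 \<or> r \<ge> 2 \<Longrightarrow> \<Psi> r = 0"
  shows "(LINT p|lborel. phase_extension U k (\<lambda>\<xi>. \<Psi> (norm \<xi>)) p)
    = (LINT r|lborel. of_real (\<Psi> r / r)) * (LINT x:U|lborel. sphere_integral (\<lambda>\<xi>. k (x, \<xi>)))"
proof -
  let ?u = "\<lambda>\<xi>::(real, 'n) vec. \<Psi> (norm \<xi>)" and ?c = "LINT r|lborel. complex_of_real (\<Psi> r / r)"
  have u: "continuous_on UNIV ?u"
    by (rule continuous_on_compose2[OF \<Psi>(1)]) (auto intro: continuous_intros)
  have "integrable lborel (phase_extension U k ?u)"
    by (rule phase_extension_integrable[OF U K k u]) (assumption | rule \<Psi>(2))+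
  then have "(LINT p|lborel. phase_extension U k ?u p) = (LINT x|lborel. LINT \<xi>|lborel. phase_extension U k ?u (x, \<xi>))"
    unfolding lborel_prod[symmetric] by (rule lborel_pair.integral_fst'[symmetric])
  also have "\<dots> = (LINT x|lborel. ?c * (indicator U x *\<^sub>R sphere_integral (\<lambda>\<xi>. k (x, \<xi>))))"
  proof (rule Bochner_Integration.integral_cong[OF refl])
    fix x :: "(real, 'n) vec"
    show "(LINT \<xi>|lborel. phase_extension U k ?u (x, \<xi>)) = ?c * (indicator U x *\<^sub>R sphere_integral (\<lambda>\<xi>. k (x, \<xi>)))"
    proof (cases "x \<in> U")
      case True
      have "phase_extension U k ?u (x, \<xi>) = (if \<xi> = 0 then 0 else k (x, \<xi>)) * of_real (\<Psi> (norm \<xi>))" for \<xi>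
        using True by (simp add: phase_extension_def)
      then show ?thesis using polar_integral_slice[OF k(1) hom True \<Psi>] True by simp
    qed (simp add: phase_extension_def)
  qed
  finally show ?thesis by (simp only: set_lebesgue_integral_def integral_mult_right_zero)
qed

theorem theorem1:
  fixes U :: "(real^'n::{finite,wellorder}) set"
    and \<kappa> :: "'n pt \<Rightarrow> complex"
    and \<beta> :: "'n form"
  assumes "open U"
    and "cutoff U \<kappa>"
    and "\<beta> \<in> \<Omega>CS U \<kappa>"
    and "compactly_supported_form U \<beta>"
  shows "res_form U \<kappa> (ext_d \<beta>) = 0"
proof -
  note U = assms(1) and \<kappa> = assms(2)
  let ?n = "of_nat CARD('n) :: complex"
  obtain K where K: "compact K" "K \<subseteq> U" and supp: "\<And>I J x \<xi>. x \<in> U - K \<Longrightarrow> \<beta> I J (x, \<xi>) = 0"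
    using assms(4) unfolding compactly_supported_form_def by blast
  obtain C where C: "\<And>I J. has_components U \<kappa> (\<beta> I J) (C I J)"
  proof -
    define C where "C I J = (SOME c. has_components U \<kappa> (\<beta> I J) c)" for I J
    have "has_components U \<kappa> (\<beta> I J) (C I J)" for I J
      unfolding C_def by (rule someI_ex[OF \<Omega>CS_has_components[OF U \<kappa> assms(3)]])
    then show ?thesis by (rule that)
  qed
  obtain e e' where d: "ext_d \<beta> UNIV UNIV = (\<lambda>p. (\<Sum>i\<in>UNIV. e i * dx i (\<beta> (UNIV - {i}) UNIV) p) +
    (\<Sum>j\<in>UNIV. e' j * dxi j (\<beta> UNIV (UNIV - {j})) p))"
    using ext_d_top_degree[of \<beta>] by (elim exE)
  define b where "b i = C (UNIV - {i}) UNIV (- ?n)" for i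
  \<comment> \<open>One degree higher than for \<open>b\<close>, because the derivative in \<xi>
    lowers the degree by one.\<close>
  define g where "g j = C UNIV (UNIV - {j}) (- ?n + 1)" for j
  define k where "k p = (\<Sum>i\<in>UNIV. e i * dx i (b i) p) + (\<Sum>j\<in>UNIV. e' j * dxi j (g j) p)" for p
  define c where "c a p = (\<Sum>i\<in>UNIV. e i * dx i (C (UNIV - {i}) UNIV a) p)
    + (\<Sum>j\<in>UNIV. e' j * dxi j (C UNIV (UNIV - {j}) (a + 1)) p)" for a p
  have hc: "has_components U \<kappa> (ext_d \<beta> UNIV UNIV) c"
    unfolding d c_def
    by (intro has_components_add has_components_sum has_components_scale[OF U \<kappa>]
        has_components_dx[OF U \<kappa>] has_components_dxi[OF U \<kappa>] C)
  have k: "k = c (- ?n)" by (simp add: fun_eq_iff k_def c_def b_def g_def)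
  have smooth_b: "smooth_on (U \<times> (UNIV - {0})) (b i)" and smooth_g: "smooth_on (U \<times> (UNIV - {0})) (g i)" for i
    unfolding b_def g_def by (rule has_components_smooth_component[OF U \<kappa> C])+
  have b0: "b i (x, \<xi>) = 0" and g0: "g i (x, \<xi>) = 0" if "x \<in> U - K" "\<xi> \<noteq> 0" for i x \<xi>
    unfolding b_def g_def by (rule has_components_zero_on_ray[OF U \<kappa> _ _ C]; use that supp in simp)+
  have hom_k: "pos_homogeneous U (- ?n) k"
    unfolding k by (rule has_components_homogeneous[OF U \<kappa> hc])
  have cont_k: "continuous_on (U \<times> (UNIV - {0})) k"
    unfolding k by (rule smooth_on_continuous_on[OF has_components_smooth_component[OF U \<kappa> hc]])
  note parts_b = phase_extension_by_parts[OF U K smooth_b b0] and parts_g = phase_extension_by_parts[OF U K smooth_g g0]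
  have k0: "k (x, \<xi>) = 0" if "x \<in> U - K" "\<xi> \<noteq> 0" for x \<xi>
    using parts_b(2)[OF _ _ that] parts_g(2)[OF _ _ that] by (simp add: k_def dx_eq_dird dxi_eq_dird)
  have "res_form U \<kappa> (ext_d \<beta>) = (LINT x:U|lborel. sphere_integral (\<lambda>\<xi>. k (x, \<xi>)))"
    unfolding res_form_def res_symbol_def
  proof (rule set_lebesgue_integral_cong)
    show "U \<in> sets lborel" using U by simp
    show "\<forall>x. x \<in> U \<longrightarrow> sphere_integral (\<lambda>\<xi>. component U \<kappa> (ext_d \<beta> UNIV UNIV) (- ?n) (x, \<xi>))
        = sphere_integral (\<lambda>\<xi>. k (x, \<xi>))"
      unfolding k by (intro allI impI sphere_integral_cong component_eq[OF U \<kappa> hc]) auto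
  qed
  moreover have "(LINT p|lborel. phase_extension U k norm_weight p) = 81 / 20 * (LINT x:U|lborel. sphere_integral (\<lambda>\<xi>. k (x, \<xi>)))"
    using sphere_integral_integral_eq[OF U K cont_k k0 hom_k continuous_on_radial_weight(1) radial_weight_support(1)]
    unfolding radial_weight_integral norm_weight_eq[abs_def] .
  moreover have "(LINT p|lborel. phase_extension U k norm_weight p) = 0"
  proof -
    let ?X = "\<lambda>i. phase_extension U (dx i (b i)) norm_weight" and ?Y = "\<lambda>j. phase_extension U (dxi j (g j)) norm_weight"
    have X: "integrable lborel (?X i)" and Y: "integrable lborel (?Y i)" for i
      unfolding dx_eq_dird dxi_eq_dird
      by (intro phase_extension_integrable[OF U K] smooth_on_continuous_on smooth_on_dird smooth_b smooth_g
          norm_weight_continuous norm_weight_support parts_b(2) parts_g(2); assumption)+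
    have "(LINT p|lborel. ?X i p) = 0" for i
    proof -
      \<comment> \<open>The direction \<open>(axis i 1, 0)\<close> has no fibre part, and the weight
        depends on \<xi> alone.\<close>
      have "phase_extension U (b i) (norm_weight' 0) = (\<lambda>p. 0)"
        by (simp add: fun_eq_iff phase_extension_def norm_weight'_def)
      then show ?thesis unfolding dx_eq_dird by (subst parts_b(1)) simp_all
    qed
    moreover have "(LINT p|lborel. ?Y j p) = 0" for j
    proof -
      \<comment> \<open>The derivative of the weight is
        \<open>\<xi> $ j / (norm \<xi>)\<^sup>2\<close> times a radial function. The quotient has
        degree -1, so moving it into \<open>g j\<close> brings the degree from
        \<open>1 - CARD('n)\<close> to \<open>- CARD('n)\<close>, as the polar formula
        requires.\<close>
      let ?h = "\<lambda>p::'n pt. g j p * of_real (snd p $ j / (norm (snd p))\<^sup>2)"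
      have "(LINT p|lborel. ?Y j p) = - (LINT p|lborel. phase_extension U (g j) (norm_weight' (axis j 1)) p)"
        unfolding dxi_eq_dird by (subst parts_g(1)) simp_all
      also have "phase_extension U (g j) (norm_weight' (axis j 1)) = phase_extension U ?h (\<lambda>\<xi>. radial_weight' (norm \<xi>))"
        by (simp add: fun_eq_iff phase_extension_def norm_weight'_eq inner_axis)
      also have "(LINT p|lborel. phase_extension U ?h (\<lambda>\<xi>. radial_weight' (norm \<xi>)) p)
        = (LINT r|lborel. of_real (radial_weight' r / r)) * (LINT x:U|lborel. sphere_integral (\<lambda>\<xi>. ?h (x, \<xi>)))"
      proof (rule sphere_integral_integral_eq[OF U K])
        show "continuous_on (U \<times> (UNIV - {0})) ?h"
          by (intro continuous_intros smooth_on_continuous_on smooth_g) auto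
        show "?h (x, \<xi>) = 0" if "x \<in> U - K" "\<xi> \<noteq> 0" for x \<xi>
          using g0[OF that] by simp
        show "pos_homogeneous U (- ?n) ?h"
        proof (rule pos_homogeneousI)
          fix x and \<xi> :: "(real, 'n) vec" and t :: real assume x: "x \<in> U" "\<xi> \<noteq> 0" "t > 0"
          have "pos_homogeneous U (- ?n + 1) (g j)"
            unfolding g_def by (rule has_components_homogeneous[OF U \<kappa> C])
          moreover have "of_real t powr (- ?n + 1) = of_real t powr (- ?n) * (of_real t :: complex)"
            unfolding powr_add using x by simp
          ultimately have 1: "g j (x, t *\<^sub>R \<xi>) = of_real t powr (- ?n) * of_real t * g j (x, \<xi>)"
            using pos_homogeneousD[of U "- ?n + 1" "g j", OF _ x] by (simp only:)
          have 2: "(t *\<^sub>R \<xi>) $ j / (norm (t *\<^sub>R \<xi>))\<^sup>2 = (\<xi> $ j / (norm \<xi>)\<^sup>2) / t"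
            using x by (simp add: power2_eq_square)
          show "?h (x, t *\<^sub>R \<xi>) = of_real t powr (- ?n) * ?h (x, \<xi>)"
            unfolding snd_conv 1 2 using x by simp
        qed
      qed (use continuous_on_radial_weight(2) radial_weight_support(2) in auto)
      finally show ?thesis unfolding radial_weight'_integral by simp
    qed
    moreover have "phase_extension U k norm_weight p = (\<Sum>i\<in>UNIV. e i * ?X i p) + (\<Sum>j\<in>UNIV. e' j * ?Y j p)" for p
      by (cases "fst p \<in> U \<and> snd p \<noteq> 0")
        (simp_all only: phase_extension_def k_def distrib_right sum_distrib_right mult.assoc if_True if_False
          simp_thms mult_zero_right sum.neutral_const add_0)
    ultimately show ?thesis
      using X Y by (simp add: Bochner_Integration.integral_add Bochner_Integration.integral_sum)
  qed
  ultimately show ?thesis by simp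
qed

end
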